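(* Let $X$ be a nonempty open bounded subset of $\mathbb{R}^n$. Let $C^{1,0}$ be the set of bounded differentiable functions $X\to\mathbb{R}$ with continuous bounded gradient, and consider the classical gradient as an operator $\partial:C^{1,0}\subset C_{ae}(X,\mathbb{R})\to C_{ae}(X,\mathbb{R}^n)$. (i) The operator $\partial$ is preclosed. Let $\boldsymbol{\partial}$ denote its closure and $\Delta$ its domain. Then $i(\Delta)\subset\Delta_{cm}$; hence every $f\in\Delta$ contains a locally Lipschitz function (with which it is identified), and for every $x\in X$ one has $\boldsymbol{\partial} f(x)=\partial_C f(x)$ as convex subsets of $\mathbb{R}^n$. (ii) $\Delta$ is a linear subspace of $C_{ae}(X,\mathbb{R})$ and $\boldsymbol{\partial}$ is linear: $\boldsymbol{\partial}(\lambda f+g)=\lambda\boldsymbol{\partial}f+\boldsymbol{\partial}g$ for all $f,g\in\Delta$, $\lambda\in\mathbb{R}$. (iii) $\Delta$ is a subring of the commutative ring $C_{ae}(X,\mathbb{R})$ and $\boldsymbol{\partial}(f\cdot g)=f\cdot\boldsymbol{\partial}g+g\cdot\boldsymbol{\partial}f$ for all $f,g\in\Delta$.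
   Context: $C_{ae}(X,\mathbb{R}^m)$ is the set of equivalence classes of bounded maps $X\to\mathbb{R}^m$ continuous at almost every point (Lebesgue), two maps being equivalent if they coincide almost everywhere; vector space, ring ($m=1$), and module-over-$C_{ae}(X,\mathbb{R})$ operations and (for $m=1$) the order ($\le$ a.e.) are defined on representatives. For $f\in C_{ae}(X,\mathbb{R})$, $k\in\mathbb{N}$: $f_k^-=\sup\{\varphi\in Lip_k(X,\mathbb{R}):\varphi\le f\}$, $f_k^+=\inf\{\varphi\in Lip_k(X,\mathbb{R}):\varphi\ge f\}$ ($Lip_k$ = $k$-Lipschitz functions, inequalities a.e.). For bounded continuous $\varphi,\psi$, $h(\varphi,\psi)$ is the Hausdorff distance between closures of graphs in $\mathrm{cl}X\times\mathbb{R}$ and $\delta(\varphi,\psi)=h(\varphi,\psi)+\int_X|\varphi-\psi|\,dx$. Metric: $r(f,g)=\sup_k\max\{\delta(f_k^-,g_k^-),\delta(f_k^+,g_k^+)\}$ for $m=1$, and $r(f,g)=\sup_{\|\xi\|=1}r(\langle f(\cdot),\xi\rangle,\langle g(\cdot),\xi\rangle)$ for general $m$, where $\langle f(\cdot),\xi\rangle$ is the class of $x\mapsto\langle\varphi(x),\xi\rangle$. Similarly $C_{cm}(X,\mathbb{R}^m)$ is the set of classes of bounded maps whose continuity points form a comeager set (complement a countable union of nowhere dense sets), modulo coincidence on a comeager set, with the analogous metric $s$ built from $h$ alone (with the same $f_k^\pm$ defined via inequalities on comeager sets). A map continuous a.e. is continuous on a comeager set, giving the inclusion $i:C_{ae}(X,\mathbb{R}^m)\to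 C_{cm}(X,\mathbb{R}^m)$. $\Delta_{cm}$ is the domain of the closure of the gradient operator $C^{1,0}\subset C_{cm}(X,\mathbb{R})\to C_{cm}(X,\mathbb{R}^n)$. The value of a class $f$ at $x$ is $f(x)=\bigcap_{\varepsilon>0}\overline{\mathrm{co}}\{\varphi(y):y\in B(x,\varepsilon)\cap C_\varphi\}$, $\varphi\in f$, $C_\varphi$ its continuity set. Preclosed operator: $f_i,g_i$ in the domain, $\lim f_i=\lim g_i$, $Af_i\to F$, $Ag_i\to G$ imply $F=G$; closure: $Af=\lim Af_i$ on the set of $f$ admitting $f_i\to f$ with $(Af_i)$ convergent. Clarke gradient of a locally Lipschitz $f$: $\partial_Cf(x)=\bigcap_{\varepsilon>0}\overline{\mathrm{co}}\{\partial f(x'):x'\in\mathcal{D}(f)\cap B(x,\varepsilon)\}$, $\mathcal{D}(f)$ the differentiability set. *)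

theory Defs
  imports "HOL-Analysis.Analysis"
begin

text \<open>Elements of C_ae(X,R^m) and C_cm(X,R^m) are represented by their representatives
(functions on the ambient type, of which only the values on X matter); the equivalence
relations, metrics and operations are all expressed on representatives.\<close>

definition cont_pts :: "'a::t2_space set \<Rightarrow> ('a \<Rightarrow> 'b::topological_space) \<Rightarrow> 'a set" where
  "cont_pts X f = {x \<in> X. continuous (at x within X) f}"

definition nowhere_dense :: "'a::topological_space set \<Rightarrow> bool" where
  "nowhere_dense A \<longleftrightarrow> interior (closure A) = {}"

definition meager :: "'a::topological_space set \<Rightarrow> bool" where
  "meager M \<longleftrightarrow> (\<exists>N. countable N \<and> (\<forall>A\<in>N. nowhere_dense A) \<and> M \<subseteq> \<Union>N)"

definition comeager_in :: "'a::topological_space set \<Rightarrow> 'a set \<Rightarrow> bool" where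
  "comeager_in X S \<longleftrightarrow> meager (X - S)"

definition hausdorff_dist :: "'a::metric_space set \<Rightarrow> 'a set \<Rightarrow> real" where
  "hausdorff_dist S T = max (SUP x\<in>S. infdist x T) (SUP y\<in>T. infdist y S)"

definition graph_on :: "'a set \<Rightarrow> ('a \<Rightarrow> 'b) \<Rightarrow> ('a \<times> 'b) set" where
  "graph_on X f = {(x, f x) | x. x \<in> X}"

definition hgraph :: "'a::euclidean_space set \<Rightarrow> ('a \<Rightarrow> real) \<Rightarrow> ('a \<Rightarrow> real) \<Rightarrow> real" where
  "hgraph X \<phi> \<psi> = hausdorff_dist (closure (graph_on X \<phi>)) (closure (graph_on X \<psi>))"

definition delta :: "'a::euclidean_space set \<Rightarrow> ('a \<Rightarrow> real) \<Rightarrow> ('a \<Rightarrow> real) \<Rightarrow> real" where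
  "delta X \<phi> \<psi> = hgraph X \<phi> \<psi> + (LINT x:X|lebesgue. \<bar>\<phi> x - \<psi> x\<bar>)"

definition cae :: "'a::euclidean_space set \<Rightarrow> ('a \<Rightarrow> 'b::real_normed_vector) \<Rightarrow> bool" where
  "cae X f \<longleftrightarrow> bounded (f ` X) \<and> X - cont_pts X f \<in> null_sets lebesgue"

definition ae_eq :: "'a::euclidean_space set \<Rightarrow> ('a \<Rightarrow> 'b) \<Rightarrow> ('a \<Rightarrow> 'b) \<Rightarrow> bool" where
  "ae_eq X f g \<longleftrightarrow> (AE x in lebesgue. x \<in> X \<longrightarrow> f x = g x)"

definition lenv_ae :: "'a::euclidean_space set \<Rightarrow> nat \<Rightarrow> ('a \<Rightarrow> real) \<Rightarrow> 'a \<Rightarrow> real" where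
  "lenv_ae X k f x = Sup ((\<lambda>\<phi>. \<phi> x) `
      {\<phi>. (real k)-lipschitz_on X \<phi> \<and> (AE y in lebesgue. y \<in> X \<longrightarrow> \<phi> y \<le> f y)})"

definition uenv_ae :: "'a::euclidean_space set \<Rightarrow> nat \<Rightarrow> ('a \<Rightarrow> real) \<Rightarrow> 'a \<Rightarrow> real" where
  "uenv_ae X k f x = Inf ((\<lambda>\<phi>. \<phi> x) `
      {\<phi>. (real k)-lipschitz_on X \<phi> \<and> (AE y in lebesgue. y \<in> X \<longrightarrow> f y \<le> \<phi> y)})"

definition r_ae :: "'a::euclidean_space set \<Rightarrow> ('a \<Rightarrow> real) \<Rightarrow> ('a \<Rightarrow> real) \<Rightarrow> real" where
  "r_ae X f g = (SUP k\<in>{1::nat..}. max (delta X (lenv_ae X k f) (lenv_ae X k g))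
                                       (delta X (uenv_ae X k f) (uenv_ae X k g)))"

definition rv_ae :: "'a::euclidean_space set \<Rightarrow> ('a \<Rightarrow> 'b::euclidean_space) \<Rightarrow> ('a \<Rightarrow> 'b) \<Rightarrow> real" where
  "rv_ae X f g = (SUP \<xi>\<in>{\<xi>::'b. norm \<xi> = 1}. r_ae X (\<lambda>x. f x \<bullet> \<xi>) (\<lambda>x. g x \<bullet> \<xi>))"

definition ccm :: "'a::euclidean_space set \<Rightarrow> ('a \<Rightarrow> 'b::real_normed_vector) \<Rightarrow> bool" where
  "ccm X f \<longleftrightarrow> bounded (f ` X) \<and> comeager_in X (cont_pts X f)"

definition lenv_cm :: "'a::euclidean_space set \<Rightarrow> nat \<Rightarrow> ('a \<Rightarrow> real) \<Rightarrow> 'a \<Rightarrow> real" where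
  "lenv_cm X k f x = Sup ((\<lambda>\<phi>. \<phi> x) `
      {\<phi>. (real k)-lipschitz_on X \<phi> \<and> (\<exists>S. comeager_in X S \<and> (\<forall>y\<in>S \<inter> X. \<phi> y \<le> f y))})"

definition uenv_cm :: "'a::euclidean_space set \<Rightarrow> nat \<Rightarrow> ('a \<Rightarrow> real) \<Rightarrow> 'a \<Rightarrow> real" where
  "uenv_cm X k f x = Inf ((\<lambda>\<phi>. \<phi> x) `
      {\<phi>. (real k)-lipschitz_on X \<phi> \<and> (\<exists>S. comeager_in X S \<and> (\<forall>y\<in>S \<inter> X. f y \<le> \<phi> y))})"

definition s_cm :: "'a::euclidean_space set \<Rightarrow> ('a \<Rightarrow> real) \<Rightarrow> ('a \<Rightarrow> real) \<Rightarrow> real" where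
  "s_cm X f g = (SUP k\<in>{1::nat..}. max (hgraph X (lenv_cm X k f) (lenv_cm X k g))
                                       (hgraph X (uenv_cm X k f) (uenv_cm X k g)))"

definition sv_cm :: "'a::euclidean_space set \<Rightarrow> ('a \<Rightarrow> 'b::euclidean_space) \<Rightarrow> ('a \<Rightarrow> 'b) \<Rightarrow> real" where
  "sv_cm X f g = (SUP \<xi>\<in>{\<xi>::'b. norm \<xi> = 1}. s_cm X (\<lambda>x. f x \<bullet> \<xi>) (\<lambda>x. g x \<bullet> \<xi>))"

definition c10_grad :: "'a::euclidean_space set \<Rightarrow> ('a \<Rightarrow> real) \<Rightarrow> ('a \<Rightarrow> 'a) \<Rightarrow> bool" where
  "c10_grad X f D \<longleftrightarrow> bounded (f ` X) \<and> (\<forall>x\<in>X. GDERIV f x :> D x)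
      \<and> continuous_on X D \<and> bounded (D ` X)"

definition grad_cl_ae :: "'a::euclidean_space set \<Rightarrow> ('a \<Rightarrow> real) \<Rightarrow> ('a \<Rightarrow> 'a) \<Rightarrow> bool" where
  "grad_cl_ae X f F \<longleftrightarrow> cae X f \<and> cae X F \<and>
     (\<exists>fs Ds. (\<forall>i. c10_grad X (fs i) (Ds i)) \<and>
        (\<lambda>i. r_ae X (fs i) f) \<longlonglongrightarrow> 0 \<and> (\<lambda>i. rv_ae X (Ds i) F) \<longlonglongrightarrow> 0)"

definition Delta_ae :: "'a::euclidean_space set \<Rightarrow> ('a \<Rightarrow> real) set" where
  "Delta_ae X = {f. \<exists>F. grad_cl_ae X f F}"

definition grad_cl_cm :: "'a::euclidean_space set \<Rightarrow> ('a \<Rightarrow> real) \<Rightarrow> ('a \<Rightarrow> 'a) \<Rightarrow> bool" where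
  "grad_cl_cm X f F \<longleftrightarrow> ccm X f \<and> ccm X F \<and>
     (\<exists>fs Ds. (\<forall>i. c10_grad X (fs i) (Ds i)) \<and>
        (\<lambda>i. s_cm X (fs i) f) \<longlonglongrightarrow> 0 \<and> (\<lambda>i. sv_cm X (Ds i) F) \<longlonglongrightarrow> 0)"

definition Delta_cm :: "'a::euclidean_space set \<Rightarrow> ('a \<Rightarrow> real) set" where
  "Delta_cm X = {f. \<exists>F. grad_cl_cm X f F}"

definition class_value :: "'a::euclidean_space set \<Rightarrow> ('a \<Rightarrow> 'b::euclidean_space) \<Rightarrow> 'a \<Rightarrow> 'b set" where
  "class_value X \<phi> x = (\<Inter>\<epsilon>\<in>{0<..}. closure (convex hull (\<phi> ` (ball x \<epsilon> \<inter> cont_pts X \<phi>))))"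

definition locally_lipschitz_on :: "'a::metric_space set \<Rightarrow> ('a \<Rightarrow> 'b::metric_space) \<Rightarrow> bool" where
  "locally_lipschitz_on X f \<longleftrightarrow> (\<forall>x\<in>X. \<exists>\<epsilon>>0. \<exists>L. L-lipschitz_on (ball x \<epsilon> \<inter> X) f)"

definition clarke_grad :: "'a::euclidean_space set \<Rightarrow> ('a \<Rightarrow> real) \<Rightarrow> 'a \<Rightarrow> 'a set" where
  "clarke_grad X f x = (\<Inter>\<epsilon>\<in>{0<..}. closure (convex hull
      {D. \<exists>x'\<in>ball x \<epsilon> \<inter> X. GDERIV f x' :> D}))"

end

(*
  On X the k-Lipschitz envelopes are infimal convolutions over any set of continuity points with null
  complement, so r-convergence yields uniform convergence of each k-envelope. If F . xi <= c near x, then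
  the upper envelopes of D_i . xi, hence the gradients D_i . xi themselves, are eventually below c + e near
  x. Thus the f_i are eventually Lipschitz on segments with a common constant and converge to a locally
  Lipschitz u, and integrating the bound gives u(b) - u(a) <= c t for b - a = t xi. At a continuity point y
  of F this says that u has gradient F(y); together with separation of convex sets it also identifies the
  Clarke gradient with the value of the class F. Preclosedness follows.

  Conversely, if u is Lipschitz on segments and has gradient F at almost every point, where F is bounded
  and a.e. continuous, then (u, F) is in the closed graph; sums and products preserve this description.
  The converse cannot be proved by adding approximating sequences, since addition is not continuous for
  the metric: opposite jumps smoothed at slightly different places leave a spike. Instead u is replaced by
  its averages over cubes of variable size eps(x). The difficulty is that the graph distance of the
  k-envelopes has to be small uniformly in k up to an arbitrary boundary. This is achieved by letting eps
  decay very fast at the boundary, depending on the modulus of continuity of F at finitely many points on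
  each layer.
*)

theory Submission
  imports Defs
begin

section \<open>Lipschitz envelopes and the metrics\<close>

text \<open>The two parts of the metric are reached differently. Up to \<eta>, the envelopes at x
  either differ little or both lie between the extreme values of F . \<xi> near x. So their
  difference is bounded by the oscillation of F at scale \<eta> plus 4 \<eta>, and the integral of
  this oscillation tends to 0 because F is continuous a.e. For the graphs it is enough to find x'
  near x with almost the same value. The intermediate value theorem provides it, since both
  envelopes come close to both extremes near x. For that an extreme value has to persist at a fixed
  scale, although continuity at the points of S holds with no common modulus; total boundedness of
  the graph of F is the substitute. When k is too small for that scale, a second, finer family of
  points is used. All radii are chosen from the vector F and not from F . \<xi>, so that one
  approximation serves every unit vector \<xi>. The variation of \<epsilon> adds a term to the
  gradient of the average; a bound \<tau> on the gradient of \<epsilon> keeps it at most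
  \<eta>.\<close>

lemma conull_meets_open:
  fixes X :: "'a::euclidean_space set"
  assumes "open X" "X - S \<in> null_sets lebesgue" "open U" "U \<inter> X \<noteq> {}"
  shows "\<exists>y\<in>S. y \<in> U \<inter> X"
proof (rule ccontr)
  assume "\<not> ?thesis"
  then have "U \<inter> X \<subseteq> X - S" by auto
  then have "negligible (U \<inter> X)"
    using assms(2) negligible_iff_null_sets negligible_subset by blast
  then show False using assms open_not_negligible by blast
qed

text \<open>The McShane (Pasch-Hausdorff) formula: for \<open>k \<ge> 0\<close> and \<open>f\<close>
  bounded below on a nonempty \<open>S\<close>, this is the largest \<open>k\<close>-Lipschitz
  function lying below \<open>f\<close> on \<open>S\<close>.\<close>

definition infconv :: "real \<Rightarrow> 'a::metric_space set \<Rightarrow> ('a \<Rightarrow> real) \<Rightarrow> 'a \<Rightarrow> real" where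
  "infconv k S f x = (INF y\<in>S. f y + k * dist x y)"

lemma infconv_le:
  assumes "0 \<le> k" "\<And>y. y \<in> S \<Longrightarrow> m \<le> f y" "y \<in> S"
  shows "infconv k S f x \<le> f y + k * dist x y"
  unfolding infconv_def
proof (rule cINF_lower)
  show "bdd_below ((\<lambda>y. f y + k * dist x y) ` S)"
    by (intro bdd_belowI2[where m=m]) (use assms in \<open>auto intro!: order_trans[OF assms(2)]\<close>)
qed fact

lemma infconv_ge:
  assumes "S \<noteq> {}" "\<And>y. y \<in> S \<Longrightarrow> c \<le> f y + k * dist x y"
  shows "c \<le> infconv k S f x"
  unfolding infconv_def using assms by (intro cINF_greatest) auto

lemma infconv_lipschitz:
  assumes "0 \<le> k" "\<And>y. y \<in> S \<Longrightarrow> m \<le> f y" "S \<noteq> {}"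
  shows "k-lipschitz_on A (infconv k S f)"
proof (rule lipschitz_onI)
  have *: "infconv k S f x \<le> infconv k S f x' + k * dist x x'" for x x'
  proof -
    have "infconv k S f x - k * dist x x' \<le> infconv k S f x'"
    proof (rule infconv_ge[OF assms(3)])
      fix y assume y: "y \<in> S"
      have "infconv k S f x \<le> f y + k * dist x y"
        by (rule infconv_le[OF assms(1,2) y])
      also have "\<dots> \<le> f y + k * (dist x x' + dist x' y)"
        using assms(1) by (intro add_left_mono mult_left_mono dist_triangle)
      finally show "infconv k S f x - k * dist x x' \<le> f y + k * dist x' y"
        by (simp add: algebra_simps)
    qed
    then show ?thesis by simp
  qed
  show "dist (infconv k S f x) (infconv k S f y) \<le> k * dist x y" for x y
    using *[of x y] *[of y x] by (simp add: dist_real_def dist_commute)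
qed fact

lemma cont_ptsD: "x \<in> cont_pts X f \<Longrightarrow> x \<in> X" "x \<in> cont_pts X f \<Longrightarrow> continuous (at x within X) f"
  by (auto simp: cont_pts_def)

lemma cont_pts_continuous_on: "continuous_on X f \<Longrightarrow> cont_pts X f = X"
  by (auto simp: cont_pts_def continuous_on_eq_continuous_within)

lemma cont_pts_minus: "cont_pts X (\<lambda>x. - f x :: real) = cont_pts X f"
proof -
  have "continuous (at x within X) (\<lambda>x. - f x) \<Longrightarrow> continuous (at x within X) f" for x
    using continuous_minus[of "at x within X" "\<lambda>x. - f x"] by simp
  then show ?thesis by (auto simp: cont_pts_def intro: continuous_minus)
qed

lemma cont_pts_inner: "cont_pts X F \<subseteq> cont_pts X (\<lambda>x. F x \<bullet> \<xi>)"
  by (auto simp: cont_pts_def intro!: continuous_intros)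

text \<open>Strict positivity of \<open>\<phi> - f\<close> at a continuity point persists nearby, so
  it cannot coexist with points of \<open>\<phi> \<le> f\<close> in every open set. The hypothesis
  \<open>meets\<close> is what conull and comeager sets have in common, so one proof serves both
  kinds of envelopes.\<close>

lemma le_at_cont_pt:
  fixes f \<phi> :: "'a::t2_space \<Rightarrow> real"
  assumes X: "open X" and y: "y \<in> cont_pts X f" and \<phi>: "continuous_on X \<phi>"
    and meets: "\<And>U. open U \<Longrightarrow> U \<inter> X \<noteq> {} \<Longrightarrow> \<exists>z\<in>U \<inter> X. \<phi> z \<le> f z"
  shows "\<phi> y \<le> f y"
proof (rule ccontr)
  assume "\<not> \<phi> y \<le> f y"
  then have "0 < \<phi> y - f y" by simp
  moreover have "continuous (at y within X) (\<lambda>z. \<phi> z - f z)"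
    using y \<phi> by (auto simp: cont_pts_def continuous_on_eq_continuous_within intro!: continuous_intros)
  ultimately have "\<forall>\<^sub>F z in at y within X. 0 < \<phi> z - f z"
    unfolding continuous_within by (rule order_tendstoD(1)[rotated])
  then obtain U where U: "open U" "y \<in> U" "\<And>z. z \<in> U \<Longrightarrow> z \<noteq> y \<Longrightarrow> z \<in> X \<Longrightarrow> 0 < \<phi> z - f z"
    unfolding eventually_at_topological by blast
  have "U \<inter> X \<noteq> {}" using U y cont_ptsD(1) by blast
  from meets[OF U(1) this] U(3) \<open>\<not> \<phi> y \<le> f y\<close> show False by force
qed

lemma bounded_realD:
  assumes "bounded (f ` X :: real set)" obtains M where "M \<ge> 0" "\<And>x. x \<in> X \<Longrightarrow> \<bar>f x\<bar> \<le> M"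
proof -
  obtain M where "\<forall>x\<in>f ` X. norm x \<le> M" using assms bounded_iff by blast
  then show ?thesis by (intro that[of "max M 0"]) auto
qed

text \<open>The supremum is a maximum, attained by \<open>infconv\<close> itself. The predicate
  \<open>P\<close> stands for the inequality almost everywhere or on a comeager set; on Lipschitz
  functions either one amounts to the inequality on \<open>S\<close>.\<close>

lemma Sup_lipschitz_minorants:
  assumes S: "S \<noteq> {}" "S \<subseteq> X" "x \<in> X" and b: "\<And>y. y \<in> S \<Longrightarrow> m \<le> f y" and "0 \<le> k"
    and P: "\<And>\<phi>. k-lipschitz_on X \<phi> \<Longrightarrow> P \<phi> \<longleftrightarrow> (\<forall>y\<in>S. \<phi> y \<le> f y)"
  shows "Sup ((\<lambda>\<phi>. \<phi> x) ` {\<phi>. k-lipschitz_on X \<phi> \<and> P \<phi>}) = infconv k S f x"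
proof (rule cSup_eq_maximum)
  note lip = infconv_lipschitz[where f=f, OF \<open>0 \<le> k\<close> b S(1)]
  have "infconv k S f y \<le> f y" if "y \<in> S" for y
    using infconv_le[where f=f and k=k and x=y, OF \<open>0 \<le> k\<close> b that] by simp
  then show "infconv k S f x \<in> (\<lambda>\<phi>. \<phi> x) ` {\<phi>. k-lipschitz_on X \<phi> \<and> P \<phi>}"
    using lip[of X] P[OF lip] by blast
  fix z assume "z \<in> (\<lambda>\<phi>. \<phi> x) ` {\<phi>. k-lipschitz_on X \<phi> \<and> P \<phi>}"
  then obtain \<phi> where \<phi>: "z = \<phi> x" "k-lipschitz_on X \<phi>" "\<forall>y\<in>S. \<phi> y \<le> f y" using P by blast
  show "z \<le> infconv k S f x" unfolding \<phi>(1)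
  proof (rule infconv_ge[OF S(1)])
    fix y assume y: "y \<in> S"
    have "dist (\<phi> x) (\<phi> y) \<le> k * dist x y"
      using \<phi>(2) y S by (auto dest: lipschitz_onD)
    then show "\<phi> x \<le> f y + k * dist x y" using \<phi>(3) y by (fastforce simp: dist_real_def)
  qed
qed

text \<open>A Lipschitz function below \<open>f\<close> almost everywhere is below \<open>f\<close>
  at each continuity point of \<open>f\<close>, and conversely \<open>S\<close> is conull.
  \<open>S\<close> is left free: it will be all of \<open>X\<close> for continuous approximants, and
  a conull set independent of the direction for the limit gradient.\<close>

lemma lenv_ae_eq:
  assumes X: "open X" "x \<in> X" and b: "bounded (f ` X)"
    and S: "S \<subseteq> cont_pts X f" "X - S \<in> null_sets lebesgue"
  shows "lenv_ae X k f x = infconv k S f x"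
proof -
  obtain M where M: "\<And>x. x \<in> X \<Longrightarrow> \<bar>f x\<bar> \<le> M" using bounded_realD[OF b] by blast
  have SX: "S \<subseteq> X" using S cont_ptsD(1) by blast
  have ne: "S \<noteq> {}" using conull_meets_open[OF X(1) S(2) X(1)] X by auto
  have iff: "(AE y in lebesgue. y \<in> X \<longrightarrow> \<phi> y \<le> f y) \<longleftrightarrow> (\<forall>y\<in>S. \<phi> y \<le> f y)"
    if "(real k)-lipschitz_on X \<phi>" for \<phi>
  proof
    assume "AE y in lebesgue. y \<in> X \<longrightarrow> \<phi> y \<le> f y"
    then obtain N where N: "{y \<in> space lebesgue. \<not> (y \<in> X \<longrightarrow> \<phi> y \<le> f y)} \<subseteq> N" "N \<in> null_sets lebesgue"
      by (auto elim!: AE_E simp: null_sets_def)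
    have N': "X - (X - N) \<in> null_sets lebesgue"
      using N(2) negligible_subset[of N "X - (X - N)"] by (auto simp: negligible_iff_null_sets)
    show "\<forall>y\<in>S. \<phi> y \<le> f y"
    proof (intro ballI le_at_cont_pt[OF X(1)])
      show "continuous_on X \<phi>" using that by (rule lipschitz_on_continuous_on)
      fix U :: "'a set" assume U: "open U" "U \<inter> X \<noteq> {}"
      from conull_meets_open[OF X(1) N' this] N(1) show "\<exists>z\<in>U \<inter> X. \<phi> z \<le> f z" by auto
    qed (use S in auto)
  next
    assume *: "\<forall>y\<in>S. \<phi> y \<le> f y"
    show "AE y in lebesgue. y \<in> X \<longrightarrow> \<phi> y \<le> f y"
      by (rule AE_I'[OF S(2)]) (use * in auto)
  qed
  have lb: "- M \<le> f y" if "y \<in> S" for y using M[of y] that SX by force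
  show ?thesis
    unfolding lenv_ae_def
  proof (rule Sup_lipschitz_minorants)
    show "S \<noteq> {}" "S \<subseteq> X" "x \<in> X" "0 \<le> real k" using ne SX X(2) by auto
    show "- M \<le> f y" if "y \<in> S" for y using lb[OF that] .
    show "(AE y in lebesgue. y \<in> X \<longrightarrow> \<phi> y \<le> f y) \<longleftrightarrow> (\<forall>y\<in>S. \<phi> y \<le> f y)"
      if "(real k)-lipschitz_on X \<phi>" for \<phi> by (rule iff[OF that])
  qed
qed

text \<open>Negation exchanges majorants and minorants; facts on upper envelopes are drawn from
  those on lower ones in this way.\<close>

lemma Inf_lipschitz_majorants:
  assumes "\<And>\<phi>. P \<phi> \<longleftrightarrow> Q (\<lambda>x. - \<phi> x)"
  shows "Inf ((\<lambda>\<phi>. \<phi> x) ` {\<phi>. k-lipschitz_on X \<phi> \<and> P \<phi>})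
    = - Sup ((\<lambda>\<phi>. \<phi> x) ` {\<phi>. k-lipschitz_on X \<phi> \<and> Q \<phi>} :: real set)"
proof -
  have "uminus ` (\<lambda>\<phi>. \<phi> x) ` {\<phi>. k-lipschitz_on X \<phi> \<and> P \<phi>}
     = (\<lambda>\<phi>. \<phi> x) ` {\<phi>. k-lipschitz_on X \<phi> \<and> Q \<phi>}" (is "?A = ?B")
  proof (intro equalityI subsetI)
    fix z assume "z \<in> ?A"
    then obtain \<phi> where "z = - \<phi> x" "k-lipschitz_on X \<phi>" "P \<phi>" by auto
    then show "z \<in> ?B" by (intro image_eqI[of _ _ "\<lambda>x. - \<phi> x"]) (simp_all add: assms)
  next
    fix z assume "z \<in> ?B"
    then obtain \<phi> where "z = \<phi> x" "k-lipschitz_on X \<phi>" "Q \<phi>" by auto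
    then show "z \<in> ?A"
      unfolding image_image by (intro image_eqI[of _ _ "\<lambda>x. - \<phi> x"]) (simp_all add: assms)
  qed
  then show ?thesis unfolding Inf_real_def by simp
qed

lemma uenv_ae_minus: "uenv_ae X k f x = - lenv_ae X k (\<lambda>x. - f x) x"
  unfolding uenv_ae_def lenv_ae_def by (rule Inf_lipschitz_majorants) simp

lemma uenv_cm_minus: "uenv_cm X k f x = - lenv_cm X k (\<lambda>x. - f x) x"
  unfolding uenv_cm_def lenv_cm_def by (rule Inf_lipschitz_majorants) simp

lemma uenv_ae_eq:
  assumes "open X" "x \<in> X" "bounded (f ` X)"
    and "S \<subseteq> cont_pts X f" "X - S \<in> null_sets lebesgue"
  shows "uenv_ae X k f x = - infconv k S (\<lambda>x. - f x) x"
proof -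
  have "bounded ((\<lambda>x. - f x) ` X)" using assms(3) by (auto simp: bounded_iff)
  moreover have "S \<subseteq> cont_pts X (\<lambda>x. - f x)"
    using assms(4) unfolding cont_pts_minus .
  ultimately show ?thesis
    unfolding uenv_ae_minus using lenv_ae_eq[OF assms(1,2) _ _ assms(5)] by simp
qed

section \<open>Hausdorff distances between graphs\<close>

lemma infdist_closure: "infdist x (closure A) = infdist x A"
  unfolding infdist_eq_setdist by (rule setdist_closure_2)

lemma hausdorff_le:
  assumes "S \<noteq> {}" "T \<noteq> {}" "\<And>x. x \<in> S \<Longrightarrow> infdist x T \<le> e" "\<And>x. x \<in> T \<Longrightarrow> infdist x S \<le> e"
  shows "hausdorff_dist S T \<le> e"
  unfolding hausdorff_dist_def using assms by (auto intro!: cSUP_least)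

text \<open>\<open>hausdorff_dist\<close> is a supremum of reals; boundedness of \<open>S\<close> is
  what makes that supremum a true upper bound.\<close>

lemma hausdorff_ge:
  assumes "bounded S" "T \<noteq> {}" "x \<in> S"
  shows "infdist x T \<le> hausdorff_dist S T"
proof -
  obtain t where t: "t \<in> T" using assms by blast
  obtain e where "\<forall>y\<in>S. dist t y \<le> e" using assms(1) bounded_any_center[of S t] by blast
  then have "bdd_above ((\<lambda>x. infdist x T) ` S)"
    using t by (intro bdd_aboveI2[where M=e] infdist_le2[of t]) (auto simp: dist_commute)
  then have "infdist x T \<le> (SUP x\<in>S. infdist x T)" using assms(3) by (rule cSUP_upper2) auto
  then show ?thesis by (simp add: hausdorff_dist_def)
qed

text \<open>Horizontal error \<open>a\<close> and vertical error \<open>b\<close> add up, as the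
  product distance is at most the sum of the two. The bound passes to the closures because sublevel
  sets of \<open>infdist\<close> are closed.\<close>

lemma hgraph_le:
  assumes "X \<noteq> {}"
    and 1: "\<And>x. x \<in> X \<Longrightarrow> \<exists>x'\<in>X. dist x x' \<le> a \<and> \<bar>\<phi> x - \<psi> x'\<bar> \<le> b"
    and 2: "\<And>x. x \<in> X \<Longrightarrow> \<exists>x'\<in>X. dist x x' \<le> a \<and> \<bar>\<psi> x - \<phi> x'\<bar> \<le> b"
  shows "hgraph X \<phi> \<psi> \<le> a + b"
proof -
  have cl: "infdist z (closure B) \<le> e" if "\<And>z. z \<in> A \<Longrightarrow> infdist z B \<le> e" "z \<in> closure A" for A B z e
  proof -
    have "closure A \<subseteq> {z. infdist z B \<le> e}"
      using that(1) by (intro closure_minimal closed_Collect_le continuous_intros) auto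
    then have "infdist z B \<le> e" using that(2) by blast
    then show ?thesis by (simp add: infdist_closure)
  qed
  have d: "infdist z (graph_on X q) \<le> a + b"
    if pq: "\<And>x. x \<in> X \<Longrightarrow> \<exists>x'\<in>X. dist x x' \<le> a \<and> \<bar>p x - q x'\<bar> \<le> b"
      and z: "z \<in> graph_on X p"
    for p q :: "_ \<Rightarrow> real" and z
  proof -
    obtain x where x: "x \<in> X" "z = (x, p x)" using z by (auto simp: graph_on_def)
    from pq[OF x(1)] obtain x' where x': "x' \<in> X" "dist x x' \<le> a" "\<bar>p x - q x'\<bar> \<le> b" by auto
    have "dist z (x', q x') \<le> dist x x' + dist (p x) (q x')"
      unfolding x(2) dist_prod_def by (simp add: sqrt_sum_squares_le_sum)
    also have "\<dots> \<le> a + b" using x' by (simp add: dist_real_def)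
    finally show ?thesis
      using x'(1) by (intro infdist_le2[of "(x', q x')"]) (auto simp: graph_on_def)
  qed
  have "graph_on X \<phi> \<noteq> {}" "graph_on X \<psi> \<noteq> {}" using assms(1) by (auto simp: graph_on_def)
  then show ?thesis unfolding hgraph_def
    by (intro hausdorff_le cl[OF d[OF 1]] cl[OF d[OF 2]]) auto
qed

lemma bounded_graph:
  fixes \<phi> :: "'a::metric_space \<Rightarrow> real"
  assumes "bounded X" "\<And>x. x \<in> X \<Longrightarrow> \<bar>\<phi> x\<bar> \<le> M"
  shows "bounded (graph_on X \<phi>)"
proof (rule bounded_subset)
  show "bounded (X \<times> {-M..M})" using assms(1) by (simp add: bounded_Times)
  show "graph_on X \<phi> \<subseteq> X \<times> {-M..M}" using assms(2) by (force simp: graph_on_def abs_le_iff)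
qed

text \<open>The graph of \<open>\<psi>\<close> has a point about \<open>?h\<close> away from
  \<open>(x, \<phi> x)\<close>, and returning to the abscissa \<open>x\<close> changes
  \<open>\<psi>\<close> by at most \<open>k\<close> times that distance. Closeness of graphs becomes
  uniform closeness once one function is Lipschitz.\<close>

lemma hgraph_lipschitz:
  assumes "bounded X" "\<And>x. x \<in> X \<Longrightarrow> \<bar>\<phi> x\<bar> \<le> M" and "k-lipschitz_on X \<psi>" "x \<in> X"
  shows "\<bar>\<phi> x - \<psi> x\<bar> \<le> (1 + k) * hgraph X \<phi> \<psi>"
proof -
  let ?h = "hgraph X \<phi> \<psi>"
  have k: "0 \<le> k" using assms(3) lipschitz_on_nonneg by blast
  have ne: "graph_on X \<psi> \<noteq> {}" using assms(4) by (auto simp: graph_on_def)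
  have "infdist (x, \<phi> x) (closure (graph_on X \<psi>)) \<le> ?h" unfolding hgraph_def
    using assms(4) ne closure_subset[of "graph_on X \<phi>"]
    by (intro hausdorff_ge bounded_closure bounded_graph[OF assms(1,2)]) (auto simp: graph_on_def)
  then have h: "infdist (x, \<phi> x) (graph_on X \<psi>) \<le> ?h" by (simp add: infdist_closure)
  \<comment> \<open>The infimum in \<open>infdist\<close> need not be attained on the graph, so a
    nearest point is taken only up to \<open>e\<close>.\<close>
  have "\<bar>\<phi> x - \<psi> x\<bar> \<le> (1 + k) * (?h + e)" if "e > 0" for e
  proof -
    have "\<exists>z\<in>graph_on X \<psi>. dist (x, \<phi> x) z < ?h + e"
    proof (rule ccontr)
      assume "\<not> ?thesis"
      then have "?h + e \<le> infdist (x, \<phi> x) (graph_on X \<psi>)"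
        using ne by (auto simp: infdist_def not_less intro!: cINF_greatest)
      then show False using h that by simp
    qed
    then obtain x' where x': "x' \<in> X" "dist (x, \<phi> x) (x', \<psi> x') < ?h + e" by (auto simp: graph_on_def)
    have "dist x x' \<le> ?h + e" "\<bar>\<phi> x - \<psi> x'\<bar> \<le> ?h + e"
      using x'(2) dist_fst_le[of "(x, \<phi> x)" "(x', \<psi> x')"] dist_snd_le[of "(x, \<phi> x)" "(x', \<psi> x')"]
      by (auto simp: dist_real_def)
    moreover have "\<bar>\<psi> x' - \<psi> x\<bar> \<le> k * dist x x'"
      using lipschitz_onD[OF assms(3) x'(1) assms(4)] by (simp add: dist_real_def dist_commute)
    moreover have "k * dist x x' \<le> k * (?h + e)" using k calculation by (intro mult_left_mono) auto
    ultimately show ?thesis by (simp add: algebra_simps)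
  qed
  then have "\<bar>\<phi> x - \<psi> x\<bar> / (1 + k) \<le> ?h + e" if "e > 0" for e
    using that k by (simp add: field_simps)
  then have "\<bar>\<phi> x - \<psi> x\<bar> / (1 + k) \<le> ?h" by (rule field_le_epsilon)
  then show ?thesis using k by (simp add: field_simps)
qed

lemma conull_dense:
  fixes X :: "'a::euclidean_space set"
  assumes "open X" "X - S \<in> null_sets lebesgue"
  shows "X \<subseteq> closure S"
proof
  fix x assume "x \<in> X"
  show "x \<in> closure S" unfolding closure_approachable
  proof (intro allI impI)
    fix e :: real assume "e > 0"
    with \<open>x \<in> X\<close> have "ball x e \<inter> X \<noteq> {}" using centre_in_ball by blast
    from conull_meets_open[OF assms open_ball this] show "\<exists>y\<in>S. dist y x < e"
      by (auto simp: dist_commute)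
  qed
qed

text \<open>Points of \<open>S\<close> converging to \<open>x\<close> make the penalty
  \<open>k * dist x y\<close> vanish, so a bound for \<open>f\<close> near \<open>x\<close>
  transfers even when \<open>x\<close> is not in \<open>S\<close>.\<close>

lemma infconv_le_local:
  assumes k: "0 \<le> k" and b: "\<And>y. y \<in> S \<Longrightarrow> m \<le> f y" and x: "x \<in> closure S" and r: "0 < r"
    and c: "\<And>y. y \<in> S \<Longrightarrow> dist x y < r \<Longrightarrow> f y \<le> c"
  shows "infconv k S f x \<le> c"
proof (rule field_le_epsilon)
  fix e :: real assume e: "e > 0"
  then have "0 < min r (e / (k + 1))" using k r by auto
  then obtain y where y: "y \<in> S" "dist y x < min r (e / (k + 1))"
    using x unfolding closure_approachable by blast
  have "infconv k S f x \<le> f y + k * dist x y" by (rule infconv_le[OF k b y(1)])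
  also have "\<dots> \<le> c + k * (e / (k + 1))"
    using y k c[OF y(1)] by (intro add_mono mult_left_mono) (auto simp: dist_commute)
  also have "\<dots> \<le> c + e" using k e by (simp add: field_simps)
  finally show "infconv k S f x \<le> c + e" .
qed

lemma infconv_abs_le:
  assumes "0 \<le> k" "\<And>y. y \<in> S \<Longrightarrow> \<bar>f y\<bar> \<le> M" "x \<in> closure S"
  shows "\<bar>infconv k S f x\<bar> \<le> M"
proof -
  have b: "- M \<le> f y" "f y \<le> M" if "y \<in> S" for y using assms(2)[OF that] by auto
  have "S \<noteq> {}" using assms(3) by auto
  have "infconv k S f x \<le> M"
    by (rule infconv_le_local[OF assms(1) b(1) assms(3) zero_less_one b(2)])
  moreover have "- M \<le> infconv k S f x"
  proof (rule infconv_ge[OF \<open>S \<noteq> {}\<close>])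
    fix y assume "y \<in> S"
    from b(1)[OF this] assms(1) show "- M \<le> f y + k * dist x y" by (simp add: add_increasing2)
  qed
  ultimately show ?thesis by (simp add: abs_le_iff)
qed

lemma cae_conull: "cae X f \<Longrightarrow> X - cont_pts X f \<in> null_sets lebesgue"
  by (simp add: cae_def)

lemma cae_bounded: "cae X f \<Longrightarrow> bounded (f ` X)"
  by (simp add: cae_def)

lemma bounded_normD:
  assumes "bounded (f ` X)" obtains M where "M \<ge> 0" "\<And>x. x \<in> X \<Longrightarrow> norm (f x) \<le> M"
proof -
  obtain M where "\<forall>x\<in>f ` X. norm x \<le> M" using assms bounded_iff by blast
  then show ?thesis by (intro that[of "max M 0"]) auto
qed

lemma cae_of_conull:
  assumes "bounded (f ` X)" "S \<subseteq> cont_pts X f" "X - S \<in> null_sets lebesgue"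
  shows "cae X f"
  using assms negligible_subset[of "X - S" "X - cont_pts X f"]
  by (auto simp: cae_def negligible_iff_null_sets)

lemma cae_continuous: "bounded (f ` X) \<Longrightarrow> continuous_on X f \<Longrightarrow> cae X f"
  by (simp add: cae_def cont_pts_continuous_on)

lemma cae_inner:
  fixes F :: "'a::euclidean_space \<Rightarrow> 'b::euclidean_space"
  assumes "cae X F" shows "cae X (\<lambda>x. F x \<bullet> \<xi>)"
proof (rule cae_of_conull[OF _ cont_pts_inner cae_conull[OF assms]])
  show "bounded ((\<lambda>x. F x \<bullet> \<xi>) ` X)"
    using bounded_linear_image[OF cae_bounded[OF assms] bounded_linear_inner_left[of \<xi>]]
    by (simp add: image_image)
qed

lemma cae_minus: "cae X f \<Longrightarrow> cae X (\<lambda>x. - f x :: real)"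
  unfolding cae_def cont_pts_minus by (auto simp: bounded_iff)

lemma lenv_ae_abs_le:
  assumes "open X" "cae X f" "\<And>x. x \<in> X \<Longrightarrow> \<bar>f x\<bar> \<le> M" "x \<in> X"
  shows "\<bar>lenv_ae X k f x\<bar> \<le> M" "\<bar>uenv_ae X k f x\<bar> \<le> M"
proof -
  have *: "\<bar>lenv_ae X k g x\<bar> \<le> M" if "cae X g" "\<And>x. x \<in> X \<Longrightarrow> \<bar>g x\<bar> \<le> M" for g
    unfolding lenv_ae_eq[OF assms(1,4) cae_bounded[OF that(1)] subset_refl cae_conull[OF that(1)]]
    using that conull_dense[OF assms(1) cae_conull[OF that(1)]] assms(4)
    by (intro infconv_abs_le) (auto dest: cont_ptsD)
  show "\<bar>lenv_ae X k f x\<bar> \<le> M" using * assms by blast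
  show "\<bar>uenv_ae X k f x\<bar> \<le> M"
    using *[OF cae_minus[OF assms(2)]] assms(3) by (simp add: uenv_ae_minus)
qed

lemma lipschitz_on_cong:
  assumes "L-lipschitz_on X f" "\<And>x. x \<in> X \<Longrightarrow> f x = g x"
  shows "L-lipschitz_on X g"
  using assms by (auto simp: lipschitz_on_def)

lemma lenv_ae_lipschitz:
  assumes "open X" "X \<noteq> {}" "cae X f"
  shows "(real k)-lipschitz_on X (lenv_ae X k f)" "(real k)-lipschitz_on X (uenv_ae X k f)"
proof -
  have *: "(real k)-lipschitz_on X (lenv_ae X k g)" if g: "cae X g" for g
  proof -
    obtain M where M: "\<And>x. x \<in> X \<Longrightarrow> \<bar>g x\<bar> \<le> M" using bounded_realD[OF cae_bounded[OF g]] by blast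
    have "cont_pts X g \<noteq> {}" using conull_dense[OF assms(1) cae_conull[OF g]] assms(2) by auto
    then have "(real k)-lipschitz_on X (infconv k (cont_pts X g) g)"
      using M by (intro infconv_lipschitz[where m="-M"]) (auto simp: abs_le_iff dest!: cont_ptsD(1) intro: minus_le_iff[THEN iffD1])
    then show ?thesis
      by (rule lipschitz_on_cong) (simp add: lenv_ae_eq[OF assms(1) _ cae_bounded[OF g] subset_refl cae_conull[OF g]])
  qed
  show "(real k)-lipschitz_on X (lenv_ae X k f)" by (rule *[OF assms(3)])
  show "(real k)-lipschitz_on X (uenv_ae X k f)"
    using *[OF cae_minus[OF assms(3)]] by (rule lipschitz_on_cong[OF lipschitz_on_minus]) (simp add: uenv_ae_minus)
qed

lemma hgraph_le_uniform:
  assumes "X \<noteq> {}" "\<And>x. x \<in> X \<Longrightarrow> \<bar>\<phi> x - \<psi> x\<bar> \<le> b"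
  shows "hgraph X \<phi> \<psi> \<le> b"
proof -
  have "hgraph X \<phi> \<psi> \<le> 0 + b"
  proof (rule hgraph_le[OF assms(1)])
    fix x assume x: "x \<in> X"
    show "\<exists>x'\<in>X. dist x x' \<le> 0 \<and> \<bar>\<phi> x - \<psi> x'\<bar> \<le> b" "\<exists>x'\<in>X. dist x x' \<le> 0 \<and> \<bar>\<psi> x - \<phi> x'\<bar> \<le> b"
      using assms(2)[OF x] x by (auto intro!: bexI[of _ x] simp: abs_minus_commute)
  qed
  then show ?thesis by simp
qed

lemma hgraph_nonneg:
  assumes "X \<noteq> {}" "bounded X" "\<And>x. x \<in> X \<Longrightarrow> \<bar>\<phi> x\<bar> \<le> M"
  shows "0 \<le> hgraph X \<phi> \<psi>"
proof -
  obtain x where "x \<in> X" using assms(1) by blast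
  have "0 \<le> infdist (x, \<phi> x) (closure (graph_on X \<psi>))" by (rule infdist_nonneg)
  also have "\<dots> \<le> hgraph X \<phi> \<psi>" unfolding hgraph_def
    using \<open>x \<in> X\<close> closure_subset[of "graph_on X \<phi>"]
    by (intro hausdorff_ge bounded_closure bounded_graph[OF assms(2,3)]) (auto simp: graph_on_def)
  finally show ?thesis .
qed

lemma set_integral_abs_le:
  fixes \<phi> :: "'a::euclidean_space \<Rightarrow> real"
  assumes "X \<in> lmeasurable" "\<And>x. x \<in> X \<Longrightarrow> \<bar>\<phi> x\<bar> \<le> b"
  shows "(LINT x:X|lebesgue. \<bar>\<phi> x\<bar>) \<le> b * measure lebesgue X"
proof -
  have "(LINT x:X|lebesgue. \<bar>\<phi> x\<bar>) \<le> (LINT x|lebesgue. indicator X x * b)"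
    unfolding set_lebesgue_integral_def
  proof (rule integral_mono')
    show "integrable lebesgue (\<lambda>x. indicator X x * b)"
      using assms(1) by (intro integrable_mult_left) (auto simp: fmeasurable_def)
    show "indicator X x *\<^sub>R \<bar>\<phi> x\<bar> \<le> indicator X x * b" for x
      using assms(2) by (auto simp: indicator_def)
    show "0 \<le> indicator X x * b" for x
      using assms(2)[of x] by (auto simp: indicator_def intro: order_trans[OF abs_ge_zero])
  qed
  also have "\<dots> = b * measure lebesgue X" by (simp add: mult.commute)
  finally show ?thesis .
qed

lemma set_integral_abs_nonneg: "0 \<le> (LINT x:X|M. \<bar>\<phi> x :: real\<bar>)"
  unfolding set_lebesgue_integral_def by (intro Bochner_Integration.integral_nonneg) auto

lemma delta_le_uniform:
  assumes "X \<noteq> {}" "X \<in> lmeasurable" "\<And>x. x \<in> X \<Longrightarrow> \<bar>\<phi> x - \<psi> x\<bar> \<le> b"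
  shows "delta X \<phi> \<psi> \<le> b + b * measure lebesgue X"
  unfolding delta_def
  by (intro add_mono hgraph_le_uniform set_integral_abs_le assms)

lemma hgraph_le_delta: "hgraph X \<phi> \<psi> \<le> delta X \<phi> \<psi>"
  unfolding delta_def using set_integral_abs_nonneg by auto

lemma r_ae_le:
  assumes "\<And>k. k \<ge> 1 \<Longrightarrow> delta X (lenv_ae X k f) (lenv_ae X k g) \<le> c"
    and "\<And>k. k \<ge> 1 \<Longrightarrow> delta X (uenv_ae X k f) (uenv_ae X k g) \<le> c"
  shows "r_ae X f g \<le> c"
  unfolding r_ae_def using assms by (intro cSUP_least) auto

lemma r_ae_cong:
  assumes "ae_eq X f f'" shows "r_ae X g f = r_ae X g f'"
proof -
  have *: "AE y in lebesgue. y \<in> X \<longrightarrow> f y = f' y" using assms by (simp add: ae_eq_def)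
  have "(AE y in lebesgue. y \<in> X \<longrightarrow> \<phi> y \<le> f y) \<longleftrightarrow> (AE y in lebesgue. y \<in> X \<longrightarrow> \<phi> y \<le> f' y)"
    and "(AE y in lebesgue. y \<in> X \<longrightarrow> f y \<le> \<phi> y) \<longleftrightarrow> (AE y in lebesgue. y \<in> X \<longrightarrow> f' y \<le> \<phi> y)" for \<phi>
    using * by (auto elim: AE_mp)
  then have "lenv_ae X k f = lenv_ae X k f'" "uenv_ae X k f = uenv_ae X k f'" for k
    by (simp_all add: lenv_ae_def uenv_ae_def fun_eq_iff)
  then show ?thesis by (simp add: r_ae_def)
qed

section \<open>Estimates for the metrics on a bounded domain\<close>

locale bounded_domain =
  fixes X :: "'a::euclidean_space set"
  assumes X: "X \<noteq> {}" "open X" "bounded X"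
begin

lemma X_lmeasurable: "X \<in> lmeasurable"
  using X by (intro lmeasurable_open)

lemma delta_env_le:
  assumes "cae X f" "cae X g" "\<And>x. x \<in> X \<Longrightarrow> \<bar>f x\<bar> \<le> M" "\<And>x. x \<in> X \<Longrightarrow> \<bar>g x\<bar> \<le> M"
  shows "delta X (lenv_ae X k f) (lenv_ae X k g) \<le> 2 * M + 2 * M * measure lebesgue X"
    and "delta X (uenv_ae X k f) (uenv_ae X k g) \<le> 2 * M + 2 * M * measure lebesgue X"
proof -
  note 1 = lenv_ae_abs_le[OF X(2) assms(1,3)] and 2 = lenv_ae_abs_le[OF X(2) assms(2,4)]
  show "delta X (lenv_ae X k f) (lenv_ae X k g) \<le> 2 * M + 2 * M * measure lebesgue X"
  proof (rule delta_le_uniform[OF X(1) X_lmeasurable])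
    fix x assume x: "x \<in> X"
    show "\<bar>lenv_ae X k f x - lenv_ae X k g x\<bar> \<le> 2 * M" using 1(1)[of x k] 2(1)[of x k] x by linarith
  qed
  show "delta X (uenv_ae X k f) (uenv_ae X k g) \<le> 2 * M + 2 * M * measure lebesgue X"
  proof (rule delta_le_uniform[OF X(1) X_lmeasurable])
    fix x assume x: "x \<in> X"
    show "\<bar>uenv_ae X k f x - uenv_ae X k g x\<bar> \<le> 2 * M" using 1(2)[of x k] 2(2)[of x k] x by linarith
  qed
qed

text \<open>\<open>r_ae\<close> is a real supremum over all \<open>k\<close> and bounds its members
  only for a bounded family; the envelopes inherit the bounds of \<open>f\<close> and
  \<open>g\<close> independently of \<open>k\<close>.\<close>

lemma r_ae_bdd:
  assumes "cae X f" "cae X g"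
  shows "bdd_above ((\<lambda>k. max (delta X (lenv_ae X k f) (lenv_ae X k g)) (delta X (uenv_ae X k f) (uenv_ae X k g))) ` {1..})"
proof -
  obtain M where M: "\<And>x. x \<in> X \<Longrightarrow> \<bar>f x\<bar> \<le> M" using bounded_realD[OF cae_bounded[OF assms(1)]] by blast
  obtain M' where M': "\<And>x. x \<in> X \<Longrightarrow> \<bar>g x\<bar> \<le> M'" using bounded_realD[OF cae_bounded[OF assms(2)]] by blast
  let ?M = "max M M'"
  have "\<bar>f x\<bar> \<le> ?M" "\<bar>g x\<bar> \<le> ?M" if "x \<in> X" for x using M[OF that] M'[OF that] by auto
  from delta_env_le[OF assms this] show ?thesis by (intro bdd_aboveI2) auto
qed

lemma r_ae_ge:
  assumes "cae X f" "cae X g" "k \<ge> 1"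
  shows "hgraph X (lenv_ae X k f) (lenv_ae X k g) \<le> r_ae X f g"
    and "hgraph X (uenv_ae X k f) (uenv_ae X k g) \<le> r_ae X f g"
proof -
  have "max (delta X (lenv_ae X k f) (lenv_ae X k g)) (delta X (uenv_ae X k f) (uenv_ae X k g)) \<le> r_ae X f g"
    unfolding r_ae_def using assms(3) by (intro cSUP_upper r_ae_bdd assms) auto
  then show "hgraph X (lenv_ae X k f) (lenv_ae X k g) \<le> r_ae X f g"
    and "hgraph X (uenv_ae X k f) (uenv_ae X k g) \<le> r_ae X f g"
    using hgraph_le_delta[of X "lenv_ae X k f" "lenv_ae X k g"]
      hgraph_le_delta[of X "uenv_ae X k f" "uenv_ae X k g"] by linarith+
qed

lemma hgraph_lenv_nonneg:
  assumes "cae X f" shows "0 \<le> hgraph X (lenv_ae X k f) \<psi>"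
proof -
  obtain M where M: "\<And>x. x \<in> X \<Longrightarrow> \<bar>f x\<bar> \<le> M" using bounded_realD[OF cae_bounded[OF assms(1)]] by blast
  show ?thesis by (rule hgraph_nonneg[OF X(1,3) lenv_ae_abs_le(1)[OF X(2) assms M]])
qed

lemma r_ae_nonneg:
  assumes "cae X f" "cae X g" shows "0 \<le> r_ae X f g"
  using order_trans[OF hgraph_lenv_nonneg r_ae_ge(1)[OF assms order_refl]] assms by blast

lemma r_ae_le_bound:
  assumes "cae X f" "cae X g" "\<And>x. x \<in> X \<Longrightarrow> \<bar>f x\<bar> \<le> M" "\<And>x. x \<in> X \<Longrightarrow> \<bar>g x\<bar> \<le> M"
  shows "r_ae X f g \<le> 2 * M + 2 * M * measure lebesgue X"
  by (intro r_ae_le delta_env_le assms)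

lemma abs_inner_unit_le: "norm \<xi> = 1 \<Longrightarrow> norm v \<le> M \<Longrightarrow> \<bar>v \<bullet> \<xi>\<bar> \<le> M"
  using Cauchy_Schwarz_ineq2[of v \<xi>] by simp

lemma rv_ae_bdd:
  fixes F G :: "'a \<Rightarrow> 'b::euclidean_space"
  assumes "cae X F" "cae X G"
  shows "bdd_above ((\<lambda>\<xi>. r_ae X (\<lambda>x. F x \<bullet> \<xi>) (\<lambda>x. G x \<bullet> \<xi>)) ` {\<xi>. norm \<xi> = 1})"
proof -
  obtain M where M: "\<And>x. x \<in> X \<Longrightarrow> norm (F x) \<le> M" using bounded_normD[OF cae_bounded[OF assms(1)]] by blast
  obtain M' where M': "\<And>x. x \<in> X \<Longrightarrow> norm (G x) \<le> M'" using bounded_normD[OF cae_bounded[OF assms(2)]] by blast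
  let ?M = "max M M'"
  have "\<bar>F x \<bullet> \<xi>\<bar> \<le> ?M" "\<bar>G x \<bullet> \<xi>\<bar> \<le> ?M" if "x \<in> X" "norm \<xi> = 1" for x \<xi>
    using that M[OF that(1)] M'[OF that(1)] by (auto intro!: abs_inner_unit_le)
  then show ?thesis
    by (intro bdd_aboveI2[where M="2 * ?M + 2 * ?M * measure lebesgue X"] r_ae_le_bound cae_inner assms) auto
qed

lemma rv_ae_ge:
  fixes F G :: "'a \<Rightarrow> 'b::euclidean_space"
  assumes "cae X F" "cae X G" "norm \<xi> = 1"
  shows "r_ae X (\<lambda>x. F x \<bullet> \<xi>) (\<lambda>x. G x \<bullet> \<xi>) \<le> rv_ae X F G"
  unfolding rv_ae_def using assms(3) by (intro cSUP_upper rv_ae_bdd assms) auto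

lemma rv_ae_le:
  fixes F G :: "'a \<Rightarrow> 'b::euclidean_space"
  assumes "\<And>\<xi>. norm \<xi> = 1 \<Longrightarrow> r_ae X (\<lambda>x. F x \<bullet> \<xi>) (\<lambda>x. G x \<bullet> \<xi>) \<le> c"
  shows "rv_ae X F G \<le> c"
proof -
  have "{\<xi>::'b. norm \<xi> = 1} \<noteq> {}" using norm_some_Basis by blast
  then show ?thesis unfolding rv_ae_def using assms by (intro cSUP_least) auto
qed

lemma rv_ae_nonneg:
  fixes F G :: "'a \<Rightarrow> 'b::euclidean_space"
  assumes "cae X F" "cae X G" shows "0 \<le> rv_ae X F G"
  using order_trans[OF r_ae_nonneg[OF cae_inner[OF assms(1)] cae_inner[OF assms(2)]]
     rv_ae_ge[OF assms, of "SOME i. i \<in> Basis"]] by (simp add: norm_some_Basis)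

text \<open>Each envelope is \<open>k\<close>-Lipschitz, so closeness of graphs becomes uniform
  closeness with factor \<open>1 + k\<close>. Because of this growth, later arguments fix
  \<open>k\<close> before passing to the limit.\<close>

lemma lenv_ae_diff:
  assumes "cae X f" "cae X g" "k \<ge> 1" "x \<in> X"
  shows "\<bar>lenv_ae X k f x - lenv_ae X k g x\<bar> \<le> (1 + real k) * r_ae X f g"
    and "\<bar>uenv_ae X k f x - uenv_ae X k g x\<bar> \<le> (1 + real k) * r_ae X f g"
proof -
  obtain M where M: "\<And>x. x \<in> X \<Longrightarrow> \<bar>f x\<bar> \<le> M" using bounded_realD[OF cae_bounded[OF assms(1)]] by blast
  show "\<bar>lenv_ae X k f x - lenv_ae X k g x\<bar> \<le> (1 + real k) * r_ae X f g"
    by (rule order_trans[OF hgraph_lipschitz[OF X(3) lenv_ae_abs_le(1)[OF X(2) assms(1) M] lenv_ae_lipschitz(1)[OF X(2,1) assms(2)] assms(4)]])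
      (auto intro!: mult_left_mono r_ae_ge assms)
  show "\<bar>uenv_ae X k f x - uenv_ae X k g x\<bar> \<le> (1 + real k) * r_ae X f g"
    by (rule order_trans[OF hgraph_lipschitz[OF X(3) lenv_ae_abs_le(2)[OF X(2) assms(1) M] lenv_ae_lipschitz(2)[OF X(2,1) assms(2)] assms(4)]])
      (auto intro!: mult_left_mono r_ae_ge assms)
qed

end

section \<open>Almost everywhere versus comeager\<close>

text \<open>Baire category theorem: the complements of the closures of countably many nowhere dense
  sets have a dense intersection, and this intersection misses \<open>U\<close>.\<close>

lemma meager_not_open:
  fixes M :: "'a::euclidean_space set"
  assumes "meager M" "open U" "U \<subseteq> M" shows "U = {}"
proof -
  obtain N where N: "countable N" "\<And>A. A \<in> N \<Longrightarrow> interior (closure A) = {}" "M \<subseteq> \<Union>N"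
    using assms(1) by (auto simp: meager_def nowhere_dense_def)
  have "UNIV \<subseteq> closure (\<Inter>((\<lambda>A. - closure A) ` N))"
  proof (rule Baire)
    fix T assume "T \<in> (\<lambda>A. - closure A) ` N"
    then show "openin (top_of_set UNIV) T \<and> UNIV \<subseteq> closure T"
      using N(2) by (auto simp: closure_complement)
  qed (use N in auto)
  moreover have "\<Inter>((\<lambda>A. - closure A) ` N) \<subseteq> - U"
  proof
    fix x assume x: "x \<in> \<Inter>((\<lambda>A. - closure A) ` N)"
    have "x \<notin> A" if "A \<in> N" for A using x that closure_subset[of A] by auto
    then show "x \<in> - U" using N(3) assms(3) by auto
  qed
  ultimately have "closure (- U) = UNIV" using closure_mono by blast
  then have "- U = UNIV" using assms(2) by (simp add: closure_complement interior_open)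
  then show ?thesis by blast
qed

lemma comeager_meets_open:
  fixes X :: "'a::euclidean_space set"
  assumes "open X" "comeager_in X S" "open U" "U \<inter> X \<noteq> {}"
  shows "\<exists>y\<in>S. y \<in> U \<inter> X"
proof (rule ccontr)
  assume "\<not> ?thesis"
  then have "U \<inter> X \<subseteq> X - S" by auto
  from meager_not_open[OF assms(2)[unfolded comeager_in_def] _ this] assms show False by auto
qed

text \<open>Both envelopes reduce to the same infimal convolution over the continuity points, since
  conull and comeager sets alike meet every nonempty open subset of \<open>X\<close>.\<close>

lemma lenv_cm_eq_ae:
  assumes "open X" "x \<in> X" "cae X f" "comeager_in X (cont_pts X f)"
  shows "lenv_cm X k f x = lenv_ae X k f x"
proof -
  let ?S = "cont_pts X f"
  obtain M where M: "\<And>x. x \<in> X \<Longrightarrow> \<bar>f x\<bar> \<le> M" using bounded_realD[OF cae_bounded[OF assms(3)]] by blast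
  have iff: "(\<exists>S. comeager_in X S \<and> (\<forall>y\<in>S \<inter> X. \<phi> y \<le> f y)) \<longleftrightarrow> (\<forall>y\<in>?S. \<phi> y \<le> f y)"
    if "(real k)-lipschitz_on X \<phi>" for \<phi>
  proof
    assume "\<exists>S. comeager_in X S \<and> (\<forall>y\<in>S \<inter> X. \<phi> y \<le> f y)"
    then obtain S where S: "comeager_in X S" "\<forall>y\<in>S \<inter> X. \<phi> y \<le> f y" by blast
    show "\<forall>y\<in>?S. \<phi> y \<le> f y"
    proof (intro ballI le_at_cont_pt[OF assms(1)])
      show "continuous_on X \<phi>" using that by (rule lipschitz_on_continuous_on)
      fix U :: "'a set" assume U: "open U" "U \<inter> X \<noteq> {}"
      from comeager_meets_open[OF assms(1) S(1) U] S(2) show "\<exists>z\<in>U \<inter> X. \<phi> z \<le> f z" by auto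
    qed
  next
    assume "\<forall>y\<in>?S. \<phi> y \<le> f y"
    with assms(4) show "\<exists>S. comeager_in X S \<and> (\<forall>y\<in>S \<inter> X. \<phi> y \<le> f y)" by blast
  qed
  have "lenv_cm X k f x = infconv k ?S f x"
    unfolding lenv_cm_def
  proof (rule Sup_lipschitz_minorants)
    show "?S \<noteq> {}" using conull_dense[OF assms(1) cae_conull[OF assms(3)]] assms(2) by auto
    show "?S \<subseteq> X" "x \<in> X" "0 \<le> real k" using assms(2) cont_ptsD(1) by auto
    fix y assume "y \<in> ?S"
    then show "- M \<le> f y" using M[of y] cont_ptsD(1) by fastforce
  next
    show "(\<exists>S. comeager_in X S \<and> (\<forall>y\<in>S \<inter> X. \<phi> y \<le> f y)) \<longleftrightarrow> (\<forall>y\<in>?S. \<phi> y \<le> f y)"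
      if "(real k)-lipschitz_on X \<phi>" for \<phi> by (rule iff[OF that])
  qed
  then show ?thesis
    using lenv_ae_eq[OF assms(1,2) cae_bounded[OF assms(3)] subset_refl cae_conull[OF assms(3)]] by simp
qed

text \<open>The discontinuity set is a countable union of relatively closed null sets.\<close>

lemma conull_cont_pts_comeager:
  fixes f :: "'a::euclidean_space \<Rightarrow> 'b::metric_space"
  assumes "open X" "X - cont_pts X f \<in> null_sets lebesgue"
  shows "comeager_in X (cont_pts X f)"
proof -
  \<comment> \<open>Points of oscillation at least \<open>1 / (n + 1)\<close>. Comparing two free
    points near \<open>x\<close>, and not one point with \<open>x\<close>, makes the set relatively
    closed.\<close>
  define D where "D n = {x \<in> X. \<forall>\<delta>>0. \<exists>y\<in>ball x \<delta> \<inter> X. \<exists>z\<in>ball x \<delta> \<inter> X. dist (f y) (f z) \<ge> 1 / real (Suc n)}" for n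
  have sub: "D n \<subseteq> X - cont_pts X f" for n
  proof
    fix x assume x: "x \<in> D n"
    have "x \<notin> cont_pts X f"
    proof
      assume "x \<in> cont_pts X f"
      then have "continuous (at x within X) f" by (rule cont_ptsD)
      then obtain d where d: "d > 0" "\<And>y. y \<in> X \<Longrightarrow> dist y x < d \<Longrightarrow> dist (f y) (f x) < 1 / real (Suc n) / 2"
        unfolding continuous_within_eps_delta by (metis half_gt_zero zero_less_divide_1_iff of_nat_0_less_iff zero_less_Suc)
      obtain y z where yz: "y \<in> ball x d \<inter> X" "z \<in> ball x d \<inter> X" "dist (f y) (f z) \<ge> 1 / real (Suc n)"
        using x d(1) unfolding D_def by blast
      have "dist (f y) (f x) < 1 / real (Suc n) / 2" "dist (f z) (f x) < 1 / real (Suc n) / 2"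
        using yz d(2)[of y] d(2)[of z] by (simp_all add: dist_commute[of x])
      with yz(3) dist_triangle2[of "f y" "f z" "f x"] show False by linarith
    qed
    then show "x \<in> X - cont_pts X f" using x by (auto simp: D_def)
  qed
  have "nowhere_dense (D n)" for n
  proof -
    have closed: "closure (D n) \<inter> X \<subseteq> D n"
    proof
      fix x assume x: "x \<in> closure (D n) \<inter> X"
      have "\<exists>y\<in>ball x \<delta> \<inter> X. \<exists>z\<in>ball x \<delta> \<inter> X. dist (f y) (f z) \<ge> 1 / real (Suc n)" if "\<delta> > 0" for \<delta>
      proof -
        obtain x' where x': "x' \<in> D n" "dist x' x < \<delta> / 2"
          using x \<open>\<delta> > 0\<close> closure_approachable[of x "D n"] half_gt_zero by blast
        then obtain y z where yz: "y \<in> ball x' (\<delta>/2) \<inter> X" "z \<in> ball x' (\<delta>/2) \<inter> X" "dist (f y) (f z) \<ge> 1 / real (Suc n)"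
          using \<open>\<delta> > 0\<close> unfolding D_def mem_Collect_eq by (meson half_gt_zero)
        have "ball x' (\<delta>/2) \<subseteq> ball x \<delta>"
          using x'(2) by (intro ball_subset_ball_iff[THEN iffD2]) (simp add: dist_commute)
        with yz show ?thesis by blast
      qed
      then show "x \<in> D n" using x by (auto simp: D_def)
    qed
    define U where "U = interior (closure (D n))"
    \<comment> \<open>An open piece of \<open>X\<close> inside the closure would consist of points
      of \<open>D n\<close>, that is of discontinuities, and a null set contains no such
      piece.\<close>
    have "U \<inter> X = {}"
    proof (rule ccontr)
      assume "U \<inter> X \<noteq> {}"
      then have "\<exists>y\<in>cont_pts X f. y \<in> U \<inter> X"
        using conull_meets_open[OF assms, of U] by (simp add: U_def)
      then show False using closed sub interior_subset[of "closure (D n)"] unfolding U_def by blast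
    qed
    moreover have "D n \<subseteq> X" by (auto simp: D_def)
    ultimately have "U \<inter> D n = {}" by blast
    then have "U \<inter> closure (D n) = {}" using open_Int_closure_eq_empty[of U "D n"] by (simp add: U_def)
    then have "U = {}" using interior_subset[of "closure (D n)"] unfolding U_def by blast
    then show ?thesis by (simp add: nowhere_dense_def U_def)
  qed
  moreover have "X - cont_pts X f \<subseteq> \<Union>(range D)"
  proof
    fix x assume x: "x \<in> X - cont_pts X f"
    then have "\<not> continuous (at x within X) f" by (auto simp: cont_pts_def)
    then obtain e where e: "e > 0" "\<And>d. d > 0 \<Longrightarrow> \<exists>y\<in>X. dist y x < d \<and> \<not> dist (f y) (f x) < e"
      unfolding continuous_within_eps_delta by blast
    obtain n where n: "1 / real (Suc n) < e" using e(1) nat_approx_posE by blast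
    have "x \<in> D n"
      unfolding D_def
    proof (safe)
      fix \<delta> :: real assume \<delta>: "\<delta> > 0"
      from e(2)[OF this] obtain y where "y \<in> X" "dist y x < \<delta>" "dist (f y) (f x) \<ge> e" by auto
      then show "\<exists>y\<in>ball x \<delta> \<inter> X. \<exists>z\<in>ball x \<delta> \<inter> X. dist (f y) (f z) \<ge> 1 / real (Suc n)"
        using x n \<delta> by (intro bexI[of _ y] bexI[of _ x]) (auto simp: dist_commute)
    qed (use x in auto)
    then show "x \<in> \<Union>(range D)" by blast
  qed
  ultimately show ?thesis
    unfolding comeager_in_def meager_def by (intro exI[of _ "range D"]) auto
qed

lemma cae_imp_ccm: "open X \<Longrightarrow> cae X f \<Longrightarrow> ccm X f"
  by (simp add: cae_def ccm_def conull_cont_pts_comeager)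

lemma graph_on_cong: "(\<And>x. x \<in> X \<Longrightarrow> f x = g x) \<Longrightarrow> graph_on X f = graph_on X g"
  by (force simp: graph_on_def)

lemma ccm_comeager: "ccm X f \<Longrightarrow> comeager_in X (cont_pts X f)"
  by (simp add: ccm_def)

context bounded_domain
begin

lemma hgraph_cm_eq_ae:
  assumes "cae X f" "cae X g"
  shows "hgraph X (lenv_cm X k f) (lenv_cm X k g) = hgraph X (lenv_ae X k f) (lenv_ae X k g)"
    and "hgraph X (uenv_cm X k f) (uenv_cm X k g) = hgraph X (uenv_ae X k f) (uenv_ae X k g)"
proof -
  have l: "graph_on X (lenv_cm X k f) = graph_on X (lenv_ae X k f)" if "cae X f" for f
    using lenv_cm_eq_ae[OF X(2) _ that ccm_comeager[OF cae_imp_ccm[OF X(2) that]]] by (rule graph_on_cong)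
  have u: "graph_on X (uenv_cm X k f) = graph_on X (uenv_ae X k f)" if "cae X f" for f
    using lenv_cm_eq_ae[OF X(2) _ cae_minus[OF that] ccm_comeager[OF cae_imp_ccm[OF X(2) cae_minus[OF that]]]]
    by (intro graph_on_cong) (simp add: uenv_cm_minus uenv_ae_minus)
  show "hgraph X (lenv_cm X k f) (lenv_cm X k g) = hgraph X (lenv_ae X k f) (lenv_ae X k g)"
    and "hgraph X (uenv_cm X k f) (uenv_cm X k g) = hgraph X (uenv_ae X k f) (uenv_ae X k g)"
    using l u assms by (simp_all add: hgraph_def)
qed

text \<open>On almost everywhere continuous functions the two metrics use the same envelopes, and
  \<open>r_ae\<close> only adds the nonnegative integral term.\<close>

lemma s_cm_bounds:
  assumes "cae X f" "cae X g"
  shows "0 \<le> s_cm X f g" "s_cm X f g \<le> r_ae X f g"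
proof -
  let ?h = "\<lambda>k. max (hgraph X (lenv_cm X k f) (lenv_cm X k g)) (hgraph X (uenv_cm X k f) (uenv_cm X k g))"
  have le: "?h k \<le> r_ae X f g" if "k \<in> {1..}" for k
    using that r_ae_ge[OF assms, of k] by (simp add: hgraph_cm_eq_ae[OF assms])
  show "s_cm X f g \<le> r_ae X f g"
    unfolding s_cm_def using le by (intro cSUP_least) auto
  have "0 \<le> ?h 1"
    using hgraph_lenv_nonneg[OF assms(1)] by (simp add: hgraph_cm_eq_ae[OF assms] le_max_iff_disj)
  also have "?h 1 \<le> s_cm X f g"
    unfolding s_cm_def using le by (intro cSUP_upper bdd_aboveI2) auto
  finally show "0 \<le> s_cm X f g" .
qed

lemma sv_cm_bounds:
  fixes F G :: "'a \<Rightarrow> 'b::euclidean_space"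
  assumes "cae X F" "cae X G"
  shows "0 \<le> sv_cm X F G" "sv_cm X F G \<le> rv_ae X F G"
proof -
  let ?s = "\<lambda>\<xi>. s_cm X (\<lambda>x. F x \<bullet> \<xi>) (\<lambda>x. G x \<bullet> \<xi>)"
  obtain \<zeta> :: 'b where \<zeta>: "norm \<zeta> = 1" using norm_some_Basis by blast
  have le: "?s \<xi> \<le> rv_ae X F G" if "\<xi> \<in> {\<xi>. norm \<xi> = 1}" for \<xi>
    using that s_cm_bounds(2)[OF cae_inner[OF assms(1), of \<xi>] cae_inner[OF assms(2), of \<xi>]] rv_ae_ge[OF assms, of \<xi>]
    by simp
  show "sv_cm X F G \<le> rv_ae X F G"
    unfolding sv_cm_def using le \<zeta> by (intro cSUP_least) auto
  have "0 \<le> ?s \<zeta>" by (rule s_cm_bounds(1)[OF cae_inner[OF assms(1)] cae_inner[OF assms(2)]])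
  also have "?s \<zeta> \<le> sv_cm X F G"
    unfolding sv_cm_def using le \<zeta> by (intro cSUP_upper bdd_aboveI2) auto
  finally show "0 \<le> sv_cm X F G" .
qed

lemma c10_continuous:
  assumes "c10_grad X f D" shows "continuous_on X f"
proof (intro continuous_at_imp_continuous_on ballI)
  fix x assume "x \<in> X"
  then have "(f has_derivative (\<lambda>h. h \<bullet> D x)) (at x)" using assms by (simp add: c10_grad_def gderiv_def)
  then show "isCont f x" by (rule has_derivative_continuous)
qed

lemma c10_cae:
  assumes "c10_grad X f D" shows "cae X f" "cae X D"
  using assms c10_continuous[OF assms] by (auto simp: c10_grad_def intro!: cae_continuous)

text \<open>One approximating sequence serves both closures, because \<open>s_cm\<close> and
  \<open>sv_cm\<close> are dominated by \<open>r_ae\<close> and \<open>rv_ae\<close>.\<close>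

lemma grad_cl_ae_imp_cm:
  assumes "grad_cl_ae X f F" shows "grad_cl_cm X f F"
proof -
  obtain fs Ds where c: "cae X f" "cae X F" "\<And>i. c10_grad X (fs i) (Ds i)"
    and lim: "(\<lambda>i. r_ae X (fs i) f) \<longlonglongrightarrow> 0" "(\<lambda>i. rv_ae X (Ds i) F) \<longlonglongrightarrow> 0"
    using assms unfolding grad_cl_ae_def by blast
  have "(\<lambda>i. s_cm X (fs i) f) \<longlonglongrightarrow> 0"
    using s_cm_bounds[OF c10_cae(1)[OF c(3)] c(1)]
    by (intro tendsto_sandwich[OF _ _ tendsto_const lim(1)]) auto
  moreover have "(\<lambda>i. sv_cm X (Ds i) F) \<longlonglongrightarrow> 0"
    using sv_cm_bounds[OF c10_cae(2)[OF c(3)] c(2)]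
    by (intro tendsto_sandwich[OF _ _ tendsto_const lim(2)]) auto
  ultimately show ?thesis
    unfolding grad_cl_cm_def
    by (intro conjI exI[of _ fs] exI[of _ Ds] allI c(3) cae_imp_ccm[OF X(2)] c(1,2))
qed

end

section \<open>Limits of gradients\<close>

text \<open>What is retained of convergence in \<open>r_ae\<close>: uniform convergence for each
  fixed \<open>k\<close>, with no uniformity in \<open>k\<close>. The condition is symmetric under
  negation, so upper bounds yield lower ones.\<close>

definition env_conv :: "'a::euclidean_space set \<Rightarrow> (nat \<Rightarrow> 'a \<Rightarrow> real) \<Rightarrow> ('a \<Rightarrow> real) \<Rightarrow> bool" where
  "env_conv X fs f \<longleftrightarrow> (\<forall>k\<ge>1. \<forall>e>0. \<forall>\<^sub>F i in sequentially. \<forall>z\<in>X.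
     \<bar>lenv_ae X k (fs i) z - lenv_ae X k f z\<bar> \<le> e \<and> \<bar>uenv_ae X k (fs i) z - uenv_ae X k f z\<bar> \<le> e)"

lemma env_conv_minus:
  assumes "env_conv X fs f" shows "env_conv X (\<lambda>i x. - fs i x) (\<lambda>x. - f x)"
proof -
  have "lenv_ae X k (\<lambda>x. - g x) z = - uenv_ae X k g z" "uenv_ae X k (\<lambda>x. - g x) z = - lenv_ae X k g z" for k g z
    by (simp_all add: uenv_ae_minus)
  then show ?thesis using assms unfolding env_conv_def
    by (simp add: abs_minus_commute conj_commute)
qed

text \<open>Mean value theorem along the segment. It is stated one-sidedly because the upper
  envelopes control a gradient only from above in a given direction.\<close>

lemma gderiv_segment_le:
  fixes f :: "'a::real_inner \<Rightarrow> real"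
  assumes d: "\<And>z. z \<in> closed_segment a b \<Longrightarrow> GDERIV f z :> D z"
    and c: "\<And>z. z \<in> closed_segment a b \<Longrightarrow> D z \<bullet> (b - a) \<le> c"
  shows "f b - f a \<le> c"
proof -
  let ?p = "\<lambda>t. a + t *\<^sub>R (b - a)"
  have seg: "?p t \<in> closed_segment a b" if "0 \<le> t" "t \<le> 1" for t
    using that unfolding closed_segment_def by (auto simp: algebra_simps intro!: exI[of _ t])
  have "((\<lambda>t. f (?p t)) has_real_derivative (D (?p t) \<bullet> (b - a))) (at t)" if "0 \<le> t" "t \<le> 1" for t
  proof -
    have "(f has_derivative (\<lambda>h. h \<bullet> D (?p t))) (at (?p t))"
      using d[OF seg[OF that]] by (simp add: gderiv_def)
    moreover have "(?p has_derivative (\<lambda>s. s *\<^sub>R (b - a))) (at t)"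
      by (auto intro!: derivative_eq_intros)
    ultimately have "((\<lambda>t. f (?p t)) has_derivative (\<lambda>s. (s *\<^sub>R (b - a)) \<bullet> D (?p t))) (at t)"
      by (rule has_derivative_compose[rotated])
    then show ?thesis
      unfolding has_field_derivative_def
      by (rule has_derivative_eq_rhs) (simp add: fun_eq_iff inner_commute)
  qed
  from MVT2[OF zero_less_one this] obtain z where "0 < z" "z < 1"
    "f (?p 1) - f (?p 0) = (1 - 0) * (D (?p z) \<bullet> (b - a))" by auto
  with c[OF seg, of z] show ?thesis by simp
qed

lemma gderiv_unique:
  assumes "GDERIV f x :> D" "GDERIV f x :> D'" shows "D = D'"
proof -
  have "(\<lambda>h. h \<bullet> D) = (\<lambda>h. h \<bullet> D')"
    using assms unfolding gderiv_def by (rule has_derivative_unique)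
  then have "(D - D') \<bullet> D = (D - D') \<bullet> D'" by (rule fun_cong)
  then have "(D - D') \<bullet> (D - D') = 0" by (simp add: inner_diff_right)
  then show ?thesis by simp
qed

lemma gderiv_transform_open:
  assumes "GDERIV f x :> D" "open S" "x \<in> S" "\<And>y. y \<in> S \<Longrightarrow> f y = g y"
  shows "GDERIV g x :> D"
  using assms unfolding gderiv_def by (rule has_derivative_transform_within_open)

context bounded_domain
begin

lemma env_convI:
  assumes "\<And>i. cae X (fs i)" "cae X f" "(\<lambda>i. r_ae X (fs i) f) \<longlonglongrightarrow> 0"
  shows "env_conv X fs f"
  unfolding env_conv_def
proof (intro allI impI)
  fix k :: nat and e :: real assume k: "1 \<le> k" and e: "0 < e"
  then have "\<forall>\<^sub>F i in sequentially. r_ae X (fs i) f < e / (1 + real k)"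
    by (intro order_tendstoD[OF assms(3)]) auto
  then show "\<forall>\<^sub>F i in sequentially. \<forall>z\<in>X.
     \<bar>lenv_ae X k (fs i) z - lenv_ae X k f z\<bar> \<le> e \<and> \<bar>uenv_ae X k (fs i) z - uenv_ae X k f z\<bar> \<le> e"
  proof eventually_elim
    case (elim i)
    then have "(1 + real k) * r_ae X (fs i) f \<le> e" by (simp add: field_simps)
    then show ?case using lenv_ae_diff[OF assms(1)[of i] assms(2) k] by (meson order_trans)
  qed
qed

text \<open>Convergence of the upper envelopes turns a bound on \<open>f\<close> near \<open>x\<close> into an asymptotic bound on
  the whole functions \<open>fs i\<close>, because the \<open>k\<close>-envelope of \<open>f\<close> does not see values at distance \<open>\<rho> / 2\<close> once
  \<open>k\<close> is large.\<close>

lemma env_conv_upper: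
  assumes fs: "\<And>i. cae X (fs i)" "\<And>i. continuous_on X (fs i)" and f: "cae X f"
    and ec: "env_conv X fs f"
    and S: "S \<subseteq> cont_pts X f" "X - S \<in> null_sets lebesgue"
    and \<rho>: "\<rho> > 0" and c: "\<And>y. y \<in> S \<Longrightarrow> dist x y < \<rho> \<Longrightarrow> f y \<le> c" and e: "e > 0"
  shows "\<forall>\<^sub>F i in sequentially. \<forall>z\<in>X. dist x z < \<rho> / 2 \<longrightarrow> fs i z \<le> c + e"
proof -
  obtain M where M: "\<And>x. x \<in> X \<Longrightarrow> \<bar>f x\<bar> \<le> M" using bounded_realD[OF cae_bounded[OF f]] by blast
  have SX: "S \<subseteq> X" using S(1) cont_ptsD(1) by blast
  have ne: "S \<noteq> {}" using conull_dense[OF X(2) S(2)] X(1) by auto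
  \<comment> \<open>\<open>k\<close> is to be so large that a point at distance at least
    \<open>\<rho> / 2\<close> pays a penalty no smaller than \<open>M - c\<close>, the most by which
    its value can exceed \<open>c\<close>.\<close>
  obtain k0 :: nat where "(M - c) / (\<rho> / 2) \<le> real k0" using real_arch_simple by blast
  then have "(M - c) / (\<rho> / 2) \<le> real (max 1 k0)" by simp
  then obtain k :: nat where k: "k \<ge> 1" "M - c \<le> real k * (\<rho> / 2)"
    using \<rho> by (metis max.cobounded1 half_gt_zero pos_divide_le_eq)
  have up: "uenv_ae X k f z \<le> c" if z: "z \<in> X" "dist x z < \<rho> / 2" for z
  proof -
    have "- c \<le> infconv k S (\<lambda>x. - f x) z"
    proof (rule infconv_ge[OF ne])
      fix y assume y: "y \<in> S"
      show "- c \<le> - f y + real k * dist z y"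
      proof (cases "dist x y < \<rho>")
        case True
        have "0 \<le> real k * dist z y" by simp
        with c[OF y True] show ?thesis by linarith
      next
        case False
        then have "\<rho> / 2 \<le> dist z y" using z(2) dist_triangle[of x y z] by linarith
        then have "real k * (\<rho> / 2) \<le> real k * dist z y" by (intro mult_left_mono) auto
        moreover have "f y \<le> M" using M[of y] y SX by (auto simp: abs_le_iff)
        ultimately show ?thesis using k(2) by linarith
      qed
    qed
    then show ?thesis by (simp add: uenv_ae_eq[OF X(2) z(1) cae_bounded[OF f] S])
  qed
  \<comment> \<open>A continuous function lies below its upper envelope at every point of
    \<open>X\<close>, so the final bound holds everywhere and not just almost everywhere.\<close>
  have "fs i z \<le> uenv_ae X k (fs i) z" if z: "z \<in> X" for i z
  proof -
    obtain M where M: "\<And>x. x \<in> X \<Longrightarrow> \<bar>fs i x\<bar> \<le> M" using bounded_realD[OF cae_bounded[OF fs(1)]] by blast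
    then have "- M \<le> - fs i y" if "y \<in> X" for y using that by (auto simp: abs_le_iff)
    from infconv_le[where f="\<lambda>x. - fs i x" and k=k and x=z, OF _ this z]
    show ?thesis using z
      by (simp add: uenv_ae_eq[where f="fs i" and S=X, OF X(2) z cae_bounded[OF fs(1)]] cont_pts_continuous_on[OF fs(2)])
  qed
  moreover have "\<forall>\<^sub>F i in sequentially. \<forall>z\<in>X.
     \<bar>lenv_ae X k (fs i) z - lenv_ae X k f z\<bar> \<le> e \<and> \<bar>uenv_ae X k (fs i) z - uenv_ae X k f z\<bar> \<le> e"
    using ec k(1) e unfolding env_conv_def by blast
  ultimately show ?thesis
    using up by (elim eventually_mono) (smt (verit))
qed

text \<open>Near a continuity point \<open>f\<close> is almost constant;
  \<open>env_conv_upper\<close> then bounds the limes superior, and its application to the negatives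
  bounds the limes inferior.\<close>

lemma env_conv_pointwise:
  assumes fs: "\<And>i. cae X (fs i)" "\<And>i. continuous_on X (fs i)" and f: "cae X f"
    and ec: "env_conv X fs f" and y: "y \<in> cont_pts X f"
  shows "(\<lambda>i. fs i y) \<longlonglongrightarrow> f y"
proof -
  have up: "\<forall>\<^sub>F i in sequentially. gs i y \<le> g y + e"
    if gs: "\<And>i. cae X (gs i)" "\<And>i. continuous_on X (gs i)" and g: "cae X g"
      and ec: "env_conv X gs g" and y: "y \<in> cont_pts X g" and e: "e > 0"
    for gs and g :: "'a \<Rightarrow> real" and e :: real
  proof -
    obtain d where d: "d > 0" "\<And>z. z \<in> X \<Longrightarrow> dist z y < d \<Longrightarrow> dist (g z) (g y) < e/2"
      using cont_ptsD(2)[OF y] e unfolding continuous_within_eps_delta by (meson half_gt_zero)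
    have "g z \<le> g y + e/2" if "z \<in> cont_pts X g" "dist y z < d" for z
      using d(2)[OF cont_ptsD(1)[OF that(1)]] that(2) abs_ge_self[of "g z - g y"]
      by (simp add: dist_real_def dist_commute)
    from env_conv_upper[OF gs g ec subset_refl cae_conull[OF g] d(1) this, where e="e/2"] e
    have "\<forall>\<^sub>F i in sequentially. \<forall>z\<in>X. dist y z < d / 2 \<longrightarrow> gs i z \<le> g y + e/2 + e/2" by simp
    then show ?thesis using cont_ptsD(1)[OF y] d(1) by (auto elim!: eventually_mono)
  qed
  have "\<forall>\<^sub>F i in sequentially. dist (fs i y) (f y) < e" if "e > 0" for e
  proof -
    have e2: "e/2 > 0" using that by simp
    have "\<forall>\<^sub>F i in sequentially. - fs i y \<le> - f y + e/2"
      using y by (intro up[OF cae_minus[OF fs(1)] continuous_on_minus[OF fs(2)] cae_minus[OF f] env_conv_minus[OF ec] _ e2])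
         (simp add: cont_pts_minus)
    with up[OF fs f ec y e2] show ?thesis
      by eventually_elim (use that in \<open>auto simp: dist_real_def abs_less_iff\<close>)
  qed
  then show ?thesis by (rule tendstoI)
qed

end

section \<open>The limit of a convergent sequence with convergent gradients\<close>

locale grad_limit = bounded_domain +
  fixes fs :: "nat \<Rightarrow> 'a::euclidean_space \<Rightarrow> real" and Ds :: "nat \<Rightarrow> 'a \<Rightarrow> 'a"
    and f :: "'a \<Rightarrow> real" and F :: "'a \<Rightarrow> 'a"
  assumes c10: "\<And>i. c10_grad X (fs i) (Ds i)"
    and f: "cae X f" and F: "cae X F"
    and rf: "(\<lambda>i. r_ae X (fs i) f) \<longlonglongrightarrow> 0" and rF: "(\<lambda>i. rv_ae X (Ds i) F) \<longlonglongrightarrow> 0"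
begin

lemma gd: "x \<in> X \<Longrightarrow> GDERIV (fs i) x :> Ds i x"
  using c10 by (simp add: c10_grad_def)

lemma Ds_env_conv:
  assumes "norm \<xi> = 1"
  shows "env_conv X (\<lambda>i x. Ds i x \<bullet> \<xi>) (\<lambda>x. F x \<bullet> \<xi>)"
proof (rule env_convI)
  show "cae X (\<lambda>x. Ds i x \<bullet> \<xi>)" "cae X (\<lambda>x. F x \<bullet> \<xi>)" for i
    using c10_cae(2)[OF c10] F by (auto intro: cae_inner)
  show "(\<lambda>i. r_ae X (\<lambda>x. Ds i x \<bullet> \<xi>) (\<lambda>x. F x \<bullet> \<xi>)) \<longlonglongrightarrow> 0"
    using rv_ae_ge[OF c10_cae(2)[OF c10] F assms] r_ae_nonneg[OF cae_inner[OF c10_cae(2)[OF c10]] cae_inner[OF F]]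
    by (intro tendsto_sandwich[OF _ _ tendsto_const rF] always_eventually) auto
qed

lemma Ds_upper:
  assumes "norm \<xi> = 1" "\<rho> > 0" "\<And>y. y \<in> cont_pts X F \<Longrightarrow> dist x y < \<rho> \<Longrightarrow> F y \<bullet> \<xi> \<le> c" "e > 0"
  shows "\<forall>\<^sub>F i in sequentially. \<forall>z\<in>X. dist x z < \<rho> / 2 \<longrightarrow> Ds i z \<bullet> \<xi> \<le> c + e"
proof (rule env_conv_upper[OF _ _ _ Ds_env_conv[OF assms(1)] cont_pts_inner cae_conull[OF F] assms(2,3,4)])
  show "cae X (\<lambda>x. Ds i x \<bullet> \<xi>)" "cae X (\<lambda>x. F x \<bullet> \<xi>)" for i
    using c10_cae(2)[OF c10] F by (auto intro: cae_inner)
  show "continuous_on X (\<lambda>x. Ds i x \<bullet> \<xi>)" for i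
    using c10 by (auto simp: c10_grad_def intro!: continuous_intros)
qed

text \<open>The envelope with \<open>k = 1\<close> is enough. The direction is that of
  \<open>Ds i z\<close> itself; it varies with \<open>i\<close> and \<open>z\<close>, which is why
  the supremum over all unit vectors in \<open>rv_ae\<close> matters.\<close>

lemma Ds_bounded: "\<exists>L>0. \<forall>\<^sub>F i in sequentially. \<forall>z\<in>X. norm (Ds i z) \<le> L"
proof -
  obtain M where M: "M \<ge> 0" "\<And>x. x \<in> X \<Longrightarrow> norm (F x) \<le> M" using bounded_normD[OF cae_bounded[OF F]] by blast
  have "\<forall>\<^sub>F i in sequentially. rv_ae X (Ds i) F < 1" by (rule order_tendstoD(2)[OF rF]) simp
  then have "\<forall>\<^sub>F i in sequentially. \<forall>z\<in>X. norm (Ds i z) \<le> M + 2"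
  proof eventually_elim
    case (elim i)
    show ?case
    proof
      fix z assume z: "z \<in> X"
      show "norm (Ds i z) \<le> M + 2"
      proof (cases "Ds i z = 0")
        case False
        define \<xi> where "\<xi> = sgn (Ds i z)"
        have \<xi>: "norm \<xi> = 1" using False by (simp add: \<xi>_def norm_sgn)
        let ?d = "\<lambda>x. Ds i x \<bullet> \<xi>" and ?F = "\<lambda>x. F x \<bullet> \<xi>"
        have d: "cae X ?d" "continuous_on X ?d" and F': "cae X ?F"
          using c10_cae(2)[OF c10] F c10 by (auto simp: c10_grad_def intro!: cae_inner continuous_intros)
        obtain B where B: "\<And>x. x \<in> X \<Longrightarrow> \<bar>?d x\<bar> \<le> B" using bounded_realD[OF cae_bounded[OF d(1)]] by blast
        have B': "- B \<le> - ?d y" if "y \<in> X" for y using B[OF that] by linarith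
        have "?d z \<le> uenv_ae X 1 ?d z"
          using infconv_le[where f="\<lambda>x. - ?d x" and k=1 and S=X and x=z and y=z, OF _ B' z] z
          by (simp add: uenv_ae_eq[OF X(2) z cae_bounded[OF d(1)], of X] cont_pts_continuous_on[OF d(2)])
        \<comment> \<open>The factor 2 is \<open>1 + k\<close> for \<open>k = 1\<close>; together
          with \<open>rv_ae X (Ds i) F < 1\<close> it leads to the constant
          \<open>M + 2\<close>.\<close>
        also have "\<dots> \<le> uenv_ae X 1 ?F z + 2 * r_ae X ?d ?F"
          using lenv_ae_diff(2)[OF d(1) F' order_refl z] by simp
        also have "uenv_ae X 1 ?F z \<le> M"
          using lenv_ae_abs_le(2)[OF X(2) F' _ z, of M 1] abs_inner_unit_le[OF \<xi> M(2)] by auto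
        also have "r_ae X ?d ?F \<le> 1"
          using rv_ae_ge[OF c10_cae(2)[OF c10] F \<xi>, of i] elim by linarith
        finally have "?d z \<le> M + 2" by simp
        moreover have "?d z = norm (Ds i z)"
          using False by (simp add: \<xi>_def sgn_div_norm power2_norm_eq_inner[symmetric] power2_eq_square)
        ultimately show ?thesis by simp
      qed (use M in simp)
    qed
  qed
  then show ?thesis using M(1) by (intro exI[of _ "M + 2"]) auto
qed

text \<open>Uniformly bounded gradients make the approximants equi-Lipschitz on segments, so convergence on
  the dense set of continuity points of the limit class propagates to all of the domain.\<close>

lemma limit_exists:
  obtains u L where "L > 0" "\<And>x. x \<in> X \<Longrightarrow> (\<lambda>i. fs i x) \<longlonglongrightarrow> u x"
    "\<And>x. x \<in> cont_pts X f \<Longrightarrow> u x = f x"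
    "\<And>a b. closed_segment a b \<subseteq> X \<Longrightarrow> \<bar>u b - u a\<bar> \<le> L * dist a b"
proof -
  obtain L where L: "L > 0" "\<forall>\<^sub>F i in sequentially. \<forall>z\<in>X. norm (Ds i z) \<le> L" using Ds_bounded by blast
  have lip: "\<forall>\<^sub>F i in sequentially. \<forall>a b. closed_segment a b \<subseteq> X \<longrightarrow> \<bar>fs i b - fs i a\<bar> \<le> L * dist a b"
    using L(2)
  proof eventually_elim
    case (elim i)
    have *: "fs i b - fs i a \<le> L * dist a b" if ab: "closed_segment a b \<subseteq> X" for a b
    proof (rule gderiv_segment_le[where D="Ds i"])
      fix z assume "z \<in> closed_segment a b"
      then have z: "z \<in> X" using ab by blast
      show "GDERIV (fs i) z :> Ds i z" by (rule gd[OF z])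
      have "Ds i z \<bullet> (b - a) \<le> norm (Ds i z) * norm (b - a)" by (rule norm_cauchy_schwarz)
      also have "\<dots> \<le> L * dist a b" using elim z by (auto simp: dist_norm norm_minus_commute intro!: mult_right_mono)
      finally show "Ds i z \<bullet> (b - a) \<le> L * dist a b" .
    qed
    show ?case
    proof (intro allI impI)
      fix a b assume ab: "closed_segment a b \<subseteq> X"
      then show "\<bar>fs i b - fs i a\<bar> \<le> L * dist a b"
        using *[of a b] *[of b a] by (auto simp: closed_segment_commute dist_commute abs_le_iff)
    qed
  qed
  have pw: "(\<lambda>i. fs i y) \<longlonglongrightarrow> f y" if "y \<in> cont_pts X f" for y
    by (rule env_conv_pointwise[OF c10_cae(1)[OF c10] c10_continuous[OF c10] f env_convI[OF c10_cae(1)[OF c10] f rf] that])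
  have "\<exists>l. (\<lambda>i. fs i x) \<longlonglongrightarrow> l" if x: "x \<in> X" for x
  proof -
    obtain \<rho> where \<rho>: "\<rho> > 0" "ball x \<rho> \<subseteq> X" using X(2) x openE by blast
    have "Cauchy (\<lambda>i. fs i x)"
    proof (rule metric_CauchyI)
      fix e :: real assume e: "e > 0"
      then have "min \<rho> (e / (4 * L)) > 0" using \<rho>(1) L(1) by simp
      moreover have "x \<in> closure (cont_pts X f)" using conull_dense[OF X(2) cae_conull[OF f]] x by blast
      ultimately obtain y where y: "y \<in> cont_pts X f" "dist y x < min \<rho> (e / (4 * L))"
        unfolding closure_approachable by blast
      have seg: "closed_segment x y \<subseteq> X"
        using y(2) \<rho> by (intro order_trans[OF closed_segment_subset \<rho>(2)]) (auto simp: dist_commute)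
      have "\<forall>\<^sub>F i in sequentially. dist (fs i y) (f y) < e / 4"
        using tendstoD[OF pw[OF y(1)], of "e/4"] e by simp
      with lip have "\<forall>\<^sub>F i in sequentially. dist (fs i x) (f y) < e / 2"
      proof eventually_elim
        case (elim i)
        have "\<bar>fs i y - fs i x\<bar> \<le> L * dist x y" using elim(1) seg by blast
        also have "\<dots> \<le> L * (e / (4 * L))" using y(2) L(1) by (intro mult_left_mono) (auto simp: dist_commute)
        also have "\<dots> = e / 4" using L(1) by simp
        finally show ?case using elim(2) unfolding dist_real_def by linarith
      qed
      then obtain N where N: "\<And>i. i \<ge> N \<Longrightarrow> dist (fs i x) (f y) < e / 2" by (auto simp: eventually_sequentially)
      show "\<exists>M. \<forall>m\<ge>M. \<forall>n\<ge>M. dist (fs m x) (fs n x) < e"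
      proof (intro exI[of _ N] allI impI)
        fix m n assume "N \<le> m" "N \<le> n"
        then show "dist (fs m x) (fs n x) < e"
          using dist_triangle_half_r[of "f y" "fs m x" e "fs n x"] N by (simp add: dist_commute)
      qed
    qed
    then show ?thesis using Cauchy_convergent convergent_def by blast
  qed
  then obtain u where u: "\<And>x. x \<in> X \<Longrightarrow> (\<lambda>i. fs i x) \<longlonglongrightarrow> u x" by metis
  show thesis
  proof (rule that[of L u])
    show "L > 0" by (rule L(1))
    show "(\<lambda>i. fs i x) \<longlonglongrightarrow> u x" if "x \<in> X" for x by (rule u[OF that])
    show "u x = f x" if "x \<in> cont_pts X f" for x
      using LIMSEQ_unique[OF u pw[OF that]] cont_ptsD(1)[OF that] by blast
    fix a b assume ab: "closed_segment a b \<subseteq> X"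
    then have "a \<in> X" "b \<in> X" by auto
    then have "(\<lambda>i. \<bar>fs i b - fs i a\<bar>) \<longlonglongrightarrow> \<bar>u b - u a\<bar>" by (intro tendsto_intros u)
    moreover have "\<forall>\<^sub>F i in sequentially. \<bar>fs i b - fs i a\<bar> \<le> L * dist a b"
      using lip by eventually_elim (use ab in blast)
    ultimately show "\<bar>u b - u a\<bar> \<le> L * dist a b"
      by (intro tendsto_upperbound[of _ _ sequentially]) auto
  qed
qed

context
  fixes u :: "'a \<Rightarrow> real"
  assumes u: "\<And>x. x \<in> X \<Longrightarrow> (\<lambda>i. fs i x) \<longlonglongrightarrow> u x"
begin

lemma limit_one_sided:
  assumes \<xi>: "norm \<xi> = 1" and \<rho>: "\<rho> > 0" "ball x \<rho> \<subseteq> X"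
    and c: "\<And>y. y \<in> cont_pts X F \<Longrightarrow> dist x y < \<rho> \<Longrightarrow> F y \<bullet> \<xi> \<le> c"
    and ab: "dist x a < \<rho> / 2" "dist x b < \<rho> / 2" "b - a = t *\<^sub>R \<xi>" "t \<ge> 0"
  shows "u b - u a \<le> t * c"
proof (rule field_le_epsilon)
  fix e :: real assume e: "e > 0"
  \<comment> \<open>The slack is scaled so that integrating it over length \<open>t\<close> costs at
    most \<open>e\<close>, also for \<open>t = 0\<close>.\<close>
  let ?e = "e / (t + 1)"
  have e': "?e > 0" using e ab(4) by simp
  have "\<forall>\<^sub>F i in sequentially. \<forall>z\<in>X. dist x z < \<rho> / 2 \<longrightarrow> Ds i z \<bullet> \<xi> \<le> c + ?e"
    by (rule Ds_upper[OF \<xi> \<rho>(1) _ e']) (rule c)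
  then have "\<forall>\<^sub>F i in sequentially. fs i b - fs i a \<le> t * (c + ?e)"
  proof (rule eventually_mono)
    fix i assume elim: "\<forall>z\<in>X. dist x z < \<rho> / 2 \<longrightarrow> Ds i z \<bullet> \<xi> \<le> c + ?e"
    show "fs i b - fs i a \<le> t * (c + ?e)"
    proof (rule gderiv_segment_le[where D="Ds i"])
      fix z assume z: "z \<in> closed_segment a b"
      moreover have "closed_segment a b \<subseteq> ball x (\<rho>/2)"
        using ab by (intro closed_segment_subset) auto
      ultimately have z': "dist x z < \<rho> / 2" by auto
      then have "z \<in> X" using \<rho> by (intro subsetD[OF \<rho>(2)]) auto
      then show "GDERIV (fs i) z :> Ds i z" by (rule gd)
      have "Ds i z \<bullet> \<xi> \<le> c + ?e" using elim z' \<open>z \<in> X\<close> by blast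
      then show "Ds i z \<bullet> (b - a) \<le> t * (c + ?e)" using ab(3,4) by (simp add: mult_left_mono)
    qed
  qed
  moreover have "a \<in> X" "b \<in> X" using ab \<rho> by (auto intro!: subsetD[OF \<rho>(2)])
  then have "(\<lambda>i. fs i b - fs i a) \<longlonglongrightarrow> u b - u a" by (intro tendsto_intros u)
  ultimately have "u b - u a \<le> t * (c + ?e)"
    by (intro tendsto_upperbound[of _ _ sequentially]) auto
  also have "\<dots> \<le> t * c + e" using e ab(4) by (simp add: field_simps)
  finally show "u b - u a \<le> t * c + e" .
qed

text \<open>Near \<open>y\<close> the map \<open>F\<close> stays within \<open>e\<close> of
  \<open>F y\<close>, so \<open>limit_one_sided\<close> in the directions \<open>\<xi>\<close> and
  \<open>- \<xi>\<close> bounds the difference quotient from both sides, uniformly in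
  \<open>\<xi>\<close>.\<close>

lemma limit_gderiv:
  assumes y: "y \<in> cont_pts X F" shows "GDERIV u y :> F y"
  unfolding gderiv_def has_derivative_at_alt
proof (intro conjI allI impI)
  show "bounded_linear (\<lambda>h. h \<bullet> F y)" by (rule bounded_linear_inner_left)
  fix e :: real assume e: "e > 0"
  obtain d where d: "d > 0" "\<And>z. z \<in> X \<Longrightarrow> dist z y < d \<Longrightarrow> dist (F z) (F y) < e"
    using cont_ptsD(2)[OF y] e unfolding continuous_within_eps_delta by meson
  obtain r where r: "r > 0" "ball y r \<subseteq> X" using X(2) cont_ptsD(1)[OF y] openE by blast
  define \<rho> where "\<rho> = min d r"
  have \<rho>: "\<rho> > 0" "ball y \<rho> \<subseteq> X" using d r by (auto simp: \<rho>_def)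
  have near: "F z \<bullet> \<xi> \<le> F y \<bullet> \<xi> + e" if "z \<in> cont_pts X F" "dist y z < \<rho>" "norm \<xi> = 1" for z \<xi>
  proof -
    have "(F z - F y) \<bullet> \<xi> \<le> norm (F z - F y) * norm \<xi>" by (rule norm_cauchy_schwarz)
    also have "\<dots> \<le> e" using d(2)[OF cont_ptsD(1)[OF that(1)]] that(2,3) by (simp add: \<rho>_def dist_norm norm_minus_commute)
    finally show ?thesis by (simp add: inner_diff_left)
  qed
  have "norm (u b - u y - (b - y) \<bullet> F y) \<le> e * norm (b - y)" if b: "norm (b - y) < \<rho> / 2" for b
  proof (cases "b = y")
    case False
    define t where "t = norm (b - y)"
    define \<xi> where "\<xi> = (b - y) /\<^sub>R t"
    have t: "t > 0" using False by (simp add: t_def)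
    have \<xi>: "norm \<xi> = 1" "norm (- \<xi>) = 1" "b - y = t *\<^sub>R \<xi>" "y - b = t *\<^sub>R (- \<xi>)"
      using t by (auto simp: \<xi>_def t_def[symmetric])
    have by_ball: "dist y b < \<rho> / 2" "dist y y < \<rho> / 2" using b \<rho>(1) by (auto simp: dist_norm norm_minus_commute)
    have "u b - u y \<le> t * (F y \<bullet> \<xi> + e)"
      using \<xi> t by (intro limit_one_sided[OF \<xi>(1) \<rho> _ by_ball(2,1) \<xi>(3)] near) simp_all
    moreover have "u y - u b \<le> t * (F y \<bullet> (- \<xi>) + e)"
      using \<xi> t by (intro limit_one_sided[OF \<xi>(2) \<rho> _ by_ball(1,2) \<xi>(4)] near) simp_all
    moreover have "(b - y) \<bullet> F y = t * (F y \<bullet> \<xi>)" unfolding \<xi>(3) by (simp add: inner_commute)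
    ultimately show ?thesis unfolding t_def[symmetric] by (simp add: algebra_simps abs_le_iff)
  qed simp
  then show "\<exists>d>0. \<forall>b. norm (b - y) < d \<longrightarrow> norm (u b - u y - (b - y) \<bullet> F y) \<le> e * norm (b - y)"
    using \<rho>(1) by (intro exI[of _ "\<rho> / 2"]) auto
qed

text \<open>A gradient outside the closed hull could be strictly separated from it, giving a
  direction in which the nearby values of \<open>F\<close> have component at most \<open>c\<close>
  and \<open>D\<close> has more. By \<open>limit_one_sided\<close>, \<open>u\<close> cannot grow
  faster than \<open>c\<close> in that direction, against differentiability at
  \<open>x\<close>.\<close>

lemma limit_gderiv_in_hull:
  assumes x: "x \<in> X" "dist x0 x < r" and D: "GDERIV u x :> D"
  shows "D \<in> closure (convex hull (F ` (ball x0 r \<inter> cont_pts X F)))" (is "D \<in> ?C")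
proof (rule ccontr)
  assume "D \<notin> ?C"
  moreover have "convex ?C" "closed ?C" by (auto intro: convex_closure convex_convex_hull)
  ultimately obtain a b where ab: "a \<bullet> D < b" "\<forall>z\<in>?C. b < a \<bullet> z"
    using separating_hyperplane_closed_point by blast
  obtain d where d: "d > 0" "ball x d \<subseteq> X" using X(2) x(1) openE by blast
  define \<rho> where "\<rho> = min d (r - dist x0 x)"
  have \<rho>: "\<rho> > 0" "ball x \<rho> \<subseteq> X" using d x by (auto simp: \<rho>_def)
  have sub: "y \<in> ball x0 r" if "dist x y < \<rho>" for y
    using that dist_triangle[of x0 y x] by (auto simp: \<rho>_def)
  have Fb: "b < a \<bullet> F y" if "y \<in> cont_pts X F" "dist x y < \<rho>" for y
  proof -
    have "F y \<in> F ` (ball x0 r \<inter> cont_pts X F)" using sub[OF that(2)] that(1) by blast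
    then have "F y \<in> ?C" using closure_subset hull_inc by (metis subsetD)
    then show ?thesis using ab(2) by blast
  qed
  \<comment> \<open>Separation alone does not exclude a zero normal; a continuity point near
    \<open>x\<close>, whose value lies on the other side, does.\<close>
  have "a \<noteq> 0"
  proof
    assume "a = 0"
    have "x \<in> closure (cont_pts X F)" using conull_dense[OF X(2) cae_conull[OF F]] x by blast
    then obtain y where "y \<in> cont_pts X F" "dist y x < \<rho>" using \<rho>(1) unfolding closure_approachable by blast
    with Fb[of y] ab(1) \<open>a = 0\<close> show False by (auto simp: dist_commute)
  qed
  \<comment> \<open>The separation puts \<open>D\<close> on the lower side, so the sign is reversed
    to obtain a direction in which \<open>D\<close> has the larger component.\<close>
  define \<xi> where "\<xi> = (- a) /\<^sub>R norm a"
  have \<xi>: "norm \<xi> = 1" using \<open>a \<noteq> 0\<close> by (simp add: \<xi>_def)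
  define c where "c = - b / norm a"
  have Fc: "F y \<bullet> \<xi> \<le> c" if "y \<in> cont_pts X F" "dist x y < \<rho>" for y
    using Fb[OF that] \<open>a \<noteq> 0\<close> by (simp add: \<xi>_def c_def field_simps inner_commute)
  have "D \<bullet> \<xi> > c" using ab(1) \<open>a \<noteq> 0\<close> by (simp add: \<xi>_def c_def field_simps inner_commute)
  then have e: "D \<bullet> \<xi> - c > 0" by simp
  have "\<exists>s>0. \<forall>y. norm (y - x) < s \<longrightarrow> norm (u y - u x - (y - x) \<bullet> D) \<le> ((D \<bullet> \<xi> - c) / 2) * norm (y - x)"
    using D e unfolding gderiv_def has_derivative_at_alt by (metis half_gt_zero)
  then obtain s where s: "s > 0" "\<And>y. norm (y - x) < s \<Longrightarrow> norm (u y - u x - (y - x) \<bullet> D) \<le> ((D \<bullet> \<xi> - c) / 2) * norm (y - x)"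
    by blast
  define t where "t = min (s / 2) (\<rho> / 4)"
  have t: "t > 0" "t < s" "t < \<rho> / 2" using s \<rho> by (auto simp: t_def min_def)
  define y where "y = x + t *\<^sub>R \<xi>"
  have n: "norm (y - x) = t" "y - x = t *\<^sub>R \<xi>" using \<xi> t by (auto simp: y_def)
  have "u y - u x \<le> t * c"
    using t n(1) \<rho>(1) by (intro limit_one_sided[OF \<xi> \<rho> _ _ _ n(2)] Fc) (auto simp: dist_norm norm_minus_commute)
  moreover have "\<bar>u y - u x - t * (D \<bullet> \<xi>)\<bar> \<le> ((D \<bullet> \<xi> - c) / 2) * t"
    using s(2)[of y] t n by (simp add: inner_commute)
  ultimately have "t * (D \<bullet> \<xi>) - t * c \<le> ((D \<bullet> \<xi> - c) / 2) * t"
    unfolding abs_le_iff by linarith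
  then have "(D \<bullet> \<xi> - c) * t \<le> 0" by (simp add: algebra_simps)
  with e t(1) show False by (simp add: mult_le_0_iff)
qed

text \<open>The two closed hulls agree already for each radius: gradients at continuity points give
  one inclusion, \<open>limit_gderiv_in_hull\<close> the other.\<close>

lemma limit_clarke:
  assumes "x \<in> X" shows "class_value X F x = clarke_grad X u x"
  unfolding class_value_def clarke_grad_def
proof (rule INF_cong[OF refl])
  fix r :: real
  let ?A = "F ` (ball x r \<inter> cont_pts X F)" and ?B = "{D. \<exists>x'\<in>ball x r \<inter> X. GDERIV u x' :> D}"
  have "?A \<subseteq> ?B" using limit_gderiv cont_ptsD(1) by blast
  then have "closure (convex hull ?A) \<subseteq> closure (convex hull ?B)" by (intro closure_mono hull_mono)
  moreover have "?B \<subseteq> closure (convex hull ?A)" using limit_gderiv_in_hull by auto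
  then have "convex hull ?B \<subseteq> closure (convex hull ?A)" by (intro hull_minimal) (auto intro: convex_closure)
  then have "closure (convex hull ?B) \<subseteq> closure (convex hull ?A)" by (intro closure_minimal) auto
  ultimately show "closure (convex hull ?A) = closure (convex hull ?B)" by blast
qed

end

end

section \<open>Envelopes of local averages\<close>

text \<open>A substitute for uniform continuity on \<open>S\<close>. The graph over \<open>S\<close>
  is totally bounded, so finitely many of its points are close to all others in position and value,
  and continuity at these finitely many yields a common radius \<open>\<rho>\<close>. Each value of
  \<open>F\<close> is thus nearly kept on a ball of radius \<open>\<rho>\<close> close by, as far as
  points of \<open>S\<close> are concerned.\<close>

lemma good_points:
  fixes S :: "'a::euclidean_space set" and F :: "'a \<Rightarrow> 'b::euclidean_space"
  assumes "bounded S" "bounded (F ` S)" and cont: "S \<subseteq> cont_pts X F" and pos: "0 < \<sigma>" "0 < \<eta>"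
  shows "\<exists>\<rho>>0. \<forall>y\<in>S. \<exists>t\<in>S. dist y t \<le> \<sigma> \<and> dist (F y) (F t) \<le> \<eta> \<and>
           (\<forall>z\<in>S. dist t z < \<rho> \<longrightarrow> dist (F z) (F t) \<le> \<eta>)"
proof -
  define G where "G = (\<lambda>y. (y, F y)) ` S"
  \<comment> \<open>The centres of the finite net lie only in the closure of the graph, so the way
    from \<open>y\<close> through a centre to a point of \<open>S\<close> takes two steps of size
    \<open>e\<close>.\<close>
  define e where "e = min \<sigma> \<eta> / 2"
  have e: "e > 0" using pos by (simp add: e_def)
  have "bounded G" by (rule bounded_subset[OF bounded_Times[OF assms(1,2)]]) (auto simp: G_def)
  then have "seq_compact (closure G)" by (intro compact_imp_seq_compact) (simp add: compact_closure)
  from seq_compact_imp_totally_bounded[OF this, rule_format, OF e]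
  obtain K where K: "finite K" "K \<subseteq> closure G" "closure G \<subseteq> (\<Union>c\<in>K. ball c e)" by (elim exE conjE)
  have "\<exists>t\<in>S. dist (t, F t) c < e" if "c \<in> K" for c
  proof -
    have "c \<in> closure G" using K(2) that by blast
    then obtain g where "g \<in> G" "dist g c < e" using e closure_approachable[of c G] by blast
    then show ?thesis by (auto simp: G_def)
  qed
  then have "\<forall>c\<in>K. \<exists>t. t \<in> S \<and> dist (t, F t) c < e" by blast
  from bchoice[OF this]
  obtain \<tau> where \<tau>: "\<And>c. c \<in> K \<Longrightarrow> \<tau> c \<in> S \<and> dist (\<tau> c, F (\<tau> c)) c < e" by blast
  have "\<exists>\<delta>>0. \<forall>z\<in>S. dist (\<tau> c) z < \<delta> \<longrightarrow> dist (F z) (F (\<tau> c)) \<le> \<eta>" if c: "c \<in> K" for c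
  proof -
    have "\<tau> c \<in> cont_pts X F" using cont \<tau>[OF c] by auto
    then have "continuous (at (\<tau> c) within X) F" by (rule cont_ptsD(2))
    then obtain \<delta> where \<delta>: "\<delta> > 0" "\<And>z. z \<in> X \<Longrightarrow> dist z (\<tau> c) < \<delta> \<Longrightarrow> dist (F z) (F (\<tau> c)) < \<eta>"
      using pos(2) unfolding continuous_within_eps_delta by meson
    show ?thesis
    proof (intro exI[of _ \<delta>] conjI \<delta>(1) ballI impI)
      fix z assume z: "z \<in> S" "dist (\<tau> c) z < \<delta>"
      then have "z \<in> X" using cont cont_ptsD(1)[of z X F] by blast
      from \<delta>(2)[OF this] z(2) show "dist (F z) (F (\<tau> c)) \<le> \<eta>" by (simp add: dist_commute)
    qed
  qed
  then have "\<forall>c\<in>K. \<exists>\<delta>. \<delta> > 0 \<and> (\<forall>z\<in>S. dist (\<tau> c) z < \<delta> \<longrightarrow> dist (F z) (F (\<tau> c)) \<le> \<eta>)" by simp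
  from bchoice[OF this]
  obtain \<delta> where \<delta>: "\<And>c. c \<in> K \<Longrightarrow> \<delta> c > 0 \<and> (\<forall>z\<in>S. dist (\<tau> c) z < \<delta> c \<longrightarrow> dist (F z) (F (\<tau> c)) \<le> \<eta>)"
    by blast
  define \<rho> where "\<rho> = Min (insert 1 (\<delta> ` K))"
  have \<rho>: "\<rho> > 0" "\<And>c. c \<in> K \<Longrightarrow> \<rho> \<le> \<delta> c" using K(1) \<delta> by (auto simp: \<rho>_def)
  show ?thesis
  proof (intro exI[of _ \<rho>] conjI \<rho>(1) ballI)
    fix y assume y: "y \<in> S"
    then have "(y, F y) \<in> closure G" using closure_subset[of G] by (auto simp: G_def)
    then obtain c where c: "c \<in> K" "dist c (y, F y) < e" using K(3) by auto
    have "dist (y, F y) (\<tau> c, F (\<tau> c)) < e + e"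
      using dist_triangle[of "(y, F y)" "(\<tau> c, F (\<tau> c))" c] c(2) \<tau>[OF c(1)]
      unfolding dist_commute[of c "(y, F y)"] dist_commute[of c "(\<tau> c, F (\<tau> c))"] by linarith
    then have "dist y (\<tau> c) < 2 * e" "dist (F y) (F (\<tau> c)) < 2 * e"
      using dist_fst_le[of "(y, F y)" "(\<tau> c, F (\<tau> c))"] dist_snd_le[of "(y, F y)" "(\<tau> c, F (\<tau> c))"] by auto
    then have "dist y (\<tau> c) \<le> \<sigma>" "dist (F y) (F (\<tau> c)) \<le> \<eta>" by (auto simp: e_def)
    moreover have "\<forall>z\<in>S. dist (\<tau> c) z < \<rho> \<longrightarrow> dist (F z) (F (\<tau> c)) \<le> \<eta>"
      using \<delta>[OF c(1)] \<rho>(2)[OF c(1)] by auto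
    ultimately show "\<exists>t\<in>S. dist y t \<le> \<sigma> \<and> dist (F y) (F t) \<le> \<eta> \<and>
           (\<forall>z\<in>S. dist t z < \<rho> \<longrightarrow> dist (F z) (F t) \<le> \<eta>)"
      using \<tau>[OF c(1)] by blast
  qed
qed

lemma layer_index:
  fixes a :: real
  assumes a: "0 < a" "a \<le> 1" shows "\<exists>m::nat. 1 \<le> m \<and> 1 \<le> real m * a \<and> real m * a \<le> 2"
proof -
  define m where "m = nat \<lceil>1 / a\<rceil>"
  have "real m = of_int \<lceil>1 / a\<rceil>" using a by (simp add: m_def)
  then have "1 / a \<le> real m" "real m < 1 / a + 1" by linarith+
  then have "1 \<le> real m * a" "real m * a \<le> 1 + a" using a by (auto simp: field_simps)
  moreover have "m \<noteq> 0" using calculation by (intro notI) simp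
  ultimately show ?thesis using a by (intro exI[of _ m]) auto
qed

text \<open>Comparison of the Lipschitz minorants of a function \<open>f\<close> and of a local average \<open>v\<close> of \<open>f\<close> over
  balls of variable radius \<open>\<epsilon>\<close>, uniformly in the Lipschitz constant \<open>k\<close>. The radius may only depend on
  the distance \<open>d\<close> to the boundary, and \<open>m\<close> indexes the layer \<open>d \<approx> 1/m\<close>. On a layer where \<open>k\<close> is small
  compared with \<open>1 / p m\<close> the two minorants are uniformly close; where it is large both of them take
  near \<open>x\<close> all the values between the essential bounds of \<open>f\<close> near \<open>x\<close>.\<close>

locale infconv_pair =
  fixes X S :: "'a::euclidean_space set" and f v \<epsilon> d :: "'a \<Rightarrow> real" and M \<eta> :: real
    and r \<rho> p \<rho>' q :: "nat \<Rightarrow> real"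
  assumes SX: "S \<subseteq> X" "X \<subseteq> closure S" and \<eta>: "0 < \<eta>" "\<eta> \<le> 1" and M: "0 \<le> M"
    and f: "\<And>y. y \<in> S \<Longrightarrow> \<bar>f y\<bar> \<le> M" and v: "\<And>x. x \<in> X \<Longrightarrow> \<bar>v x\<bar> \<le> M + 1"
    and up: "\<And>x c. x \<in> X \<Longrightarrow> (\<And>y. y \<in> S \<Longrightarrow> dist x y \<le> \<epsilon> x \<Longrightarrow> f y \<le> c) \<Longrightarrow> v x \<le> c + \<eta>"
    and lo: "\<And>x c. x \<in> X \<Longrightarrow> (\<And>y. y \<in> S \<Longrightarrow> dist x y \<le> \<epsilon> x \<Longrightarrow> c \<le> f y) \<Longrightarrow> c - \<eta> \<le> v x"
    and d: "\<And>x y. \<bar>d x - d y\<bar> \<le> dist x y" "\<And>x. x \<in> X \<Longrightarrow> 0 < d x" "\<And>x. d x \<le> 1"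
      "\<And>x. x \<in> X \<Longrightarrow> ball x (d x) \<subseteq> X"
    and r: "\<And>m. 1 \<le> m \<Longrightarrow> 0 < r m" "\<And>m. 1 \<le> m \<Longrightarrow> r m \<le> \<eta> / 4" "\<And>m. 1 \<le> m \<Longrightarrow> real m * r m \<le> 1 / 16"
    and \<rho>: "\<And>m. 1 \<le> m \<Longrightarrow> 0 < \<rho> m" "\<And>m. 1 \<le> m \<Longrightarrow> \<rho> m \<le> r m"
    and p: "\<And>m. 1 \<le> m \<Longrightarrow> 0 < p m" "\<And>m. 1 \<le> m \<Longrightarrow> p m * (4 * M + 6) \<le> \<eta> * \<rho> m" "\<And>m. 1 \<le> m \<Longrightarrow> p m \<le> r m"
    and q: "\<And>m. 1 \<le> m \<Longrightarrow> q m \<le> \<rho> m / 4" "\<And>m. 1 \<le> m \<Longrightarrow> q m \<le> p m" "\<And>m. 1 \<le> m \<Longrightarrow> q m < \<rho>' m"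
    and good: "\<And>m y. 1 \<le> m \<Longrightarrow> y \<in> S \<Longrightarrow> \<exists>t\<in>S. dist y t \<le> r m \<and> \<bar>f y - f t\<bar> \<le> \<eta> \<and>
           (\<forall>z\<in>S. dist t z < \<rho> m \<longrightarrow> \<bar>f z - f t\<bar> \<le> \<eta>)"
    and good': "\<And>m y. 1 \<le> m \<Longrightarrow> y \<in> S \<Longrightarrow> \<exists>t\<in>S. dist y t \<le> p m \<and> \<bar>f y - f t\<bar> \<le> \<eta> \<and>
           (\<forall>z\<in>S. dist t z < \<rho>' m \<longrightarrow> \<bar>f z - f t\<bar> \<le> \<eta>)"
    and \<epsilon>: "\<And>m x. 1 \<le> m \<Longrightarrow> x \<in> X \<Longrightarrow> real m * d x \<le> 4 \<Longrightarrow> \<epsilon> x \<le> q m"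
begin

lemma layer:
  assumes "x \<in> X" obtains m :: nat where "1 \<le> m" "1 \<le> real m * d x" "real m * d x \<le> 2"
  using layer_index[OF d(2)[OF assms] d(3)] by blast

context
  fixes k :: real
  assumes k: "0 < k"
begin

abbreviation "A \<equiv> infconv k X v"
abbreviation "B \<equiv> infconv k S f"

lemma fb: "y \<in> S \<Longrightarrow> - M \<le> f y" "y \<in> S \<Longrightarrow> f y \<le> M" using f by (auto simp: abs_le_iff minus_le_iff)
lemma vb: "y \<in> X \<Longrightarrow> - (M + 1) \<le> v y" "y \<in> X \<Longrightarrow> v y \<le> M + 1"
  using v[of y] by linarith+

lemma A_le: "y \<in> X \<Longrightarrow> A x \<le> v y + k * dist x y" by (rule infconv_le[OF _ vb(1)]) (use k in auto)
lemma B_le: "y \<in> S \<Longrightarrow> B x \<le> f y + k * dist x y" by (rule infconv_le[OF _ fb(1)]) (use k in auto)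

lemma A_le_v: "x \<in> X \<Longrightarrow> A x \<le> v x" using A_le[of x x] by simp
lemma B_le_f: "x \<in> S \<Longrightarrow> B x \<le> f x" using B_le[of x x] by simp

lemma B_le_local:
  assumes "x \<in> X" "0 < s" "\<And>y. y \<in> S \<Longrightarrow> dist x y < s \<Longrightarrow> f y \<le> c" shows "B x \<le> c"
  using assms k SX(2) by (intro infconv_le_local[OF _ fb(1) _ assms(2,3)]) auto

lemma B_ge:
  assumes "x \<in> X" "\<And>y. y \<in> S \<Longrightarrow> k * dist x y < 2 * M + 3 \<Longrightarrow> c \<le> f y + k * dist x y" "c \<le> M + 1"
  shows "c \<le> B x"
proof (rule infconv_ge)
  show "S \<noteq> {}" using assms(1) SX(2) by auto
  fix y assume "y \<in> S"
  with assms(2)[OF this] fb(1)[OF this] assms(3) show "c \<le> f y + k * dist x y" by linarith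
qed

lemma A_ge:
  assumes "x \<in> X" "\<And>y. y \<in> X \<Longrightarrow> k * dist x y < 2 * M + 3 \<Longrightarrow> c \<le> v y + k * dist x y" "c \<le> M + 1"
  shows "c \<le> A x"
proof (rule infconv_ge)
  show "X \<noteq> {}" using assms(1) by auto
  fix y assume "y \<in> X"
  with assms(2)[OF this] vb(1)[OF this] assms(3) show "c \<le> v y + k * dist x y" by linarith
qed

text \<open>The purpose of \<open>p m * (4 * M + 6) \<le> \<eta> * \<rho> m\<close>: since
  \<open>4 * M + 6\<close> is twice the cutoff, on a layer with \<open>\<eta> \<le> k * p m\<close>
  every competitor that counts lies within \<open>\<rho> m / 2\<close>.\<close>

lemma radius_of_large:
  assumes "1 \<le> m" "\<eta> \<le> k * p m" shows "4 * M + 6 \<le> k * \<rho> m"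
proof -
  have "\<eta> * (4 * M + 6) \<le> k * p m * (4 * M + 6)" using assms(2) M by (intro mult_right_mono) auto
  also have "\<dots> \<le> k * (\<eta> * \<rho> m)" using p(2)[OF assms(1)] k by (simp add: mult.assoc)
  finally have "\<eta> * (4 * M + 6) \<le> \<eta> * (k * \<rho> m)" by (simp add: ac_simps)
  then show ?thesis using \<eta>(1) by simp
qed

lemma near_of_large:
  assumes "1 \<le> m" "\<eta> \<le> k * p m" "k * dist x y < 2 * M + 3" shows "dist x y < \<rho> m / 2"
proof -
  have "k * dist x y < k * (\<rho> m / 2)" using radius_of_large[OF assms(1,2)] assms(3) by linarith
  then show ?thesis using k by simp
qed

text \<open>While \<open>k * p m < \<eta>\<close>, moving a competitor by \<open>p m\<close> changes
  its penalty by less than \<open>\<eta>\<close>. An average can then be traded for values of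
  \<open>f\<close> nearby, and a value of \<open>f\<close> for the average at a good point within
  \<open>p m\<close>.\<close>

lemma small_case:
  assumes x: "x \<in> X" and small: "\<And>m. 1 \<le> m \<Longrightarrow> 1 \<le> 2 * (real m * d x) \<Longrightarrow> real m * d x \<le> 3 \<Longrightarrow> k * p m < \<eta>"
  shows "\<bar>A x - B x\<bar> \<le> 4 * \<eta>"
proof -
  \<comment> \<open>The hypothesis concerns layers of \<open>x\<close>, but the competitor
    \<open>y\<close> may lie in another one. Were \<open>k\<close> large on the layer of
    \<open>y\<close>, then \<open>y\<close> would be so close to \<open>x\<close> that this layer,
    widened to the range from 1/2 to 3, contains \<open>x\<close>.\<close>
  have rel: "k * p m < \<eta>" if y: "k * dist x y < 2 * M + 3" and m: "1 \<le> m" "1 \<le> real m * d y" "real m * d y \<le> 2" for y m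
  proof (rule ccontr)
    assume "\<not> k * p m < \<eta>"
    then have large: "\<eta> \<le> k * p m" by simp
    have "dist x y \<le> r m" using near_of_large[OF m(1) large y] \<rho>[OF m(1)] by linarith
    then have "\<bar>d x - d y\<bar> \<le> r m" using d(1)[of x y] by linarith
    then have "real m * \<bar>d x - d y\<bar> \<le> 1/16" using r(3)[OF m(1)] by (meson mult_left_mono of_nat_0_le_iff order_trans)
    then have "\<bar>real m * d x - real m * d y\<bar> \<le> 1/16" by (simp add: abs_mult flip: right_diff_distrib)
    with m have "1 \<le> 2 * (real m * d x)" "real m * d x \<le> 3" by linarith+
    from small[OF m(1) this] large show False by simp
  qed
  have "B x - 2 * \<eta> \<le> A x"
  proof (rule A_ge[OF x])
    show "B x - 2 * \<eta> \<le> M + 1"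
      using B_le_local[OF x zero_less_one fb(2)] \<eta> by simp
    fix y assume y: "y \<in> X" "k * dist x y < 2 * M + 3"
    obtain m where m: "1 \<le> m" "1 \<le> real m * d y" "real m * d y \<le> 2" using layer[OF y(1)] by blast
    have "\<epsilon> y \<le> p m" using \<epsilon>[OF m(1) y(1)] m q(2)[OF m(1)] by linarith
    then have "k * \<epsilon> y \<le> k * p m" using k by simp
    then have k\<epsilon>: "k * \<epsilon> y \<le> \<eta>" using rel[OF y(2) m] by linarith
    have "B x - k * dist x y - \<eta> - \<eta> \<le> v y"
    proof (rule lo[OF y(1)])
      fix z assume z: "z \<in> S" "dist y z \<le> \<epsilon> y"
      have "k * dist x z \<le> k * (dist x y + dist y z)" using k by (simp add: dist_triangle)
      also have "\<dots> \<le> k * dist x y + k * \<epsilon> y" using k z by (simp add: distrib_left)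
      finally show "B x - k * dist x y - \<eta> \<le> f z" using B_le[OF z(1), of x] k\<epsilon> by linarith
    qed
    then show "B x - 2 * \<eta> \<le> v y + k * dist x y" by linarith
  qed
  moreover have "A x - 4 * \<eta> \<le> B x"
  proof (rule B_ge[OF x])
    show "A x - 4 * \<eta> \<le> M + 1" using A_le_v[OF x] vb(2)[OF x] \<eta> by linarith
    fix y assume y: "y \<in> S" "k * dist x y < 2 * M + 3"
    then have yX: "y \<in> X" using SX by blast
    obtain m where m: "1 \<le> m" "1 \<le> real m * d y" "real m * d y \<le> 2" using layer[OF yX] by blast
    \<comment> \<open>\<open>v y\<close> itself may far exceed \<open>f y\<close> if
      \<open>f\<close> jumps within \<open>\<epsilon> y\<close> of \<open>y\<close>. At the good
      point \<open>t\<close> the averaging radius is below \<open>\<rho>' m\<close>, a distance up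
      to which \<open>f\<close> is nearly constant on \<open>S\<close>.\<close>
    obtain t where t: "t \<in> S" "dist y t \<le> p m" "\<bar>f y - f t\<bar> \<le> \<eta>"
      "\<And>z. z \<in> S \<Longrightarrow> dist t z < \<rho>' m \<Longrightarrow> \<bar>f z - f t\<bar> \<le> \<eta>" using good'[OF m(1) y(1)] by blast
    have tX: "t \<in> X" using t SX by blast
    have "\<bar>d t - d y\<bar> \<le> r m" using d(1)[of t y] t(2) p(3)[OF m(1)] by (simp add: dist_commute)
    then have "real m * \<bar>d t - d y\<bar> \<le> 1/16" using r(3)[OF m(1)] by (meson mult_left_mono of_nat_0_le_iff order_trans)
    then have "\<bar>real m * d t - real m * d y\<bar> \<le> 1/16" by (simp add: abs_mult flip: right_diff_distrib)
    then have "real m * d t \<le> 4" using m(3) by linarith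
    from \<epsilon>[OF m(1) tX this] q(3)[OF m(1)] have \<epsilon>t: "\<epsilon> t < \<rho>' m" by linarith
    have "v t \<le> f t + \<eta> + \<eta>"
    proof (rule up[OF tX])
      fix z assume "z \<in> S" "dist t z \<le> \<epsilon> t"
      with t(4)[of z] \<epsilon>t show "f z \<le> f t + \<eta>" by (simp add: abs_le_iff)
    qed
    moreover have "k * dist x t \<le> k * dist x y + k * p m"
    proof -
      have "k * dist x t \<le> k * (dist x y + dist y t)" using k by (simp add: dist_triangle)
      also have "\<dots> \<le> k * dist x y + k * p m" using k t(2) by (simp add: distrib_left)
      finally show ?thesis .
    qed
    ultimately show "A x - 4 * \<eta> \<le> f y + k * dist x y"
      using A_le[OF tX, of x] rel[OF y(2) m] t(3) unfolding abs_le_iff by linarith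
  qed
  ultimately show ?thesis using \<eta>(1) by (simp add: abs_le_iff)
qed

text \<open>For large \<open>k\<close> only competitors within \<open>\<rho> m / 2\<close> count, so
  both envelopes at \<open>x\<close> stay, up to \<open>\<eta>\<close>, between the extreme values
  \<open>l\<close> and \<open>h\<close> of \<open>f\<close> near \<open>x\<close>. Both also come
  near \<open>l\<close> and near \<open>h\<close> at good points, and continuity fills in the values
  between. At \<open>x\<close> itself they are compared only through the spread \<open>w\<close> of
  \<open>f\<close>.\<close>

lemma large_case:
  assumes x: "x \<in> X" and m: "1 \<le> m" "1 \<le> 2 * (real m * d x)" "real m * d x \<le> 3" and large: "\<eta> \<le> k * p m"
  shows "\<exists>x'\<in>X. dist x x' \<le> \<eta> \<and> \<bar>A x - B x'\<bar> \<le> 6 * \<eta>" "\<exists>x'\<in>X. dist x x' \<le> \<eta> \<and> \<bar>B x - A x'\<bar> \<le> 6 * \<eta>"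
    and "\<And>w. (\<And>y z. y \<in> S \<Longrightarrow> z \<in> S \<Longrightarrow> dist x y < \<eta> \<Longrightarrow> dist x z < \<eta> \<Longrightarrow> f y - f z \<le> w) \<Longrightarrow> \<bar>A x - B x\<bar> \<le> w + 2 * \<eta>"
proof -
  \<comment> \<open>\<open>r m\<close> exceeds the reach \<open>\<rho> m / 2\<close> of the
    competitors plus the averaging radius \<open>\<rho> m / 4\<close>, so every value of
    \<open>f\<close> that counts at \<open>x\<close> is taken in \<open>N\<close>.\<close>
  define N where "N = {y \<in> S. dist x y < r m}"
  have rm: "0 < r m" "r m \<le> \<eta> / 4" by (rule r[OF m(1)])+
  have rd: "4 * r m < d x"
  proof -
    have "real m * (4 * r m) < real m * d x" using r(3)[OF m(1)] m(2) by linarith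
    then show ?thesis using m(1) by simp
  qed
  have dnear: "real m * d y \<le> 4" if "dist x y < 2 * r m" for y
  proof -
    have "d y \<le> d x + 2 * r m" using d(1)[of x y] that by linarith
    then have "real m * d y \<le> real m * (d x + 2 * r m)" by (intro mult_left_mono) auto
    also have "\<dots> = real m * d x + 2 * (real m * r m)" by (simp add: algebra_simps)
    finally show ?thesis using r(3)[OF m(1)] m(3) by linarith
  qed
  have ballX: "y \<in> X" if "dist x y < 2 * r m" for y
    using d(4)[OF x] that rd rm by (intro subsetD[OF d(4)[OF x]]) auto
  have \<epsilon>near: "\<epsilon> y \<le> \<rho> m / 4" if "dist x y < 2 * r m" for y
    using \<epsilon>[OF m(1) ballX[OF that] dnear[OF that]] q(1)[OF m(1)] by linarith
  have \<rho>m: "0 < \<rho> m" "\<rho> m \<le> r m" by (rule \<rho>[OF m(1)])+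
  have "\<exists>y\<in>S. dist y x < r m" using x SX(2) rm(1) closure_approachable[of x S] by blast
  then have "N \<noteq> {}" by (auto simp: N_def dist_commute)
  have bdd: "bdd_below (f ` N)" "bdd_above (f ` N)"
    using fb by (auto simp: N_def intro!: bdd_belowI2[where m="-M"] bdd_aboveI2[where M=M])
  define l h where "l = Inf (f ` N)" and "h = Sup (f ` N)"
  have lh: "l \<le> f y" "f y \<le> h" if "y \<in> N" for y
    using that bdd by (auto simp: l_def h_def intro: cINF_lower cSUP_upper)
  have hM: "h \<le> M" "l \<le> M"
  proof -
    show "h \<le> M" unfolding h_def using \<open>N \<noteq> {}\<close> fb(2) by (intro cSUP_least) (auto simp: N_def)
    then show "l \<le> M" using lh \<open>N \<noteq> {}\<close> by force
  qed
  have rangeA: "l - \<eta> \<le> A x" "A x \<le> h + \<eta>"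
  proof -
    show "l - \<eta> \<le> A x"
    proof (rule A_ge[OF x])
      show "l - \<eta> \<le> M + 1" using hM \<eta> by linarith
      fix y assume y: "y \<in> X" "k * dist x y < 2 * M + 3"
      have xy: "dist x y < \<rho> m / 2" by (rule near_of_large[OF m(1) large y(2)])
      have "l - \<eta> \<le> v y"
      proof (rule lo[OF y(1)])
        fix z assume z: "z \<in> S" "dist y z \<le> \<epsilon> y"
        have "dist x z \<le> dist x y + dist y z" by (rule dist_triangle)
        also have "\<dots> < r m" using xy z(2) \<epsilon>near[of y] \<rho>m by linarith
        finally show "l \<le> f z" using z(1) by (intro lh) (auto simp: N_def)
      qed
      then show "l - \<eta> \<le> v y + k * dist x y" using k by (simp add: add_increasing2)
    qed
    have "v x \<le> h + \<eta>"
      using \<epsilon>near[of x] \<rho>m by (intro up[OF x] lh) (auto simp: N_def)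
    then show "A x \<le> h + \<eta>" using A_le_v[OF x] by linarith
  qed
  have rangeB: "l \<le> B x" "B x \<le> h"
  proof -
    show "l \<le> B x"
    proof (rule B_ge[OF x])
      show "l \<le> M + 1" using hM by linarith
      fix y assume y: "y \<in> S" "k * dist x y < 2 * M + 3"
      have "dist x y < \<rho> m / 2" by (rule near_of_large[OF m(1) large y(2)])
      then have "l \<le> f y" using y(1) \<rho>m by (intro lh) (auto simp: N_def)
      then show "l \<le> f y + k * dist x y" using k by (simp add: add_increasing2)
    qed
    show "B x \<le> h" by (rule B_le_local[OF x rm(1)]) (auto simp: N_def intro: lh)
  qed
  obtain y where y: "y \<in> N" "f y < l + \<eta>"
    using cINF_less_iff[of N f "l + \<eta>"] \<open>N \<noteq> {}\<close> bdd \<eta>(1) unfolding l_def by auto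
  obtain y' where y': "y' \<in> N" "h - \<eta> < f y'"
    using less_cSUP_iff[of N f "h - \<eta>"] \<open>N \<noteq> {}\<close> bdd \<eta>(1) unfolding h_def by auto
  \<comment> \<open>\<open>y\<close> and \<open>y'\<close> nearly attain the extremes, but perhaps
    only on tiny sets. The points \<open>t\<close> and \<open>t'\<close> keep these values up to
    distance \<open>\<rho> m\<close>, far enough to be felt by the averages and the
    envelopes.\<close>
  obtain t where t: "t \<in> S" "dist y t \<le> r m" "\<bar>f y - f t\<bar> \<le> \<eta>"
    "\<And>z. z \<in> S \<Longrightarrow> dist t z < \<rho> m \<Longrightarrow> \<bar>f z - f t\<bar> \<le> \<eta>" using good[OF m(1), of y] y(1) by (auto simp: N_def)
  obtain t' where t': "t' \<in> S" "dist y' t' \<le> r m" "\<bar>f y' - f t'\<bar> \<le> \<eta>"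
    "\<And>z. z \<in> S \<Longrightarrow> dist t' z < \<rho> m \<Longrightarrow> \<bar>f z - f t'\<bar> \<le> \<eta>" using good[OF m(1), of y'] y'(1) by (auto simp: N_def)
  have tx: "dist x t < 2 * r m" "dist x t' < 2 * r m"
    using y(1) t(2) dist_triangle[of x t y] y'(1) t'(2) dist_triangle[of x t' y'] by (auto simp: N_def)
  have "B t \<le> l + 4 * \<eta>" using B_le_f[OF t(1)] t(3) y(2) \<eta>(1) by (simp add: abs_le_iff)
  have "v t \<le> f t + \<eta> + \<eta>"
  proof (rule up[OF ballX[OF tx(1)]])
    fix z assume "z \<in> S" "dist t z \<le> \<epsilon> t"
    with t(4)[of z] \<epsilon>near[OF tx(1)] \<rho>m show "f z \<le> f t + \<eta>" by (simp add: abs_le_iff)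
  qed
  then have "A t \<le> l + 4 * \<eta>" using A_le_v[OF ballX[OF tx(1)]] t(3) y(2) unfolding abs_le_iff by linarith
  have ft': "f t' \<le> M" "h - 2 * \<eta> \<le> f t'" using fb(2)[OF t'(1)] t'(3) y'(2) unfolding abs_le_iff by linarith+
  have "f t' - 2 * \<eta> \<le> A t'"
  proof (rule A_ge[OF ballX[OF tx(2)]])
    show "f t' - 2 * \<eta> \<le> M + 1" using ft' \<eta> by linarith
    fix z assume z: "z \<in> X" "k * dist t' z < 2 * M + 3"
    have tz: "dist t' z < \<rho> m / 2" by (rule near_of_large[OF m(1) large z(2)])
    have "real m * d z \<le> 4"
    proof -
      have "\<bar>d z - d t'\<bar> \<le> r m" using d(1)[of z t'] tz \<rho>m by (simp add: dist_commute)
      moreover have "d t' \<le> d x + 2 * r m" using d(1)[of x t'] tx(2) by linarith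
      ultimately have "d z \<le> d x + 3 * r m" by linarith
      then have "real m * d z \<le> real m * (d x + 3 * r m)" by (intro mult_left_mono) auto
      also have "\<dots> = real m * d x + 3 * (real m * r m)" by (simp add: algebra_simps)
      finally show ?thesis using r(3)[OF m(1)] m(3) by linarith
    qed
    from \<epsilon>[OF m(1) z(1) this] q(1)[OF m(1)] have \<epsilon>z: "\<epsilon> z \<le> \<rho> m / 4" by linarith
    have "f t' - \<eta> - \<eta> \<le> v z"
    proof (rule lo[OF z(1)])
      fix w assume w: "w \<in> S" "dist z w \<le> \<epsilon> z"
      have "dist t' w \<le> dist t' z + dist z w" by (rule dist_triangle)
      also have "\<dots> < \<rho> m" using tz w(2) \<epsilon>z \<rho>m by linarith
      finally show "f t' - \<eta> \<le> f w" using t'(4)[OF w(1)] unfolding abs_le_iff by linarith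
    qed
    then show "f t' - 2 * \<eta> \<le> v z + k * dist t' z" using k by (simp add: add_increasing2)
  qed
  then have "h - 4 * \<eta> \<le> A t'" using ft' by linarith
  have "f t' - \<eta> \<le> B t'"
  proof (rule B_ge[OF ballX[OF tx(2)]])
    show "f t' - \<eta> \<le> M + 1" using ft' \<eta> by linarith
    fix z assume z: "z \<in> S" "k * dist t' z < 2 * M + 3"
    have "dist t' z < \<rho> m / 2" by (rule near_of_large[OF m(1) large z(2)])
    then have "f t' - \<eta> \<le> f z" using t'(4)[OF z(1)] \<rho>m unfolding abs_le_iff by linarith
    then show "f t' - \<eta> \<le> f z + k * dist t' z" using k by (simp add: add_increasing2)
  qed
  then have "h - 4 * \<eta> \<le> B t'" using ft' \<eta> by linarith
  \<comment> \<open>A value between \<open>g t\<close> and \<open>g t'\<close> is attained on the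
    segment, which stays in \<open>X\<close> because the ball of radius \<open>2 * r m\<close> does.
    A value below \<open>g t\<close> or above \<open>g t'\<close> misses that end by at most
    \<open>5 * \<eta>\<close>.\<close>
  have ivt: "\<exists>x'\<in>X. dist x x' \<le> \<eta> \<and> \<bar>c - g x'\<bar> \<le> 6 * \<eta>"
    if g: "continuous_on UNIV g" "g t \<le> l + 4 * \<eta>" "h - 4 * \<eta> \<le> g t'" and c: "l - \<eta> \<le> c" "c \<le> h + \<eta>"
    for g :: "'a \<Rightarrow> real" and c
  proof -
    have "\<exists>z\<in>closed_segment t t'. \<bar>c - g z\<bar> \<le> 6 * \<eta>"
    proof (cases "g t \<le> c \<and> c \<le> g t'")
      case True
      have "connected (g ` closed_segment t t')"
        using continuous_on_subset[OF g(1), of "closed_segment t t'"] by (intro connected_continuous_image) auto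
      then have "c \<in> g ` closed_segment t t'"
        by (rule connectedD_interval[of _ "g t" "g t'"]) (use True in auto)
      then obtain z where "z \<in> closed_segment t t'" "c = g z" by blast
      then show ?thesis using \<eta>(1) by (intro bexI[of _ z]) auto
    next
      case False
      then consider "c < g t" | "g t' < c" by linarith
      then show ?thesis
      proof cases
        case 1
        then have "\<bar>c - g t\<bar> \<le> 6 * \<eta>" using g(2) c(1) \<eta>(1) by linarith
        then show ?thesis by (intro bexI[of _ t]) auto
      next
        case 2
        then have "\<bar>c - g t'\<bar> \<le> 6 * \<eta>" using g(3) c(2) \<eta>(1) by linarith
        then show ?thesis by (intro bexI[of _ t']) auto
      qed
    qed
    moreover have "closed_segment t t' \<subseteq> ball x (2 * r m)"
      using tx by (intro closed_segment_subset) auto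
    ultimately obtain z where "z \<in> ball x (2 * r m)" "\<bar>c - g z\<bar> \<le> 6 * \<eta>" by blast
    then show ?thesis using ballX[of z] rm by (intro bexI[of _ z]) auto
  qed
  have cont: "continuous_on UNIV A" "continuous_on UNIV B"
  proof -
    have "k-lipschitz_on UNIV A" by (rule infconv_lipschitz[OF _ vb(1)]) (use k x in auto)
    then show "continuous_on UNIV A" by (rule lipschitz_on_continuous_on)
    have "k-lipschitz_on UNIV B" by (rule infconv_lipschitz[OF _ fb(1)]) (use k x SX(2) in auto)
    then show "continuous_on UNIV B" by (rule lipschitz_on_continuous_on)
  qed
  show "\<exists>x'\<in>X. dist x x' \<le> \<eta> \<and> \<bar>A x - B x'\<bar> \<le> 6 * \<eta>"
    by (rule ivt[OF cont(2) \<open>B t \<le> l + 4 * \<eta>\<close> \<open>h - 4 * \<eta> \<le> B t'\<close> rangeA])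
  show "\<exists>x'\<in>X. dist x x' \<le> \<eta> \<and> \<bar>B x - A x'\<bar> \<le> 6 * \<eta>"
    using rangeB \<eta>(1) by (intro ivt[OF cont(1) \<open>A t \<le> l + 4 * \<eta>\<close> \<open>h - 4 * \<eta> \<le> A t'\<close>]) auto
  fix w assume w: "\<And>y z. y \<in> S \<Longrightarrow> z \<in> S \<Longrightarrow> dist x y < \<eta> \<Longrightarrow> dist x z < \<eta> \<Longrightarrow> f y - f z \<le> w"
  have N\<eta>: "z \<in> S" "dist x z < \<eta>" if "z \<in> N" for z using that rm \<eta> by (auto simp: N_def)
  have "h \<le> l + w"
  proof -
    have "h - w \<le> f z" if z: "z \<in> N" for z
    proof -
      have "h \<le> w + f z" unfolding h_def
      proof (rule cSUP_least[OF \<open>N \<noteq> {}\<close>])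
        fix y assume "y \<in> N"
        with w[of y z] N\<eta>[of y] N\<eta>[OF z] show "f y \<le> w + f z" by simp
      qed
      then show ?thesis by simp
    qed
    then have "h - w \<le> l" unfolding l_def using \<open>N \<noteq> {}\<close> by (intro cINF_greatest) auto
    then show ?thesis by simp
  qed
  then show "\<bar>A x - B x\<bar> \<le> w + 2 * \<eta>" using rangeA rangeB \<eta>(1) unfolding abs_le_iff by linarith
qed

text \<open>The dichotomy is whether \<open>k\<close> is large on some layer near that of
  \<open>x\<close>. The bound \<open>w\<close> is left free so that it can later be the oscillation
  of a vector map, the same for all directions.\<close>

lemma compare:
  assumes x: "x \<in> X"
  shows "\<exists>x'\<in>X. dist x x' \<le> \<eta> \<and> \<bar>A x - B x'\<bar> \<le> 6 * \<eta>" "\<exists>x'\<in>X. dist x x' \<le> \<eta> \<and> \<bar>B x - A x'\<bar> \<le> 6 * \<eta>"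
    and "\<And>w. 0 \<le> w \<Longrightarrow> (\<And>y z. y \<in> S \<Longrightarrow> z \<in> S \<Longrightarrow> dist x y < \<eta> \<Longrightarrow> dist x z < \<eta> \<Longrightarrow> f y - f z \<le> w)
      \<Longrightarrow> \<bar>A x - B x\<bar> \<le> w + 4 * \<eta>"
proof -
  have "(\<exists>x'\<in>X. dist x x' \<le> \<eta> \<and> \<bar>A x - B x'\<bar> \<le> 6 * \<eta>) \<and> (\<exists>x'\<in>X. dist x x' \<le> \<eta> \<and> \<bar>B x - A x'\<bar> \<le> 6 * \<eta>)
    \<and> (\<forall>w\<ge>0. (\<forall>y\<in>S. \<forall>z\<in>S. dist x y < \<eta> \<longrightarrow> dist x z < \<eta> \<longrightarrow> f y - f z \<le> w) \<longrightarrow> \<bar>A x - B x\<bar> \<le> w + 4 * \<eta>)"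
  proof (cases "\<exists>m. 1 \<le> m \<and> 1 \<le> 2 * (real m * d x) \<and> real m * d x \<le> 3 \<and> \<eta> \<le> k * p m")
    case True
    then obtain m where m: "1 \<le> m" "1 \<le> 2 * (real m * d x)" "real m * d x \<le> 3" "\<eta> \<le> k * p m" by blast
    have "\<bar>A x - B x\<bar> \<le> w + 4 * \<eta>"
      if "\<forall>y\<in>S. \<forall>z\<in>S. dist x y < \<eta> \<longrightarrow> dist x z < \<eta> \<longrightarrow> f y - f z \<le> w" for w
      using large_case(3)[OF x m, of w] that \<eta>(1) by force
    then show ?thesis using large_case(1,2)[OF x m] by blast
  next
    case False
    then have "\<bar>A x - B x\<bar> \<le> 4 * \<eta>" by (intro small_case[OF x]) force
    moreover have "\<bar>B x - A x\<bar> \<le> 4 * \<eta>" using calculation by linarith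
    ultimately show ?thesis using x \<eta>(1) by (intro conjI bexI[of _ x]) auto
  qed
  then show "\<exists>x'\<in>X. dist x x' \<le> \<eta> \<and> \<bar>A x - B x'\<bar> \<le> 6 * \<eta>" "\<exists>x'\<in>X. dist x x' \<le> \<eta> \<and> \<bar>B x - A x'\<bar> \<le> 6 * \<eta>"
    and "\<And>w. 0 \<le> w \<Longrightarrow> (\<And>y z. y \<in> S \<Longrightarrow> z \<in> S \<Longrightarrow> dist x y < \<eta> \<Longrightarrow> dist x z < \<eta> \<Longrightarrow> f y - f z \<le> w)
      \<Longrightarrow> \<bar>A x - B x\<bar> \<le> w + 4 * \<eta>"
    by blast+
qed

end

end

section \<open>Mollification with variable radius\<close>

text \<open>Truncation at 1 lets \<open>layer_index\<close> assign a layer to every point of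
  \<open>X\<close>.\<close>

definition bdist :: "'a::euclidean_space set \<Rightarrow> 'a \<Rightarrow> real" where
  "bdist X x = min 1 (infdist x (- X))"

lemma bdist_lipschitz: "\<bar>bdist X x - bdist X y\<bar> \<le> dist x y"
proof -
  have "infdist x (- X) \<le> infdist y (- X) + dist x y" "infdist y (- X) \<le> infdist x (- X) + dist x y"
    using infdist_triangle[of x "- X" y] infdist_triangle[of y "- X" x] by (auto simp: dist_commute)
  moreover have "0 \<le> dist x y" by simp
  ultimately show ?thesis unfolding bdist_def by linarith
qed

lemma bdist_le_1: "bdist X x \<le> 1"
  by (simp add: bdist_def)

context bounded_domain
begin

lemma compl_nonempty: "- X \<noteq> {}"
  using X(3) not_bounded_UNIV by (metis Compl_UNIV_eq double_compl)

lemma bdist_pos: "x \<in> X \<Longrightarrow> 0 < bdist X x"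
  using X(2) compl_nonempty infdist_pos_not_in_closed[of "- X" x] by (auto simp: bdist_def closed_Compl)

lemma bdist_ball: "ball x (bdist X x) \<subseteq> X"
proof
  fix y assume "y \<in> ball x (bdist X x)"
  then have "dist x y < infdist x (- X)" by (auto simp: bdist_def)
  then show "y \<in> X" using infdist_le[of y "- X" x] by force
qed

end

text \<open>The remainder of the linear approximation is at most \<open>(s - t)\<^sup>2\<close> for
  every combination of signs. The squared positive part is a simple C^1 profile for bumps, and a C^1
  radius makes the averages C^1.\<close>

lemma max_square_DERIV: "((\<lambda>t. (max 0 t)\<^sup>2) has_real_derivative 2 * max 0 t) (at t)"
  unfolding has_field_derivative_def has_derivative_at_alt
proof (intro conjI allI impI)
  fix e :: real assume e: "e > 0"
  have sq: "norm ((max 0 s)\<^sup>2 - (max 0 t)\<^sup>2 - 2 * max 0 t * (s - t)) \<le> (s - t)\<^sup>2" for s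
  proof -
    consider "0 \<le> s" "0 \<le> t" | "s < 0" "0 \<le> t" | "0 \<le> s" "t < 0" | "s < 0" "t < 0" by linarith
    then show ?thesis
    proof cases
      case 1
      then have "(max 0 s)\<^sup>2 - (max 0 t)\<^sup>2 - 2 * max 0 t * (s - t) = (s - t)\<^sup>2"
        by (simp add: power2_eq_square algebra_simps)
      then show ?thesis by simp
    next
      case 2
      then have "(max 0 s)\<^sup>2 - (max 0 t)\<^sup>2 - 2 * max 0 t * (s - t) = (s - t)\<^sup>2 - s\<^sup>2"
        by (simp add: power2_eq_square algebra_simps)
      moreover have "s\<^sup>2 \<le> (s - t)\<^sup>2" using 2 by (intro abs_le_square_iff[THEN iffD1]) auto
      ultimately show ?thesis by simp
    next
      case 3
      then have "s\<^sup>2 \<le> (s - t)\<^sup>2" by (intro power_mono) auto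
      then show ?thesis using 3 by simp
    qed simp
  qed
  have "norm ((max 0 s)\<^sup>2 - (max 0 t)\<^sup>2 - 2 * max 0 t * (s - t)) \<le> e * norm (s - t)" if "norm (s - t) < e" for s
  proof -
    have "(s - t)\<^sup>2 = norm (s - t) * norm (s - t)" by (simp add: power2_eq_square)
    also have "\<dots> \<le> e * norm (s - t)" using that by (intro mult_right_mono) auto
    finally show ?thesis using sq[of s] by (rule order_trans[rotated])
  qed
  then show "\<exists>d>0. \<forall>s. norm (s - t) < d \<longrightarrow> norm ((max 0 s)\<^sup>2 - (max 0 t)\<^sup>2 - 2 * max 0 t * (s - t)) \<le> e * norm (s - t)"
    using e by blast
qed (rule bounded_linear_mult_right)

lemma bump_gderiv:
  "GDERIV (\<lambda>x. (max 0 (\<rho>\<^sup>2 - (norm (x - c))\<^sup>2))\<^sup>2) x :> (- 4 * max 0 (\<rho>\<^sup>2 - (norm (x - c))\<^sup>2)) *\<^sub>R (x - c)"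
proof -
  have "GDERIV (\<lambda>x. \<rho>\<^sup>2 - (norm (x - c))\<^sup>2) x :> (- 2) *\<^sub>R (x - c)"
    unfolding gderiv_def power2_norm_eq_inner
    by (auto intro!: derivative_eq_intros simp: fun_eq_iff inner_commute algebra_simps)
  from GDERIV_DERIV_compose[OF this max_square_DERIV] show ?thesis by simp
qed

lemma bump_bounds:
  assumes "0 < \<rho>" "\<rho> \<le> 1"
  shows "(max 0 (\<rho>\<^sup>2 - (norm (x - c))\<^sup>2))\<^sup>2 \<le> 1"
    and "norm ((- 4 * max 0 (\<rho>\<^sup>2 - (norm (x - c))\<^sup>2)) *\<^sub>R (x - c)) \<le> 4"
    and "dist c x < \<rho> \<Longrightarrow> 0 < (max 0 (\<rho>\<^sup>2 - (norm (x - c))\<^sup>2))\<^sup>2"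
    and "\<not> dist c x < \<rho> \<Longrightarrow> (max 0 (\<rho>\<^sup>2 - (norm (x - c))\<^sup>2))\<^sup>2 = 0"
proof -
  let ?m = "max 0 (\<rho>\<^sup>2 - (norm (x - c))\<^sup>2)"
  have \<rho>1: "\<rho>\<^sup>2 \<le> 1" using assms by (simp add: power_le_one)
  have "\<rho>\<^sup>2 - (norm (x - c))\<^sup>2 \<le> 1" using \<rho>1 zero_le_power2[of "norm (x - c)"] by linarith
  then have m: "0 \<le> ?m" "?m \<le> 1" by auto
  then show "?m\<^sup>2 \<le> 1" by (rule power_le_one)
  have n: "dist c x = norm (x - c)" by (simp add: dist_norm norm_minus_commute)
  have iff: "\<rho>\<^sup>2 - (norm (x - c))\<^sup>2 > 0 \<longleftrightarrow> dist c x < \<rho>"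
    using assms(1) power_mono_iff[of \<rho> "norm (x - c)" 2] by (auto simp: n not_le[symmetric])
  show "dist c x < \<rho> \<Longrightarrow> 0 < ?m\<^sup>2" using iff by simp
  show z: "\<not> dist c x < \<rho> \<Longrightarrow> ?m\<^sup>2 = 0" using iff by (simp add: max_def not_less)
  show "norm ((- 4 * ?m) *\<^sub>R (x - c)) \<le> 4"
  proof (cases "dist c x < \<rho>")
    case True
    have "?m * norm (x - c) \<le> 1 * 1" using m True assms by (intro mult_mono) (auto simp: n)
    then show ?thesis using m by (simp add: abs_mult)
  next
    case False
    then show ?thesis using z by simp
  qed
qed

context bounded_domain
begin

text \<open>A series of bumps centred at a dense sequence in \<open>X\<close>. Positivity comes from
  density and the gradient bound from a geometric series. The decay is obtained because each bump
  meets only finitely many of the sets on which some \<open>q m\<close> is prescribed.\<close>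

lemma variable_radius_exists:
  fixes q :: "nat \<Rightarrow> real"
  assumes q: "\<And>m. 0 < q m" and \<tau>: "0 < \<tau>"
  obtains \<epsilon> E where "\<And>x. x \<in> X \<Longrightarrow> 0 < \<epsilon> x" "\<And>x. GDERIV \<epsilon> x :> E x" "continuous_on UNIV E"
    "\<And>x. norm (E x) \<le> \<tau>" "\<And>m x. x \<in> X \<Longrightarrow> real m * bdist X x \<le> 4 \<Longrightarrow> \<epsilon> x \<le> q m"
proof -
  obtain D :: "'a set" where D: "countable D" "\<And>U. open U \<Longrightarrow> U \<noteq> {} \<Longrightarrow> \<exists>y\<in>D. y \<in> U"
    using countable_dense_exists by blast
  define c where "c = from_nat_into (D \<inter> X)"
  have DX: "D \<inter> X \<noteq> {}" "countable (D \<inter> X)" using D(2)[OF X(2,1)] D(1) by auto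
  have c: "range c = D \<inter> X" unfolding c_def by (rule range_from_nat_into[OF DX])
  \<comment> \<open>Where bump \<open>j\<close> is positive, the truncated boundary distance is at
    least \<open>\<rho> j\<close>, half its value at the centre.\<close>
  define \<rho> where "\<rho> j = bdist X (c j) / 2" for j
  have \<rho>: "0 < \<rho> j" "\<rho> j \<le> 1" for j
    using bdist_pos[of "c j"] bdist_le_1[of X "c j"] c by (auto simp: \<rho>_def)
  define b where "b j x = (max 0 ((\<rho> j)\<^sup>2 - (norm (x - c j))\<^sup>2))\<^sup>2" for j x
  define g where "g j x = (- 4 * max 0 ((\<rho> j)\<^sup>2 - (norm (x - c j))\<^sup>2)) *\<^sub>R (x - c j)" for j x
  have bg: "GDERIV (b j) x :> g j x" for j x unfolding b_def g_def by (rule bump_gderiv)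
  have b: "0 \<le> b j x" "b j x \<le> 1" "dist (c j) x < \<rho> j \<Longrightarrow> 0 < b j x" "\<not> dist (c j) x < \<rho> j \<Longrightarrow> b j x = 0"
    and g: "norm (g j x) \<le> 4" for j x
    unfolding b_def g_def by (rule zero_le_power2 bump_bounds[OF \<rho>]; assumption?)+
  \<comment> \<open>Where bump \<open>j\<close> is positive,
    \<open>real m * bdist X x \<le> 4\<close> forces \<open>m \<le> 4 / \<rho> j\<close>; the
    minimum over these finitely many indices respects every \<open>q m\<close> that applies
    there.\<close>
  define Q where "Q j = Min (q ` {..nat \<lfloor>4 / \<rho> j\<rfloor>})" for j
  have Q: "0 < Q j" for j using q by (simp add: Q_def)
  \<comment> \<open>The divisor 5 absorbs the bound 4 for the bump gradients; the powers of one half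
    sum to 1.\<close>
  define a where "a j = (1/2) ^ Suc j * (min \<tau> (Q j) / 5)" for j
  have a: "0 < a j" for j using Q \<tau> by (simp add: a_def)
  have ag: "norm (a j *\<^sub>R g j x) \<le> (1/2) ^ Suc j * \<tau>" for j x
  proof -
    have "norm (a j *\<^sub>R g j x) \<le> a j * 4" using a[of j] g[of j x] by simp
    also have "\<dots> \<le> (1/2) ^ Suc j * \<tau>"
      unfolding a_def mult.assoc using \<tau> Q[of j] by (intro mult_left_mono) auto
    finally show ?thesis .
  qed
  have geo: "(\<lambda>j. (1/2) ^ Suc j * (s::real)) sums s" for s
    using sums_mult2[OF power_half_series, of s] by simp
  have ab: "a j * b j x \<le> (1/2) ^ Suc j * s" if "b j x > 0 \<Longrightarrow> Q j \<le> s" "0 \<le> s" for j x s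
  proof (cases "b j x > 0")
    case True
    have "a j * b j x \<le> a j * 1" using a[of j] b(2)[of j x] by (intro mult_left_mono) auto
    also have "\<dots> \<le> (1/2) ^ Suc j * s"
      unfolding a_def mult.assoc using \<tau> Q[of j] that(1)[OF True] by (intro mult_left_mono) auto
    finally show ?thesis .
  next
    case False
    then have "b j x = 0" using b(1)[of j x] by linarith
    then show ?thesis using that(2) by simp
  qed
  define E where "E x = (\<Sum>j. a j *\<^sub>R g j x)" for x
  have ul: "uniform_limit UNIV (\<lambda>n x. \<Sum>j<n. a j *\<^sub>R g j x) E sequentially"
    unfolding E_def by (rule Weierstrass_m_test[OF ag sums_summable[OF geo]])
  have "\<exists>h. \<forall>x\<in>UNIV. (\<lambda>j. a j * b j x) sums h x \<and> (h has_derivative (\<lambda>y. y \<bullet> E x)) (at x within UNIV)"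
  proof (rule has_derivative_series)
    show "convex (UNIV :: 'a set)" by simp
    show "((\<lambda>x. a j * b j x) has_derivative (\<lambda>y. y \<bullet> (a j *\<^sub>R g j x))) (at x within UNIV)" for j x
      using bg[of j x] unfolding gderiv_def by (auto intro!: derivative_eq_intros)
    show "\<forall>\<^sub>F n in sequentially. \<forall>x\<in>UNIV. \<forall>h. norm ((\<Sum>j<n. h \<bullet> (a j *\<^sub>R g j x)) - h \<bullet> E x) \<le> e * norm h" if "e > 0" for e
      using uniform_limitD[OF ul that]
    proof eventually_elim
      case (elim n)
      show ?case
      proof (intro ballI allI)
        fix x h
        have "(\<Sum>j<n. h \<bullet> (a j *\<^sub>R g j x)) - h \<bullet> E x = h \<bullet> ((\<Sum>j<n. a j *\<^sub>R g j x) - E x)"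
          unfolding inner_diff_right inner_sum_right ..
        also have "norm \<dots> \<le> norm h * norm ((\<Sum>j<n. a j *\<^sub>R g j x) - E x)" by (simp add: Cauchy_Schwarz_ineq2)
        also have "\<dots> \<le> e * norm h"
          unfolding mult.commute[of e] using elim[rule_format, of x] by (intro mult_left_mono) (auto simp: dist_norm)
        finally show "norm ((\<Sum>j<n. h \<bullet> (a j *\<^sub>R g j x)) - h \<bullet> E x) \<le> e * norm h" .
      qed
    qed
    show "(0 :: 'a) \<in> UNIV" by simp
    let ?x = "0 :: 'a"
    have "summable (\<lambda>j. a j * b j ?x)"
    proof (rule summable_comparison_test')
      show "summable (\<lambda>j. (1/2) ^ Suc j * \<tau>)" by (rule sums_summable[OF geo])
      fix j :: nat
      have "a j * b j ?x \<le> a j * 1" using a[of j] b(2)[of j ?x] by (intro mult_left_mono) auto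
      also have "\<dots> \<le> (1/2) ^ Suc j * \<tau>" unfolding a_def mult.assoc mult_1_right using \<tau> Q[of j] by (intro mult_left_mono) auto
      finally show "norm (a j * b j ?x) \<le> (1/2) ^ Suc j * \<tau>" using a[of j] b(1)[of j ?x] by simp
    qed
    then show "(\<lambda>j. a j * b j ?x) sums (\<Sum>j. a j * b j ?x)" by (rule summable_sums)
  qed
  then obtain \<epsilon> where \<epsilon>: "\<And>x. (\<lambda>j. a j * b j x) sums \<epsilon> x" "\<And>x. GDERIV \<epsilon> x :> E x"
    by (auto simp: gderiv_def)
  show thesis
  proof (rule that[of \<epsilon> E])
    show "GDERIV \<epsilon> x :> E x" for x by (rule \<epsilon>(2))
    show "continuous_on UNIV E"
      by (rule uniform_limit_theorem[OF _ ul])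
        (auto simp: g_def intro!: always_eventually continuous_intros)
    show "norm (E x) \<le> \<tau>" for x
    proof -
      have s: "summable (\<lambda>j. norm (a j *\<^sub>R g j x))"
        using ag by (intro summable_comparison_test'[OF sums_summable[OF geo[of \<tau>]]]) auto
      have "norm (E x) \<le> (\<Sum>j. norm (a j *\<^sub>R g j x))" unfolding E_def by (rule summable_norm[OF s])
      also have "\<dots> \<le> (\<Sum>j. (1/2) ^ Suc j * \<tau>)" by (rule suminf_le[OF ag s sums_summable[OF geo]])
      also have "\<dots> = \<tau>" using sums_unique[OF geo[of \<tau>]] by simp
      finally show ?thesis .
    qed
    fix x assume x: "x \<in> X"
    show "0 < \<epsilon> x"
    proof -
      \<comment> \<open>A centre within a quarter of \<open>bdist X x\<close> has a bump radius
        exceeding its distance to \<open>x\<close>, so its bump is positive at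
        \<open>x\<close>.\<close>
      have "x \<in> ball x (bdist X x / 4) \<inter> X" using x bdist_pos[OF x] by simp
      then have "ball x (bdist X x / 4) \<inter> X \<noteq> {}" by blast
      then obtain y where y: "y \<in> D" "y \<in> ball x (bdist X x / 4) \<inter> X"
        using D(2)[of "ball x (bdist X x / 4) \<inter> X"] X(2) by blast
      then obtain j where j: "y = c j" using c by blast
      have "bdist X x \<le> bdist X y + dist x y" using bdist_lipschitz[of X x y] by linarith
      moreover have "dist x y < bdist X x / 4" using y(2) by simp
      ultimately have "dist x y < bdist X y / 2" using zero_le_dist[of x y] by linarith
      then have "dist (c j) x < \<rho> j" by (simp add: j \<rho>_def dist_commute)
      then have "0 < a j * b j x" using a[of j] b(3) by simp
      moreover have "a i * b i x \<ge> 0" for i using a[of i] b(1) by (simp add: less_imp_le)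
      ultimately have "0 < (\<Sum>j. a j * b j x)"
        using suminf_pos2[of "\<lambda>j. a j * b j x" j] sums_summable[OF \<epsilon>(1)[of x]] by simp
      then show ?thesis using sums_unique[OF \<epsilon>(1)[of x]] by simp
    qed
    fix m :: nat assume m: "real m * bdist X x \<le> 4"
    have Qm: "Q j \<le> q m" if "b j x > 0" for j
    proof -
      have "dist (c j) x < \<rho> j" using b(4)[of j x] that by auto
      then have "\<rho> j \<le> bdist X x" using bdist_lipschitz[of X "c j" x] by (simp add: \<rho>_def)
      then have "real m * \<rho> j \<le> 4" using m by (meson mult_left_mono of_nat_0_le_iff order_trans)
      then have "real m \<le> 4 / \<rho> j" using \<rho>(1)[of j] by (simp add: field_simps)
      then have "m \<le> nat \<lfloor>4 / \<rho> j\<rfloor>" by linarith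
      then show ?thesis unfolding Q_def by (intro Min_le) auto
    qed
    have "(\<Sum>j. a j * b j x) \<le> (\<Sum>j. (1/2) ^ Suc j * q m)"
      by (rule suminf_le[OF ab sums_summable[OF \<epsilon>(1)] sums_summable[OF geo]]) (use Qm q less_imp_le in auto)
    then show "\<epsilon> x \<le> q m" using sums_unique[OF \<epsilon>(1)[of x]] sums_unique[OF geo[of "q m"]] by simp
  qed
qed

end

text \<open>Dominated convergence is applied to the remainder quotients along sequences tending to
  0. Only data anchored at \<open>x0\<close> enter, which suits an integrand whose gradient exists
  merely for almost every \<open>z\<close>, with an exceptional set depending on the point.\<close>

lemma gderiv_integral:
  fixes g :: "'a::euclidean_space \<Rightarrow> 'b \<Rightarrow> real" and G :: "'b \<Rightarrow> 'a"
  assumes "finite_measure M" and \<delta>: "0 < \<delta>"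
    and gd: "AE z in M. GDERIV (\<lambda>x. g x z) x0 :> G z"
    and int: "\<And>x. dist x x0 < \<delta> \<Longrightarrow> integrable M (g x)"
    and lip: "\<And>x. dist x x0 < \<delta> \<Longrightarrow> AE z in M. \<bar>g x z - g x0 z\<bar> \<le> C * dist x x0"
    and G: "G \<in> borel_measurable M" "AE z in M. norm (G z) \<le> C"
  shows "GDERIV (\<lambda>x. integral\<^sup>L M (g x)) x0 :> integral\<^sup>L M G"
proof -
  interpret finite_measure M by fact
  have intG: "integrable M G" by (rule integrable_const_bound[OF G(2,1)])
  have int0: "integrable M (g x0)" using int[of x0] \<delta> by simp
  show ?thesis
    unfolding gderiv_def has_derivative_at LIMSEQ_SEQ_conv[symmetric]
  proof (intro conjI allI impI)
    show "bounded_linear (\<lambda>h. h \<bullet> integral\<^sup>L M G)" by (rule bounded_linear_inner_left)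
    fix h :: "nat \<Rightarrow> 'a" assume "(\<forall>n. h n \<noteq> 0) \<and> h \<longlonglongrightarrow> 0"
    then have h: "\<And>n. h n \<noteq> 0" "h \<longlonglongrightarrow> 0" by auto
    \<comment> \<open>The value 0 for steps outside the \<open>\<delta>\<close>-ball makes the
      domination hold for all \<open>n\<close>; only finitely many \<open>n\<close> are
      affected.\<close>
    define q where "q n z = (if norm (h n) < \<delta> then (g (x0 + h n) z - g x0 z - h n \<bullet> G z) / norm (h n) else 0)" for n z
    have ev: "\<forall>\<^sub>F n in sequentially. norm (h n) < \<delta>"
      using tendstoD[OF h(2) \<delta>] by simp
    have "(\<lambda>n. integral\<^sup>L M (q n)) \<longlonglongrightarrow> integral\<^sup>L M (\<lambda>z. 0)"
    proof (rule integral_dominated_convergence)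
      show "integrable M (\<lambda>z. 2 * C)" by simp
      show "(\<lambda>z. 0) \<in> borel_measurable M" by simp
      show "q n \<in> borel_measurable M" for n
      proof (cases "norm (h n) < \<delta>")
        case True
        then have "g (x0 + h n) \<in> borel_measurable M" "g x0 \<in> borel_measurable M"
          using int[of "x0 + h n"] int0 by (auto simp: dist_norm)
        then show ?thesis using True G(1) unfolding q_def by simp
      next
        case False
        then have "q n = (\<lambda>z. 0)" by (simp add: q_def fun_eq_iff)
        then show ?thesis by simp
      qed
      show "AE z in M. (\<lambda>n. q n z) \<longlonglongrightarrow> 0"
        using gd
      proof eventually_elim
        case (elim z)
        then have "(\<lambda>k. norm (g (x0 + k) z - g x0 z - k \<bullet> G z) / norm k) \<midarrow>0\<rightarrow> 0"
          unfolding gderiv_def has_derivative_at by blast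
        then have "(\<lambda>n. norm (g (x0 + h n) z - g x0 z - h n \<bullet> G z) / norm (h n)) \<longlonglongrightarrow> 0"
          using h unfolding LIMSEQ_SEQ_conv[symmetric] by blast
        then have "(\<lambda>n. norm ((g (x0 + h n) z - g x0 z - h n \<bullet> G z) / norm (h n))) \<longlonglongrightarrow> 0" by simp
        then have "(\<lambda>n. (g (x0 + h n) z - g x0 z - h n \<bullet> G z) / norm (h n)) \<longlonglongrightarrow> 0"
          by (rule tendsto_norm_zero_cancel)
        then show ?case
          by (rule Lim_transform_eventually) (use ev in eventually_elim, simp add: q_def)
      qed
      show "AE z in M. norm (q n z) \<le> 2 * C" for n
      proof (cases "norm (h n) < \<delta>")
        case True
        then have "dist (x0 + h n) x0 < \<delta>" by (simp add: dist_norm)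
        from lip[OF this] G(2) show ?thesis
        proof eventually_elim
          case (elim z)
          have "\<bar>h n \<bullet> G z\<bar> \<le> norm (h n) * C"
            using elim(2) by (intro order_trans[OF Cauchy_Schwarz_ineq2] mult_left_mono) auto
          moreover have "\<bar>g (x0 + h n) z - g x0 z\<bar> \<le> C * norm (h n)" using elim(1) by (simp add: dist_norm)
          ultimately have "\<bar>g (x0 + h n) z - g x0 z - h n \<bullet> G z\<bar> \<le> 2 * C * norm (h n)"
            unfolding mult.commute[of "norm (h n)"] by linarith
          then show ?case using True h(1)[of n] by (simp add: q_def field_simps)
        qed
      next
        case False
        have "AE z in M. 0 \<le> 2 * C" using G(2)
        proof eventually_elim
          case (elim z)
          then show ?case using norm_ge_zero[of "G z"] by linarith
        qed
        then show ?thesis using False by (simp add: q_def)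
      qed
    qed
    then have "(\<lambda>n. norm (integral\<^sup>L M (q n))) \<longlonglongrightarrow> 0" using tendsto_norm_zero by fastforce
    then show "(\<lambda>n. norm (integral\<^sup>L M (g (x0 + h n)) - integral\<^sup>L M (g x0) - h n \<bullet> integral\<^sup>L M G) / norm (h n)) \<longlonglongrightarrow> 0"
    proof (rule Lim_transform_eventually)
      show "\<forall>\<^sub>F n in sequentially. norm (integral\<^sup>L M (q n)) =
        norm (integral\<^sup>L M (g (x0 + h n)) - integral\<^sup>L M (g x0) - h n \<bullet> integral\<^sup>L M G) / norm (h n)"
        using ev
      proof eventually_elim
        case (elim n)
        then have "integrable M (g (x0 + h n))" by (intro int) (simp add: dist_norm)
        note int' = this integrable_inner_right[OF intG, of "h n"]
        have "integral\<^sup>L M (q n) = (integral\<^sup>L M (g (x0 + h n)) - integral\<^sup>L M (g x0) - h n \<bullet> integral\<^sup>L M G) / norm (h n)"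
        proof -
          have "q n = (\<lambda>z. (g (x0 + h n) z - g x0 z - h n \<bullet> G z) / norm (h n))"
            using elim by (simp add: q_def fun_eq_iff)
          then show ?thesis using int' int0 intG by simp
        qed
        then show ?case by simp
      qed
    qed
  qed
qed

section \<open>Averages over scaled cubes\<close>

lemma negligible_affine_vimage:
  fixes N :: "'a::euclidean_space set"
  assumes "negligible N" "s \<noteq> 0" shows "negligible {z. x + s *\<^sub>R z \<in> N}"
proof -
  have "{z. x + s *\<^sub>R z \<in> N} = (\<lambda>y. (1 / s) *\<^sub>R (y - x)) ` N"
  proof (intro equalityI subsetI)
    fix z assume "z \<in> {z. x + s *\<^sub>R z \<in> N}"
    then show "z \<in> (\<lambda>y. (1 / s) *\<^sub>R (y - x)) ` N"
      using assms(2) by (intro image_eqI[of _ _ "x + s *\<^sub>R z"]) auto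
  qed (use assms(2) in auto)
  moreover have "negligible ((\<lambda>y. (1 / s) *\<^sub>R (y - x)) ` N)"
    by (intro negligible_differentiable_image_negligible[OF order_refl assms(1)])
       (auto intro!: derivative_intros simp: differentiable_on_def)
  ultimately show ?thesis by simp
qed

text \<open>The cube has measure 1, so the integral is already an average; the price is the factor
  \<open>DIM('a)\<close> in norm bounds for its points.\<close>

abbreviation unit_cube :: "'a::euclidean_space measure" where
  "unit_cube \<equiv> lebesgue_on (cbox 0 One)"

lemma unit_cube_norm: "z \<in> cbox 0 One \<Longrightarrow> norm z \<le> real DIM('a)" for z :: "'a::euclidean_space"
proof -
  assume z: "z \<in> cbox 0 One"
  have "norm z \<le> (\<Sum>b\<in>Basis. \<bar>z \<bullet> b\<bar>)" by (rule norm_le_l1)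
  also have "\<dots> \<le> (\<Sum>b\<in>(Basis :: 'a set). 1)" using z by (intro sum_mono) (auto simp: mem_box abs_le_iff)
  finally show ?thesis by simp
qed

lemma unit_cube_finite: "finite_measure (unit_cube :: 'a::euclidean_space measure)"
  by (rule finite_measure_lebesgue_on) simp

lemma unit_cube_total: "measure unit_cube (cbox 0 (One :: 'a::euclidean_space)) = 1"
  by (simp add: measure_restrict_space)

lemma integrable_const_cube: "integrable (unit_cube :: 'a::euclidean_space measure) (\<lambda>z. c :: 'b::euclidean_space)"
  using unit_cube_finite by (rule finite_measure.integrable_const)

lemma integral_const_cube:
  "(LINT z|(unit_cube :: 'a::euclidean_space measure). c) = (c :: 'b::euclidean_space)"
  using unit_cube_total[where 'a='a] by simp

lemma norm_integral_cube_le: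
  fixes f :: "'a::euclidean_space \<Rightarrow> 'b::euclidean_space"
  assumes "integrable unit_cube f" "\<And>z. z \<in> cbox 0 One \<Longrightarrow> norm (f z) \<le> B"
  shows "norm (integral\<^sup>L unit_cube f) \<le> B"
proof -
  have "norm (integral\<^sup>L unit_cube f) \<le> (LINT z|unit_cube. norm (f z))"
    by (rule integral_norm_bound)
  also have "\<dots> \<le> (LINT z|(unit_cube :: 'a measure). B)"
    using assms(2) by (intro integral_mono integrable_norm assms(1) integrable_const_cube) auto
  also have "\<dots> = B" by (rule integral_const_cube)
  finally show ?thesis .
qed

text \<open>Lipschitz bounds are asked along segments in \<open>X\<close> because \<open>X\<close>
  may fail to be convex. \<open>S\<close> is a parameter, and not \<open>cont_pts X F\<close>, so
  that two pairs can be brought to a common conull set before sums and products are formed.\<close>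

locale lip_grad = bounded_domain X for X :: "'a::euclidean_space set" +
  fixes S :: "'a set" and u :: "'a \<Rightarrow> real" and F :: "'a \<Rightarrow> 'a" and L :: real
  assumes S: "S \<subseteq> cont_pts X F" "X - S \<in> null_sets lebesgue"
    and FL: "\<And>x. x \<in> X \<Longrightarrow> norm (F x) \<le> L" and L: "0 < L"
    and ulip: "\<And>a b. closed_segment a b \<subseteq> X \<Longrightarrow> \<bar>u b - u a\<bar> \<le> L * dist a b"
    and ug: "\<And>y. y \<in> S \<Longrightarrow> GDERIV u y :> F y"
    and ub: "bounded (u ` X)"
begin

lemma S_subset: "S \<subseteq> X" using S(1) cont_ptsD(1) by blast

text \<open>\<open>F\<close> is uncontrolled outside \<open>X\<close>; the default 0 off
  \<open>S\<close> yields a total function bounded by \<open>L\<close> that equals \<open>F\<close>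
  almost everywhere on \<open>X\<close>.\<close>

definition Fc :: "'a \<Rightarrow> 'a" where "Fc y = (if y \<in> S then F y else 0)"

lemma Fc_bound: "norm (Fc y) \<le> L"
  using FL S_subset L by (auto simp: Fc_def)

lemma u_continuous: "continuous_on X u"
proof (intro continuous_at_imp_continuous_on ballI)
  fix x assume "x \<in> X"
  then obtain r where r: "r > 0" "ball x r \<subseteq> X" using X(2) openE by blast
  show "isCont u x"
    unfolding continuous_at_eps_delta
  proof (intro allI impI)
    fix e :: real assume e: "e > 0"
    show "\<exists>d>0. \<forall>y. dist y x < d \<longrightarrow> dist (u y) (u x) < e"
    proof (intro exI[of _ "min r (e / L)"] conjI allI impI)
      show "0 < min r (e / L)" using r e L by simp
      fix y assume y: "dist y x < min r (e / L)"
      have "closed_segment x y \<subseteq> X" using y r(1) by (intro order_trans[OF closed_segment_subset r(2)]) (auto simp: dist_commute)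
      then have "\<bar>u y - u x\<bar> \<le> L * dist x y" by (rule ulip)
      also have "\<dots> < e" using y L by (simp add: field_simps dist_commute)
      finally show "dist (u y) (u x) < e" by (simp add: dist_real_def)
    qed
  qed
qed

context
  fixes \<epsilon> :: "'a \<Rightarrow> real" and E :: "'a \<Rightarrow> 'a" and \<tau> :: real
  assumes \<epsilon>: "\<And>x. x \<in> X \<Longrightarrow> 0 < \<epsilon> x" "\<And>x. GDERIV \<epsilon> x :> E x" "continuous_on UNIV E" "\<And>x. norm (E x) \<le> \<tau>"
    and small: "\<And>x. x \<in> X \<Longrightarrow> 2 * (real DIM('a) * \<epsilon> x) < bdist X x"
begin

abbreviation shift :: "'a \<Rightarrow> 'a \<Rightarrow> 'a" where
  "shift x z \<equiv> x + \<epsilon> x *\<^sub>R z"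

definition mol :: "'a \<Rightarrow> real" where
  "mol x = (LINT z|unit_cube. u (shift x z))"

text \<open>Where \<open>shift x z \<in> S\<close>, this is the gradient at \<open>x\<close> of the
  function sending \<open>x\<close> to \<open>u (shift x z)\<close>; the second summand stems from
  the variation of the radius.\<close>

definition molg :: "'a \<Rightarrow> 'a \<Rightarrow> 'a" where
  "molg x z = Fc (shift x z) + (Fc (shift x z) \<bullet> z) *\<^sub>R E x"

definition mold :: "'a \<Rightarrow> 'a" where
  "mold x = (LINT z|unit_cube. molg x z)"

lemma \<epsilon>_continuous: "isCont \<epsilon> x"
  using \<epsilon>(2)[of x] unfolding gderiv_def by (rule has_derivative_continuous)

lemma shift_dist: "x \<in> X \<Longrightarrow> z \<in> cbox 0 One \<Longrightarrow> dist x (shift x z) \<le> real DIM('a) * \<epsilon> x"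
  using unit_cube_norm[of z] \<epsilon>(1)[of x] by (simp add: dist_norm mult.commute mult_right_mono)

lemma shift_in: "x \<in> X \<Longrightarrow> z \<in> cbox 0 One \<Longrightarrow> shift x z \<in> X"
proof -
  assume x: "x \<in> X" and z: "z \<in> cbox 0 One"
  have "0 \<le> real DIM('a) * \<epsilon> x" using \<epsilon>(1)[OF x] by simp
  then have "dist x (shift x z) < bdist X x" using shift_dist[OF x z] small[OF x] by linarith
  then show ?thesis using bdist_ball[of x] by auto
qed

text \<open>For fixed \<open>x\<close> the shift is affine in \<open>z\<close> with nonzero factor
  \<open>\<epsilon> x\<close>, so preimages of null sets are null. Positivity of the radius is used
  here.\<close>

lemma AE_shift: "x \<in> X \<Longrightarrow> AE z in unit_cube. shift x z \<in> S"
proof -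
  assume x: "x \<in> X"
  have "negligible {z. shift x z \<in> X - S}"
    using S(2) \<epsilon>(1)[OF x] by (intro negligible_affine_vimage) (auto simp: negligible_iff_null_sets)
  then have "AE z in lebesgue. \<not> (shift x z \<in> X - S)"
    by (auto simp: negligible_iff_null_sets dest!: AE_not_in)
  then have "AE z in lebesgue. z \<in> cbox 0 One \<longrightarrow> shift x z \<in> S"
    by eventually_elim (use shift_in[OF x] in auto)
  then show ?thesis by (simp add: AE_restrict_space_iff)
qed

lemma AE_cube: "AE z in unit_cube. z \<in> cbox 0 (One::'a)"
  by (rule AE_I2) simp

lemma measurable_u:
  assumes x: "x \<in> X" shows "(\<lambda>z. u (shift x z)) \<in> borel_measurable unit_cube"
proof (rule continuous_imp_measurable_on_sets_lebesgue)
  show "continuous_on (cbox 0 One) (\<lambda>z. u (shift x z))"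
    using shift_in[OF x] by (intro continuous_on_compose2[OF u_continuous]) (auto intro!: continuous_intros)
qed simp

text \<open>Measurability is drawn from continuity of \<open>F\<close> on \<open>S\<close>; the
  preimage of \<open>S\<close> in the cube is measurable since the rest of the cube is null.\<close>

lemma measurable_Fc:
  assumes x: "x \<in> X" shows "(\<lambda>z. Fc (shift x z)) \<in> borel_measurable unit_cube"
proof -
  define S0 where "S0 = {z \<in> cbox 0 One. shift x z \<in> S}"
  have "negligible {z. shift x z \<in> X - S}"
    using S(2) \<epsilon>(1)[OF x] by (intro negligible_affine_vimage) (auto simp: negligible_iff_null_sets)
  then have "negligible (cbox 0 One - S0)"
    by (rule negligible_subset) (use shift_in[OF x] in \<open>auto simp: S0_def\<close>)
  then have "cbox 0 One - S0 \<in> sets lebesgue" by (rule negligible_imp_sets)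
  then have "cbox 0 One - (cbox 0 One - S0) \<in> sets lebesgue" by (rule sets.Diff[rotated]) simp
  also have "cbox 0 One - (cbox 0 One - S0) = S0" by (auto simp: S0_def)
  finally have S0: "S0 \<in> sets lebesgue" .
  have "continuous_on S0 (\<lambda>z. F (shift x z))"
  proof (rule continuous_on_compose2[of S F])
    show "continuous_on S F"
      unfolding continuous_on_eq_continuous_within
      using S(1) S_subset cont_ptsD(2) continuous_within_subset by blast
  qed (auto simp: S0_def intro!: continuous_intros)
  then have "(\<lambda>z. F (shift x z)) \<in> borel_measurable (lebesgue_on S0)"
    by (rule continuous_imp_measurable_on_sets_lebesgue[OF _ S0])
  then have "(\<lambda>z. if z \<in> S0 then F (shift x z) else 0) \<in> borel_measurable lebesgue"
    by (rule borel_measurable_if_I[OF _ S0])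
  then have "(\<lambda>z. if z \<in> S0 then F (shift x z) else 0) \<in> borel_measurable unit_cube"
    by (rule measurable_restrict_space1)
  then show ?thesis
    by (rule measurable_cong[THEN iffD1, rotated]) (auto simp: S0_def Fc_def)
qed

lemma measurable_molg: "x \<in> X \<Longrightarrow> molg x \<in> borel_measurable unit_cube"
proof -
  assume x: "x \<in> X"
  have "(\<lambda>z. z) \<in> borel_measurable (unit_cube :: 'a measure)"
    by (intro continuous_imp_measurable_on_sets_lebesgue continuous_on_id) simp
  then show ?thesis unfolding molg_def using measurable_Fc[OF x] by (intro measurable) auto
qed

lemma \<tau>_nonneg: "0 \<le> \<tau>" using \<epsilon>(4) norm_ge_zero order_trans by blast

lemma second_term_bound: "z \<in> cbox 0 One \<Longrightarrow> norm ((Fc y \<bullet> z) *\<^sub>R E x) \<le> L * real DIM('a) * \<tau>"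
proof -
  assume z: "z \<in> cbox 0 One"
  have "\<bar>Fc y \<bullet> z\<bar> \<le> norm (Fc y) * norm z" by (rule Cauchy_Schwarz_ineq2)
  also have "\<dots> \<le> L * real DIM('a)" using Fc_bound unit_cube_norm[OF z] L by (intro mult_mono) auto
  finally show ?thesis using \<epsilon>(4)[of x] L by (auto intro!: mult_mono)
qed

lemma molg_bound: "z \<in> cbox 0 One \<Longrightarrow> norm (molg x z) \<le> L + L * real DIM('a) * \<tau>"
  unfolding molg_def using Fc_bound second_term_bound by (intro norm_triangle_le add_mono) auto

lemma integrable_molg: "x \<in> X \<Longrightarrow> integrable unit_cube (molg x)"
  by (rule finite_measure.integrable_const_bound[OF unit_cube_finite _ measurable_molg, where B="L + L * real DIM('a) * \<tau>"])
     (auto intro!: AE_I2 molg_bound)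

lemma integrable_u: "x \<in> X \<Longrightarrow> integrable unit_cube (\<lambda>z. u (shift x z))"
proof -
  assume x: "x \<in> X"
  obtain B where B: "\<And>x. x \<in> X \<Longrightarrow> \<bar>u x\<bar> \<le> B" using bounded_realD[OF ub] by blast
  show ?thesis
    by (rule finite_measure.integrable_const_bound[OF unit_cube_finite _ measurable_u[OF x], where B=B])
     (auto intro!: AE_I2 B shift_in[OF x])
qed

lemma mol_near:
  assumes x: "x \<in> X" shows "\<bar>mol x - u x\<bar> \<le> L * (real DIM('a) * \<epsilon> x)"
proof -
  have "mol x - u x = (LINT z|unit_cube. u (shift x z)) - (LINT z|(unit_cube :: 'a measure). u x)"
    unfolding mol_def integral_const_cube ..
  also have "\<dots> = (LINT z|unit_cube. u (shift x z) - u x)"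
    by (rule Bochner_Integration.integral_diff[symmetric, OF integrable_u[OF x] integrable_const_cube])
  also have "norm \<dots> \<le> L * (real DIM('a) * \<epsilon> x)"
  proof (rule norm_integral_cube_le)
    show "integrable unit_cube (\<lambda>z. u (shift x z) - u x)"
      by (rule Bochner_Integration.integrable_diff[OF integrable_u[OF x] integrable_const_cube])
    fix z :: 'a assume z: "z \<in> cbox 0 One"
    have "0 \<le> real DIM('a) * \<epsilon> x" using \<epsilon>(1)[OF x] by simp
    then have "dist x (shift x z) < bdist X x" using shift_dist[OF x z] small[OF x] by linarith
    then have "closed_segment x (shift x z) \<subseteq> ball x (bdist X x)"
      using bdist_pos[OF x] by (intro closed_segment_subset) auto
    then have "closed_segment x (shift x z) \<subseteq> X" using bdist_ball by blast
    then have "\<bar>u (shift x z) - u x\<bar> \<le> L * dist x (shift x z)" by (rule ulip)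
    also have "\<dots> \<le> L * (real DIM('a) * \<epsilon> x)" using shift_dist[OF x z] L by simp
    finally show "norm (u (shift x z) - u x) \<le> L * (real DIM('a) * \<epsilon> x)" by simp
  qed
  finally show ?thesis by simp
qed

lemma shift_gderiv:
  assumes "shift x z \<in> S"
  shows "GDERIV (\<lambda>x. u (shift x z)) x :> molg x z"
proof -
  have 1: "((\<lambda>x. shift x z) has_derivative (\<lambda>h. h + (h \<bullet> E x) *\<^sub>R z)) (at x)"
    using \<epsilon>(2)[of x] unfolding gderiv_def by (auto intro!: derivative_eq_intros)
  have 2: "(u has_derivative (\<lambda>h. h \<bullet> F (shift x z))) (at (shift x z))"
    using ug[OF assms] by (simp add: gderiv_def)
  have "((\<lambda>x. u (shift x z)) has_derivative (\<lambda>h. (h + (h \<bullet> E x) *\<^sub>R z) \<bullet> F (shift x z))) (at x)"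
    by (rule has_derivative_compose[OF 1 2])
  then show ?thesis unfolding gderiv_def
    by (rule has_derivative_eq_rhs) (use assms in \<open>simp add: fun_eq_iff molg_def Fc_def inner_add_left inner_add_right inner_commute mult.commute\<close>)
qed

lemma \<epsilon>_lipschitz: "\<bar>\<epsilon> y - \<epsilon> x\<bar> \<le> \<tau> * dist x y"
proof -
  have *: "\<epsilon> b - \<epsilon> a \<le> \<tau> * dist a b" for a b
  proof (rule gderiv_segment_le[where D=E])
    show "GDERIV \<epsilon> z :> E z" for z by (rule \<epsilon>(2))
    fix z
    have "E z \<bullet> (b - a) \<le> norm (E z) * norm (b - a)" by (rule norm_cauchy_schwarz)
    also have "\<dots> \<le> \<tau> * dist a b" using \<epsilon>(4)[of z] by (simp add: dist_norm norm_minus_commute mult_right_mono)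
    finally show "E z \<bullet> (b - a) \<le> \<tau> * dist a b" .
  qed
  show ?thesis using *[of x y] *[of y x] by (simp add: abs_le_iff dist_commute)
qed

lemma shift_lipschitz: "z \<in> cbox 0 One \<Longrightarrow> dist (shift x z) (shift y z) \<le> (1 + \<tau> * real DIM('a)) * dist x y"
proof -
  assume z: "z \<in> cbox 0 One"
  have "(shift x z) - (shift y z) = (x - y) + (\<epsilon> x - \<epsilon> y) *\<^sub>R z" by (simp add: algebra_simps)
  then have "dist (shift x z) (shift y z) \<le> norm (x - y) + \<bar>\<epsilon> x - \<epsilon> y\<bar> * norm z"
    unfolding dist_norm by (metis norm_triangle_ineq norm_scaleR)
  also have "\<bar>\<epsilon> x - \<epsilon> y\<bar> * norm z \<le> (\<tau> * dist x y) * real DIM('a)"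
    using \<epsilon>_lipschitz[of x y] unit_cube_norm[OF z] \<tau>_nonneg by (intro mult_mono) (auto simp: dist_commute)
  finally show ?thesis by (simp add: dist_norm algebra_simps)
qed

text \<open>For every \<open>x\<close> almost every shift hits a point where \<open>u\<close> has
  gradient \<open>F\<close>, and the Lipschitz bound on segments dominates the quotients, so the
  average is differentiable at every point.\<close>

lemma mol_gderiv:
  assumes x: "x \<in> X" shows "GDERIV mol x :> mold x"
proof -
  obtain r where r: "r > 0" "ball x r \<subseteq> X" using X(2) x openE by blast
  have C: "0 < 1 + \<tau> * real DIM('a)" using \<tau>_nonneg by (simp add: add_pos_nonneg)
  \<comment> \<open>For \<open>y\<close> this close to \<open>x\<close> the shifts of
    \<open>y\<close> lie within \<open>real DIM('a) * \<epsilon> x\<close> of those of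
    \<open>x\<close>. With the factor 2 in \<open>small\<close>, both ends of the segment stay in
    the ball of radius \<open>bdist X x\<close>.\<close>
  define \<delta> where "\<delta> = min r (real DIM('a) * \<epsilon> x / (1 + \<tau> * real DIM('a)))"
  have \<delta>: "0 < \<delta>" using r \<epsilon>(1)[OF x] C by (simp add: \<delta>_def)
  have nearX: "y \<in> X" if "dist y x < \<delta>" for y using that r(2) by (auto simp: \<delta>_def dist_commute)
  have "GDERIV (\<lambda>x. LINT z|unit_cube. u (shift x z)) x :> (LINT z|unit_cube. molg x z)"
  proof (rule gderiv_integral[OF unit_cube_finite \<delta>])
    show "AE z in unit_cube. GDERIV (\<lambda>x. u (shift x z)) x :> molg x z"
      using AE_shift[OF x] by eventually_elim (rule shift_gderiv)
    show "integrable unit_cube (\<lambda>z. u (shift y z))" if "dist y x < \<delta>" for y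
      by (rule integrable_u[OF nearX[OF that]])
    show "molg x \<in> borel_measurable unit_cube" by (rule measurable_molg[OF x])
    show "AE z in unit_cube. norm (molg x z) \<le> L * (1 + \<tau> * real DIM('a))"
      using AE_cube by eventually_elim (use molg_bound in \<open>simp add: algebra_simps\<close>)
    fix y assume y: "dist y x < \<delta>"
    show "AE z in unit_cube. \<bar>u (shift y z) - u (shift x z)\<bar> \<le> L * (1 + \<tau> * real DIM('a)) * dist y x"
      using AE_cube
    proof eventually_elim
      case (elim z)
      let ?a = "shift x z" and ?b = "shift y z"
      have ab: "dist ?a ?b \<le> (1 + \<tau> * real DIM('a)) * dist x y" by (rule shift_lipschitz[OF elim])
      also have "\<dots> < real DIM('a) * \<epsilon> x" using y C by (simp add: \<delta>_def field_simps dist_commute)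
      finally have "dist x ?b < real DIM('a) * \<epsilon> x + real DIM('a) * \<epsilon> x"
        using shift_dist[OF x elim] dist_triangle[of x ?b ?a] by linarith
      then have b: "dist x ?b < bdist X x" using small[OF x] by linarith
      have "0 \<le> real DIM('a) * \<epsilon> x" using \<epsilon>(1)[OF x] by simp
      then have a: "dist x ?a < bdist X x" using shift_dist[OF x elim] small[OF x] by linarith
      have "closed_segment ?a ?b \<subseteq> ball x (bdist X x)" using a b by (intro closed_segment_subset) auto
      then have "\<bar>u ?b - u ?a\<bar> \<le> L * dist ?a ?b" by (intro ulip order_trans[OF _ bdist_ball])
      also have "\<dots> \<le> L * ((1 + \<tau> * real DIM('a)) * dist x y)" using ab L by simp
      finally show ?case by (simp add: dist_commute mult.assoc)
    qed
  qed
  then show ?thesis by (simp add: mol_def[abs_def] mold_def)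
qed

text \<open>A convergent sequence involves only countably many null sets of \<open>z\<close>.
  Outside them all shifts and their limit lie in \<open>S\<close>, where \<open>F\<close> is
  continuous, so the uniformly bounded integrands converge.\<close>

lemma mold_continuous: "continuous_on X mold"
  unfolding continuous_on_sequentially
proof (intro allI ballI impI)
  fix xs x assume x: "x \<in> X" and "(\<forall>n. xs n \<in> X) \<and> xs \<longlonglongrightarrow> x"
  then have xs: "\<And>n. xs n \<in> X" "xs \<longlonglongrightarrow> x" by auto
  have \<epsilon>xs: "(\<lambda>n. \<epsilon> (xs n)) \<longlonglongrightarrow> \<epsilon> x" by (rule isCont_tendsto_compose[OF \<epsilon>_continuous xs(2)])
  have Exs: "(\<lambda>n. E (xs n)) \<longlonglongrightarrow> E x"
    using \<epsilon>(3) xs(2) by (intro isCont_tendsto_compose[of x E]) (simp_all add: continuous_on_eq_continuous_at)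
  have "(\<lambda>n. LINT z|unit_cube. molg (xs n) z) \<longlonglongrightarrow> (LINT z|unit_cube. molg x z)"
  proof (rule integral_dominated_convergence)
    show "integrable (unit_cube :: 'a measure) (\<lambda>z. L + L * real DIM('a) * \<tau>)"
      using unit_cube_finite by (rule finite_measure.integrable_const)
    show "molg x \<in> borel_measurable unit_cube" "molg (xs n) \<in> borel_measurable unit_cube" for n
      using measurable_molg x xs(1) by auto
    show "AE z in unit_cube. norm (molg (xs n) z) \<le> L + L * real DIM('a) * \<tau>" for n
      using AE_cube by eventually_elim (rule molg_bound)
    have "AE z in unit_cube. \<forall>n. shift (xs n) z \<in> S"
      using AE_shift[OF xs(1)] by (simp add: AE_all_countable)
    then show "AE z in unit_cube. (\<lambda>n. molg (xs n) z) \<longlonglongrightarrow> molg x z"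
      using AE_shift[OF x]
    proof eventually_elim
      case (elim z)
      have y: "(\<lambda>n. shift (xs n) z) \<longlonglongrightarrow> shift x z" by (intro tendsto_intros xs \<epsilon>xs)
      have "shift x z \<in> cont_pts X F" using elim(2) S(1) by (rule subsetD[rotated])
      then have "continuous (at (shift x z) within X) F" by (rule cont_ptsD(2))
      moreover have "\<forall>n. shift (xs n) z \<in> X" using elim(1) S_subset by auto
      ultimately have "(\<lambda>n. F (shift (xs n) z)) \<longlonglongrightarrow> F (shift x z)"
        unfolding continuous_within_sequentially comp_def using y by simp
      then have "(\<lambda>n. Fc (shift (xs n) z)) \<longlonglongrightarrow> Fc (shift x z)"
        using elim by (simp add: Fc_def)
      then show ?case unfolding molg_def by (intro tendsto_intros Exs)
    qed
  qed
  then show "(mold \<circ> xs) \<longlonglongrightarrow> mold x" by (simp add: mold_def comp_def)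
qed

text \<open>An average of vectors in a half-space stays in it; the variation of the radius adds at
  most \<open>L * real DIM('a) * \<tau>\<close>.\<close>

lemma mold_upper:
  assumes x: "x \<in> X" and \<xi>: "norm \<xi> = 1" and c: "\<And>y. y \<in> S \<Longrightarrow> dist x y \<le> real DIM('a) * \<epsilon> x \<Longrightarrow> F y \<bullet> \<xi> \<le> c"
  shows "mold x \<bullet> \<xi> \<le> c + L * real DIM('a) * \<tau>"
proof -
  have "mold x \<bullet> \<xi> = (LINT z|unit_cube. molg x z \<bullet> \<xi>)"
    unfolding mold_def using integrable_molg[OF x] by simp
  also have "\<dots> \<le> (LINT z|(unit_cube :: 'a measure). c + L * real DIM('a) * \<tau>)"
  proof (rule integral_mono_AE)
    show "integrable unit_cube (\<lambda>z. molg x z \<bullet> \<xi>)" using integrable_molg[OF x] by simp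
    show "integrable (unit_cube :: 'a measure) (\<lambda>z. c + L * real DIM('a) * \<tau>)"
      by (rule integrable_const_cube)
    show "AE z in unit_cube. molg x z \<bullet> \<xi> \<le> c + L * real DIM('a) * \<tau>"
      using AE_shift[OF x] AE_cube
    proof eventually_elim
      case (elim z)
      have "Fc (shift x z) \<bullet> \<xi> \<le> c" using c[OF elim(1) shift_dist[OF x elim(2)]] elim(1) by (simp add: Fc_def)
      moreover have "\<bar>((Fc (shift x z) \<bullet> z) *\<^sub>R E x) \<bullet> \<xi>\<bar> \<le> L * real DIM('a) * \<tau>"
        by (rule abs_inner_unit_le[OF \<xi> second_term_bound[OF elim(2)]])
      ultimately show ?case unfolding molg_def inner_add_left by linarith
    qed
  qed
  also have "\<dots> = c + L * real DIM('a) * \<tau>" by (rule integral_const_cube)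
  finally show ?thesis .
qed

lemma mol_c10: "c10_grad X mol mold"
  unfolding c10_grad_def
proof (intro conjI ballI mold_continuous mol_gderiv)
  obtain B where B: "\<And>x. x \<in> X \<Longrightarrow> \<bar>u x\<bar> \<le> B" using bounded_realD[OF ub] by blast
  show "bounded (mol ` X)"
  proof (rule boundedI)
    fix w assume "w \<in> mol ` X"
    then obtain x where x: "x \<in> X" "w = mol x" by blast
    have "2 * (real DIM('a) * \<epsilon> x) \<le> 1" using small[OF x(1)] bdist_le_1[of X x] by linarith
    then have "L * (real DIM('a) * \<epsilon> x) \<le> L * 1" using L \<epsilon>(1)[OF x(1)] by (intro mult_left_mono) auto
    then show "norm w \<le> B + L" using mol_near[OF x(1)] B[OF x(1)] x(2) by simp
  qed
  show "bounded (mold ` X)"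
  proof (rule boundedI)
    fix w assume "w \<in> mold ` X"
    then obtain x where x: "x \<in> X" "w = mold x" by blast
    show "norm w \<le> L + L * real DIM('a) * \<tau>"
      unfolding x(2) mold_def by (rule norm_integral_cube_le[OF integrable_molg[OF x(1)] molg_bound])
  qed
qed

end

end

section \<open>A characterization of the closure of the gradient\<close>

lemma infconv_diff_le:
  assumes "0 \<le> k" "S \<noteq> {}" "\<And>y. y \<in> S \<Longrightarrow> m \<le> f y" and fg: "\<And>y. y \<in> S \<Longrightarrow> f y \<le> g y + e"
  shows "infconv k S f x - e \<le> infconv k S g x"
proof (rule infconv_ge[OF assms(2)])
  fix y assume y: "y \<in> S"
  have "infconv k S f x \<le> f y + k * dist x y" by (rule infconv_le[OF assms(1,3) y])
  then show "infconv k S f x - e \<le> g y + k * dist x y" using fg[OF y] by linarith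
qed

text \<open>Infimal convolutions over the same set differ by no more than the functions do, whatever
  \<open>k\<close>; continuity allows that set to be \<open>X\<close> for both.\<close>

lemma (in bounded_domain) r_ae_le_uniform:
  assumes f: "cae X f" "continuous_on X f" and g: "cae X g" "continuous_on X g"
    and e: "\<And>x. x \<in> X \<Longrightarrow> \<bar>f x - g x\<bar> \<le> e"
  shows "r_ae X f g \<le> e + e * measure lebesgue X"
proof -
  have l: "\<bar>lenv_ae X k p x - lenv_ae X k q x\<bar> \<le> e"
    if p: "cae X p" "continuous_on X p" and q: "cae X q" "continuous_on X q"
      and pq: "\<And>x. x \<in> X \<Longrightarrow> \<bar>p x - q x\<bar> \<le> e" and x: "x \<in> X" for p q k x
  proof -
    obtain M where M: "\<And>x. x \<in> X \<Longrightarrow> \<bar>p x\<bar> \<le> M" using bounded_realD[OF cae_bounded[OF p(1)]] by blast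
    obtain M' where M': "\<And>x. x \<in> X \<Longrightarrow> \<bar>q x\<bar> \<le> M'" using bounded_realD[OF cae_bounded[OF q(1)]] by blast
    have b: "- M \<le> p y" "- M' \<le> q y" "p y \<le> q y + e" "q y \<le> p y + e" if "y \<in> X" for y
      using M[OF that] M'[OF that] pq[OF that] by linarith+
    have eq: "lenv_ae X k p x = infconv k X p x" "lenv_ae X k q x = infconv k X q x"
      using p q x by (auto intro!: lenv_ae_eq X simp: cont_pts_continuous_on cae_def)
    show ?thesis
      using infconv_diff_le[where f=p and g=q and k="real k" and x=x, OF of_nat_0_le_iff X(1) b(1,3)]
        infconv_diff_le[where f=q and g=p and k="real k" and x=x, OF of_nat_0_le_iff X(1) b(2,4)]
      unfolding eq by (simp add: abs_le_iff)
  qed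
  have u: "\<bar>uenv_ae X k f x - uenv_ae X k g x\<bar> \<le> e" if x: "x \<in> X" for k x
  proof -
    have "\<bar>lenv_ae X k (\<lambda>x. - f x) x - lenv_ae X k (\<lambda>x. - g x) x\<bar> \<le> e"
      using e by (intro l[OF _ _ _ _ _ x] cae_minus f g continuous_on_minus) (simp add: abs_minus_commute)
    then show ?thesis by (simp add: uenv_ae_minus abs_minus_commute)
  qed
  show ?thesis
    by (intro r_ae_le delta_le_uniform X X_lmeasurable u l f g e)
qed

section \<open>Oscillation of the limit gradient\<close>

context lip_grad
begin

text \<open>The oscillation of the whole vector bounds that of every component
  \<open>F x \<bullet> \<xi>\<close> with a unit vector \<open>\<xi>\<close>, so one function serves
  all directions.\<close>

definition osc :: "real \<Rightarrow> 'a \<Rightarrow> real" where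
  "osc \<eta> x = (SUP (y, z)\<in>(S \<inter> ball x \<eta>) \<times> (S \<inter> ball x \<eta>). dist (F y) (F z))"

lemma osc_bdd: "bdd_above ((\<lambda>(y, z). dist (F y) (F z)) ` ((S \<inter> A) \<times> (S \<inter> A)))"
proof (rule bdd_aboveI2[where M="2 * L"], clarify)
  fix y z assume "y \<in> S" "z \<in> S"
  then have "norm (F y) \<le> L" "norm (F z) \<le> L" using FL S_subset by auto
  then show "dist (F y) (F z) \<le> 2 * L" using norm_triangle_ineq4[of "F y" "F z"] by (simp add: dist_norm)
qed

lemma osc_ge: "y \<in> S \<Longrightarrow> z \<in> S \<Longrightarrow> dist x y < \<eta> \<Longrightarrow> dist x z < \<eta> \<Longrightarrow> dist (F y) (F z) \<le> osc \<eta> x"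
  unfolding osc_def using osc_bdd[of "ball x \<eta>"] by (intro cSUP_upper2[of _ _ "(y, z)"]) auto

lemma ball_meets_S:
  assumes "x \<in> X" "0 < \<eta>" obtains y where "y \<in> S" "dist x y < \<eta>"
proof -
  have "x \<in> closure S" using conull_dense[OF X(2) S(2)] assms(1) by blast
  then obtain y where "y \<in> S" "dist y x < \<eta>" using assms(2) unfolding closure_approachable by blast
  then show thesis by (intro that) (auto simp: dist_commute)
qed

lemma osc_nonneg: "x \<in> X \<Longrightarrow> 0 < \<eta> \<Longrightarrow> 0 \<le> osc \<eta> x"
  using ball_meets_S[of x \<eta>] osc_ge[of _ _ x \<eta>] by (metis dist_self)

lemma osc_le:
  assumes "x \<in> X" "0 < \<eta>" "\<And>y z. y \<in> S \<Longrightarrow> z \<in> S \<Longrightarrow> dist x y < \<eta> \<Longrightarrow> dist x z < \<eta> \<Longrightarrow> dist (F y) (F z) \<le> c"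
  shows "osc \<eta> x \<le> c"
proof -
  obtain y where "y \<in> S" "dist x y < \<eta>" using ball_meets_S[OF assms(1,2)] by blast
  then have "(S \<inter> ball x \<eta>) \<times> (S \<inter> ball x \<eta>) \<noteq> {}" by auto
  then show ?thesis unfolding osc_def using assms(3) by (intro cSUP_least) auto
qed

lemma osc_le_2L: "x \<in> X \<Longrightarrow> 0 < \<eta> \<Longrightarrow> osc \<eta> x \<le> 2 * L"
proof (rule osc_le)
  fix y z assume "y \<in> S" "z \<in> S"
  then have "norm (F y) \<le> L" "norm (F z) \<le> L" using FL S_subset by auto
  then show "dist (F y) (F z) \<le> 2 * L" using norm_triangle_ineq4[of "F y" "F z"] by (simp add: dist_norm)
qed auto

text \<open>For \<open>a \<ge> 0\<close> the superlevel set is a union of intersections of two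
  balls, cut with \<open>X\<close>, hence open; for negative \<open>a\<close> it is the whole
  space.\<close>

lemma osc_measurable:
  assumes "0 < \<eta>" shows "(\<lambda>x. indicator X x * osc \<eta> x) \<in> borel_measurable lebesgue"
  unfolding borel_measurable_iff_greater
proof
  fix a :: real
  show "{x \<in> space lebesgue. a < indicator X x * osc \<eta> x} \<in> sets lebesgue"
  proof (cases "a < 0")
    case True
    then have "{x \<in> space lebesgue. a < indicator X x * osc \<eta> x} = UNIV"
      using osc_nonneg[OF _ assms] by (auto simp: indicator_def intro: less_le_trans)
    then show ?thesis by simp
  next
    case False
    have "{x \<in> space lebesgue. a < indicator X x * osc \<eta> x}
        = X \<inter> (\<Union>y\<in>S. \<Union>z\<in>{z\<in>S. a < dist (F y) (F z)}. ball y \<eta> \<inter> ball z \<eta>)" (is "?A = ?B")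
    proof (intro equalityI subsetI)
      fix x assume "x \<in> ?A"
      then have x: "x \<in> X" "a < osc \<eta> x" using False by (cases "x \<in> X"; simp)+
      have "\<exists>y z. y \<in> S \<and> z \<in> S \<and> dist x y < \<eta> \<and> dist x z < \<eta> \<and> a < dist (F y) (F z)"
        using osc_le[OF x(1) assms, of a] x(2) by force
      then show "x \<in> ?B" using x(1) by (auto simp: dist_commute)
    next
      fix x assume "x \<in> ?B"
      then obtain y z where yz: "x \<in> X" "y \<in> S" "z \<in> S" "a < dist (F y) (F z)" "dist x y < \<eta>" "dist x z < \<eta>"
        by (auto simp: dist_commute)
      then have "a < osc \<eta> x" using osc_ge[of y z x \<eta>] by linarith
      then show "x \<in> ?A" using yz(1) by simp
    qed
    moreover have "open ?B" by (intro open_Int X(2) open_UN ballI open_ball)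
    ultimately show ?thesis by (metis borel_open sets_completionI_sets sets_lborel)
  qed
qed

lemma osc_integrable:
  assumes "0 < \<eta>" shows "integrable lebesgue (\<lambda>x. indicator X x * osc \<eta> x)"
proof (rule Bochner_Integration.integrable_bound[OF _ osc_measurable[OF assms]])
  show "integrable lebesgue (\<lambda>x. indicator X x * (2 * L))"
    using X_lmeasurable by (intro integrable_mult_left) (auto simp: fmeasurable_def)
  show "AE x in lebesgue. norm (indicator X x * osc \<eta> x) \<le> norm (indicator X x * (2 * L))"
    using osc_nonneg[OF _ assms] osc_le_2L[OF _ assms] L by (intro AE_I2) (auto simp: indicator_def)
qed

text \<open>At points of \<open>S\<close> the oscillation shrinks to 0 with the radius, and
  \<open>2 * L\<close> dominates it. This limit controls the integral part of
  \<open>delta\<close>.\<close>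

lemma osc_integral_tendsto:
  "(\<lambda>n. LINT x|lebesgue. indicator X x * osc (inverse (real (Suc n))) x) \<longlonglongrightarrow> 0"
proof -
  let ?\<eta> = "\<lambda>n. inverse (real (Suc n))"
  have "(\<lambda>n. LINT x|lebesgue. indicator X x * osc (?\<eta> n) x) \<longlonglongrightarrow> (LINT x|(lebesgue :: 'a measure). 0)"
  proof (rule integral_dominated_convergence)
    show "(\<lambda>x. indicator X x * osc (?\<eta> n) x) \<in> borel_measurable lebesgue" for n by (rule osc_measurable) simp
    show "integrable lebesgue (\<lambda>x. indicator X x * (2 * L))"
      using X_lmeasurable by (intro integrable_mult_left) (auto simp: fmeasurable_def)
    show "AE x in lebesgue. norm (indicator X x * osc (?\<eta> n) x) \<le> indicator X x * (2 * L)" for n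
      using osc_nonneg[of _ "?\<eta> n"] osc_le_2L[of _ "?\<eta> n"] by (intro AE_I2) (auto simp: indicator_def)
    have "AE x in lebesgue. x \<notin> X - S" by (rule AE_not_in[OF S(2)])
    then show "AE x in lebesgue. (\<lambda>n. indicator X x * osc (?\<eta> n) x) \<longlonglongrightarrow> 0"
    proof eventually_elim
      case (elim x)
      show ?case
      proof (cases "x \<in> X")
        case True
        then have x: "x \<in> cont_pts X F" using elim S(1) by auto
        have "(\<lambda>n. osc (?\<eta> n) x) \<longlonglongrightarrow> 0"
        proof (rule tendstoI)
          fix e :: real assume e: "e > 0"
          obtain d where d: "d > 0" "\<And>z. z \<in> X \<Longrightarrow> dist z x < d \<Longrightarrow> dist (F z) (F x) < e / 4"
            using cont_ptsD(2)[OF x] e unfolding continuous_within_eps_delta by (meson divide_pos_pos zero_less_numeral)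
          have "\<forall>\<^sub>F n in sequentially. ?\<eta> n < d"
            using order_tendstoD(2)[OF LIMSEQ_inverse_real_of_nat d(1)] .
          then show "\<forall>\<^sub>F n in sequentially. dist (osc (?\<eta> n) x) 0 < e"
          proof eventually_elim
            case (elim n)
            have "osc (?\<eta> n) x \<le> e / 2"
            proof (rule osc_le[OF True])
              fix y z assume yz: "y \<in> S" "z \<in> S" "dist x y < ?\<eta> n" "dist x z < ?\<eta> n"
              have "dist (F y) (F x) < e / 4" "dist (F z) (F x) < e / 4"
                using yz elim S_subset d(2)[of y] d(2)[of z] by (auto simp: dist_commute[of x])
              then show "dist (F y) (F z) \<le> e / 2" using dist_triangle2[of "F y" "F z" "F x"] by linarith
            qed simp
            moreover have "0 \<le> osc (?\<eta> n) x" by (rule osc_nonneg[OF True]) simp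
            ultimately show ?case using e by (simp add: dist_real_def)
          qed
        qed
        then show ?thesis using True by simp
      qed simp
    qed
  qed simp
  then show ?thesis by simp
qed

text \<open>The three conclusions of \<open>infconv_pair.compare\<close>: the first two feed the
  Hausdorff distance of the graphs, the third feeds the integral.\<close>

definition env_close :: "real \<Rightarrow> ('a \<Rightarrow> real) \<Rightarrow> ('a \<Rightarrow> real) \<Rightarrow> bool" where
  "env_close \<eta> \<phi> \<psi> \<longleftrightarrow> (\<forall>x\<in>X. (\<exists>x'\<in>X. dist x x' \<le> \<eta> \<and> \<bar>\<phi> x - \<psi> x'\<bar> \<le> 6 * \<eta>) \<and>
     (\<exists>x'\<in>X. dist x x' \<le> \<eta> \<and> \<bar>\<psi> x - \<phi> x'\<bar> \<le> 6 * \<eta>) \<and> \<bar>\<phi> x - \<psi> x\<bar> \<le> osc \<eta> x + 4 * \<eta>)"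

lemma env_close_cong:
  assumes "env_close \<eta> \<phi> \<psi>" "\<And>x. x \<in> X \<Longrightarrow> \<phi>' x = \<phi> x" "\<And>x. x \<in> X \<Longrightarrow> \<psi>' x = \<psi> x"
  shows "env_close \<eta> \<phi>' \<psi>'"
  using assms unfolding env_close_def by simp

lemma env_close_minus:
  assumes "env_close \<eta> \<phi> \<psi>" shows "env_close \<eta> (\<lambda>x. - \<phi> x) (\<lambda>x. - \<psi> x)"
proof -
  have "\<bar>- a - - b\<bar> = \<bar>a - b\<bar>" for a b :: real by simp
  then show ?thesis using assms unfolding env_close_def by presburger
qed

text \<open>The 7 is \<open>1 + 6\<close>, horizontal plus vertical error of the graphs; the rest
  comes from integrating \<open>osc \<eta> x + 4 * \<eta>\<close> over \<open>X\<close>.\<close>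

lemma delta_le_osc:
  assumes \<eta>: "0 < \<eta>" and close: "env_close \<eta> \<phi> \<psi>"
  shows "delta X \<phi> \<psi> \<le> (7 + 4 * measure lebesgue X) * \<eta> + (LINT x|lebesgue. indicator X x * osc \<eta> x)"
proof -
  have 1: "\<exists>x'\<in>X. dist x x' \<le> \<eta> \<and> \<bar>\<phi> x - \<psi> x'\<bar> \<le> 6 * \<eta>"
    and 2: "\<exists>x'\<in>X. dist x x' \<le> \<eta> \<and> \<bar>\<psi> x - \<phi> x'\<bar> \<le> 6 * \<eta>"
    and 3: "\<bar>\<phi> x - \<psi> x\<bar> \<le> osc \<eta> x + 4 * \<eta>" if "x \<in> X" for x
    using close that unfolding env_close_def by blast+
  have "hgraph X \<phi> \<psi> \<le> \<eta> + 6 * \<eta>" by (rule hgraph_le[OF X(1) 1 2])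
  moreover have "(LINT x:X|lebesgue. \<bar>\<phi> x - \<psi> x\<bar>) \<le> (LINT x|lebesgue. indicator X x * osc \<eta> x) + 4 * \<eta> * measure lebesgue X"
  proof -
    have "(LINT x:X|lebesgue. \<bar>\<phi> x - \<psi> x\<bar>) \<le> (LINT x|lebesgue. indicator X x * osc \<eta> x + indicator X x * (4 * \<eta>))"
      unfolding set_lebesgue_integral_def
    proof (rule integral_mono')
      show "integrable lebesgue (\<lambda>x. indicator X x * osc \<eta> x + indicator X x * (4 * \<eta>))"
        using X_lmeasurable by (intro Bochner_Integration.integrable_add osc_integrable[OF \<eta>] integrable_mult_left) (auto simp: fmeasurable_def)
      show "indicator X x *\<^sub>R \<bar>\<phi> x - \<psi> x\<bar> \<le> indicator X x * osc \<eta> x + indicator X x * (4 * \<eta>)" for x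
        using 3[of x] by (simp add: indicator_def)
      show "0 \<le> indicator X x * osc \<eta> x + indicator X x * (4 * \<eta>)" for x
        using osc_nonneg[OF _ \<eta>, of x] \<eta> by (simp add: indicator_def)
    qed
    also have "\<dots> = (LINT x|lebesgue. indicator X x * osc \<eta> x) + (LINT x|lebesgue. indicator X x * (4 * \<eta>))"
      using X_lmeasurable by (intro Bochner_Integration.integral_add osc_integrable[OF \<eta>] integrable_mult_left) (auto simp: fmeasurable_def)
    also have "(LINT x|lebesgue. indicator X x * (4 * \<eta>)) = 4 * \<eta> * measure lebesgue X" by simp
    finally show ?thesis .
  qed
  ultimately show ?thesis unfolding delta_def by (simp add: algebra_simps)
qed

text \<open>The radii are chosen in the order \<open>r\<close>, \<open>\<rho>\<close>,
  \<open>p\<close>, \<open>\<rho>'\<close>, \<open>q\<close>, and the averaging radius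
  \<open>\<epsilon>\<close> last. \<open>good_points\<close> is applied to the vector
  \<open>F\<close>, so none of them depends on \<open>\<xi>\<close> or \<open>k\<close>.\<close>

lemma approximation:
  assumes \<eta>: "0 < \<eta>" "\<eta> \<le> 1"
  obtains w D where "c10_grad X w D" "\<And>x. x \<in> X \<Longrightarrow> \<bar>w x - u x\<bar> \<le> \<eta>"
    "\<And>\<xi> k. norm \<xi> = 1 \<Longrightarrow> 0 < k \<Longrightarrow>
      env_close \<eta> (infconv k X (\<lambda>x. D x \<bullet> \<xi>)) (infconv k S (\<lambda>x. F x \<bullet> \<xi>))"
proof -
  have bS: "bounded S" using X(3) S_subset bounded_subset by blast
  have bF: "bounded (F ` S)" using FL S_subset by (intro boundedI[of _ L]) blast
  note gp = good_points[OF bS bF S(1) _ \<eta>(1)]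
  \<comment> \<open>\<open>max 1 m\<close> keeps the radius positive at the index 0, which is not a
    layer. The 16 serves both \<open>r m \<le> \<eta> / 4\<close> and
    \<open>real m * r m \<le> 1 / 16\<close>.\<close>
  define r where "r m = \<eta> / (16 * real (max 1 m))" for m
  have r0: "0 < r m" for m using \<eta> by (simp add: r_def)
  have r1: "r m \<le> \<eta> / 4" for m
  proof -
    have "16 * real (max 1 m) \<ge> 4" by simp
    then show ?thesis unfolding r_def using \<eta> by (intro divide_left_mono) auto
  qed
  have r2: "real m * r m \<le> 1 / 16" for m
  proof -
    have "real m * r m \<le> real (max 1 m) * r m" using r0[of m] by (intro mult_right_mono) auto
    also have "\<dots> = \<eta> / 16" by (simp add: r_def)
    finally show ?thesis using \<eta> by simp
  qed
  have "\<forall>m. \<exists>\<rho>. \<rho> > 0 \<and> (\<forall>y\<in>S. \<exists>t\<in>S. dist y t \<le> r m \<and> dist (F y) (F t) \<le> \<eta> \<and>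
           (\<forall>z\<in>S. dist t z < \<rho> \<longrightarrow> dist (F z) (F t) \<le> \<eta>))"
    using gp[OF r0] by simp
  from choice[OF this] obtain \<rho>0 where \<rho>0: "\<And>m. \<rho>0 m > 0"
    "\<And>m y. y \<in> S \<Longrightarrow> \<exists>t\<in>S. dist y t \<le> r m \<and> dist (F y) (F t) \<le> \<eta> \<and> (\<forall>z\<in>S. dist t z < \<rho>0 m \<longrightarrow> dist (F z) (F t) \<le> \<eta>)"
    by blast
  define \<rho> where "\<rho> m = min (\<rho>0 m) (r m)" for m
  have \<rho>: "0 < \<rho> m" "\<rho> m \<le> r m" "\<rho> m \<le> \<rho>0 m" for m using \<rho>0(1) r0 by (auto simp: \<rho>_def)
  define p where "p m = \<eta> * \<rho> m / (4 * L + 6)" for m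
  have p0: "0 < p m" for m using \<eta> \<rho> L by (simp add: p_def)
  have p1: "p m * (4 * L + 6) = \<eta> * \<rho> m" for m using L by (simp add: p_def)
  have p2: "p m \<le> r m" for m
  proof -
    have "p m * 1 \<le> p m * (4 * L + 6)" using p0[of m] L by (intro mult_left_mono) auto
    also have "\<dots> \<le> 1 * \<rho> m" unfolding p1 using \<eta> \<rho>(1)[of m] by (intro mult_right_mono) auto
    finally show ?thesis using \<rho>(2)[of m] by simp
  qed
  have "\<forall>m. \<exists>\<rho>. \<rho> > 0 \<and> (\<forall>y\<in>S. \<exists>t\<in>S. dist y t \<le> p m \<and> dist (F y) (F t) \<le> \<eta> \<and>
           (\<forall>z\<in>S. dist t z < \<rho> \<longrightarrow> dist (F z) (F t) \<le> \<eta>))"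
    using gp[OF p0] by simp
  from choice[OF this] obtain \<rho>' where \<rho>': "\<And>m. \<rho>' m > 0"
    "\<And>m y. y \<in> S \<Longrightarrow> \<exists>t\<in>S. dist y t \<le> p m \<and> dist (F y) (F t) \<le> \<eta> \<and> (\<forall>z\<in>S. dist t z < \<rho>' m \<longrightarrow> dist (F z) (F t) \<le> \<eta>)"
    by blast
  define q where "q m = min (\<rho> m / 4) (min (p m) (\<rho>' m / 2))" for m
  have q0: "0 < q m" for m using \<rho>(1) p0 \<rho>'(1) by (simp add: q_def)
  have q: "q m \<le> \<rho> m / 4" "q m \<le> p m" "q m < \<rho>' m" for m
    using \<rho>'(1)[of m] by (auto simp: q_def min_less_iff_disj)
  define N where "N = real DIM('a)"
  have N: "N > 0" by (simp add: N_def)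
  \<comment> \<open>The size that makes the extra term in \<open>mold_upper\<close> equal to
    \<open>\<eta>\<close>.\<close>
  define \<tau> where "\<tau> = \<eta> / (L * N)"
  have \<tau>: "0 < \<tau>" "L * N * \<tau> = \<eta>" using \<eta> L N by (auto simp: \<tau>_def)
  \<comment> \<open>Shifts have length up to \<open>N * \<epsilon> x\<close>, so it is this product
    that has to stay below \<open>q m\<close>.\<close>
  have "0 < q m / N" for m using q0[of m] N by simp
  then obtain \<epsilon> E where \<epsilon>: "\<And>x. x \<in> X \<Longrightarrow> 0 < \<epsilon> x" "\<And>x. GDERIV \<epsilon> x :> E x" "continuous_on UNIV E"
    "\<And>x. norm (E x) \<le> \<tau>" and \<epsilon>q: "\<And>m x. x \<in> X \<Longrightarrow> real m * bdist X x \<le> 4 \<Longrightarrow> \<epsilon> x \<le> q m / N"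
    using variable_radius_exists[OF _ \<tau>(1), of "\<lambda>m. q m / N"] by metis
  have N\<epsilon>: "N * \<epsilon> x \<le> q m" if "x \<in> X" "real m * bdist X x \<le> 4" for x m
    using \<epsilon>q[OF that] N by (simp add: field_simps)
  have small: "2 * (real DIM('a) * \<epsilon> x) < bdist X x" and near: "L * (real DIM('a) * \<epsilon> x) \<le> \<eta>" if x: "x \<in> X" for x
  proof -
    obtain m :: nat where m: "m \<ge> 1" "1 \<le> real m * bdist X x" "real m * bdist X x \<le> 2" using layer_index[OF bdist_pos[OF x] bdist_le_1] by blast
    have Nq: "N * \<epsilon> x \<le> q m" using N\<epsilon>[OF x, of m] m by simp
    have "2 * q m \<le> r m" using q(1)[of m] \<rho>(2)[of m] \<rho>(1)[of m] by linarith
    then have "real m * (2 * (N * \<epsilon> x)) \<le> real m * r m" using Nq by (intro mult_left_mono) auto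
    also have "\<dots> < real m * bdist X x" using r2[of m] m by linarith
    finally show "2 * (real DIM('a) * \<epsilon> x) < bdist X x" using m(1) by (simp add: N_def)
    have "L * (N * \<epsilon> x) \<le> L * p m" using Nq q(2)[of m] L by (intro mult_left_mono) auto
    also have "\<dots> \<le> p m * (4 * L + 6)" using p0[of m] L by (simp add: algebra_simps)
    also have "\<dots> \<le> \<eta> * 1" unfolding p1 using \<eta> \<rho>(2)[of m] r1[of m] by (intro mult_left_mono) auto
    finally show "L * (real DIM('a) * \<epsilon> x) \<le> \<eta>" by (simp add: N_def)
  qed
  note fin = \<epsilon> small
  have upper: "mold \<epsilon> E x \<bullet> \<xi> \<le> c + \<eta>"
    if "x \<in> X" "norm \<xi> = 1" "\<And>y. y \<in> S \<Longrightarrow> dist x y \<le> N * \<epsilon> x \<Longrightarrow> F y \<bullet> \<xi> \<le> c" for x \<xi> c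
    using mold_upper[OF \<epsilon> small that(1,2), of c] that(3) \<tau>(2) unfolding N_def by simp
  have pair: "infconv_pair X S (\<lambda>x. F x \<bullet> \<xi>) (\<lambda>x. mold \<epsilon> E x \<bullet> \<xi>) (\<lambda>x. N * \<epsilon> x) (bdist X) L \<eta> r \<rho> p \<rho>' q"
    if \<xi>: "norm \<xi> = 1" for \<xi>
  proof
    have \<xi>': "norm (- \<xi>) = 1" using \<xi> by simp
    have inn: "\<bar>F y \<bullet> \<xi> - F z \<bullet> \<xi>\<bar> \<le> dist (F y) (F z)" for y z
      using Cauchy_Schwarz_ineq2[of "F y - F z" \<xi>] \<xi> by (simp add: inner_diff_left dist_norm)
    have Fb: "F y \<bullet> \<zeta> \<le> L" if "y \<in> S" "norm \<zeta> = 1" for y \<zeta>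
      using abs_inner_unit_le[OF that(2) FL[of y]] that(1) S_subset by auto
    show "S \<subseteq> X" by (rule S_subset)
    show "X \<subseteq> closure S" by (rule conull_dense[OF X(2) S(2)])
    show "0 < \<eta>" "\<eta> \<le> 1" "0 \<le> L" using \<eta> L by auto
    show "\<bar>F y \<bullet> \<xi>\<bar> \<le> L" if "y \<in> S" for y
      using Fb[OF that \<xi>] Fb[OF that \<xi>'] by (simp add: abs_le_iff)
    show "\<bar>mold \<epsilon> E x \<bullet> \<xi>\<bar> \<le> L + 1" if "x \<in> X" for x
      using upper[OF that \<xi> Fb[OF _ \<xi>]] upper[OF that \<xi>' Fb[OF _ \<xi>']] \<eta> by (simp add: abs_le_iff)
    show "mold \<epsilon> E x \<bullet> \<xi> \<le> c + \<eta>" if "x \<in> X" "\<And>y. y \<in> S \<Longrightarrow> dist x y \<le> N * \<epsilon> x \<Longrightarrow> F y \<bullet> \<xi> \<le> c" for x c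
      by (rule upper[OF that(1) \<xi> that(2)])
    \<comment> \<open>A lower bound in direction \<open>\<xi>\<close> is an upper bound in direction
      \<open>- \<xi>\<close>.\<close>
    show "c - \<eta> \<le> mold \<epsilon> E x \<bullet> \<xi>" if "x \<in> X" "\<And>y. y \<in> S \<Longrightarrow> dist x y \<le> N * \<epsilon> x \<Longrightarrow> c \<le> F y \<bullet> \<xi>" for x c
      using upper[OF that(1) \<xi>', of "- c"] that(2) by simp
    show "\<bar>bdist X x - bdist X y\<bar> \<le> dist x y" for x y by (rule bdist_lipschitz)
    show "0 < bdist X x" if "x \<in> X" for x by (rule bdist_pos[OF that])
    show "bdist X x \<le> 1" for x by (rule bdist_le_1)
    show "ball x (bdist X x) \<subseteq> X" for x by (rule bdist_ball)
    show "N * \<epsilon> x \<le> q m" if "x \<in> X" "real m * bdist X x \<le> 4" for x m by (rule N\<epsilon>[OF that])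
    show "0 < r m" "r m \<le> \<eta> / 4" "real m * r m \<le> 1 / 16" "0 < \<rho> m" "\<rho> m \<le> r m" "0 < p m"
      "p m * (4 * L + 6) \<le> \<eta> * \<rho> m" "p m \<le> r m" "q m \<le> \<rho> m / 4" "q m \<le> p m" "q m < \<rho>' m" for m
      using r0 r1 r2 \<rho> p0 p1 p2 q by auto
    have gp: "\<exists>t\<in>S. dist y t \<le> a \<and> \<bar>F y \<bullet> \<xi> - F t \<bullet> \<xi>\<bar> \<le> \<eta> \<and> (\<forall>z\<in>S. dist t z < b \<longrightarrow> \<bar>F z \<bullet> \<xi> - F t \<bullet> \<xi>\<bar> \<le> \<eta>)"
      if gp: "\<exists>t\<in>S. dist y t \<le> a \<and> dist (F y) (F t) \<le> \<eta> \<and> (\<forall>z\<in>S. dist t z < c \<longrightarrow> dist (F z) (F t) \<le> \<eta>)"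
        and bc: "b \<le> c" for y a b c
    proof -
      obtain t where t: "t \<in> S" "dist y t \<le> a" "dist (F y) (F t) \<le> \<eta>" "\<forall>z\<in>S. dist t z < c \<longrightarrow> dist (F z) (F t) \<le> \<eta>"
        using gp by blast
      have "\<bar>F z \<bullet> \<xi> - F t \<bullet> \<xi>\<bar> \<le> \<eta>" if "z \<in> S" "dist t z < b" for z
        using t(4) that bc by (intro order_trans[OF inn]) auto
      then show ?thesis using t(1,2) order_trans[OF inn t(3)] by blast
    qed
    fix m y assume y: "y \<in> S"
    show "\<exists>t\<in>S. dist y t \<le> r m \<and> \<bar>F y \<bullet> \<xi> - F t \<bullet> \<xi>\<bar> \<le> \<eta> \<and> (\<forall>z\<in>S. dist t z < \<rho> m \<longrightarrow> \<bar>F z \<bullet> \<xi> - F t \<bullet> \<xi>\<bar> \<le> \<eta>)"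
      by (rule gp[OF \<rho>0(2)[OF y] \<rho>(3)])
    show "\<exists>t\<in>S. dist y t \<le> p m \<and> \<bar>F y \<bullet> \<xi> - F t \<bullet> \<xi>\<bar> \<le> \<eta> \<and> (\<forall>z\<in>S. dist t z < \<rho>' m \<longrightarrow> \<bar>F z \<bullet> \<xi> - F t \<bullet> \<xi>\<bar> \<le> \<eta>)"
      by (rule gp[OF \<rho>'(2)[OF y] order_refl])
  qed
  show thesis
  proof (rule that)
    show "c10_grad X (mol \<epsilon>) (mold \<epsilon> E)" by (rule mol_c10[OF \<epsilon> small])
    show "\<bar>mol \<epsilon> x - u x\<bar> \<le> \<eta>" if "x \<in> X" for x
      by (rule order_trans[OF mol_near[OF \<epsilon> small that] near[OF that]])
    fix \<xi> :: 'a and k :: real assume \<xi>: "norm \<xi> = 1" and k: "0 < k"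
    show "env_close \<eta> (infconv k X (\<lambda>x. mold \<epsilon> E x \<bullet> \<xi>)) (infconv k S (\<lambda>x. F x \<bullet> \<xi>))"
      unfolding env_close_def
    proof (intro ballI conjI)
      fix x assume x: "x \<in> X"
      note compare = infconv_pair.compare[OF pair[OF \<xi>] k x]
      show "\<exists>x'\<in>X. dist x x' \<le> \<eta> \<and> \<bar>infconv k X (\<lambda>x. mold \<epsilon> E x \<bullet> \<xi>) x - infconv k S (\<lambda>x. F x \<bullet> \<xi>) x'\<bar> \<le> 6 * \<eta>"
        by (rule compare(1))
      show "\<exists>x'\<in>X. dist x x' \<le> \<eta> \<and> \<bar>infconv k S (\<lambda>x. F x \<bullet> \<xi>) x - infconv k X (\<lambda>x. mold \<epsilon> E x \<bullet> \<xi>) x'\<bar> \<le> 6 * \<eta>"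
        by (rule compare(2))
      show "\<bar>infconv k X (\<lambda>x. mold \<epsilon> E x \<bullet> \<xi>) x - infconv k S (\<lambda>x. F x \<bullet> \<xi>) x\<bar> \<le> osc \<eta> x + 4 * \<eta>"
      proof (rule compare(3)[OF osc_nonneg[OF x \<eta>(1)]])
        fix y z assume yz: "y \<in> S" "z \<in> S" "dist x y < \<eta>" "dist x z < \<eta>"
        have "F y \<bullet> \<xi> - F z \<bullet> \<xi> \<le> dist (F y) (F z)"
          using norm_cauchy_schwarz[of "F y - F z" \<xi>] \<xi> by (simp add: inner_diff_left dist_norm)
        also have "\<dots> \<le> osc \<eta> x" by (rule osc_ge[OF yz])
        finally show "F y \<bullet> \<xi> - F z \<bullet> \<xi> \<le> osc \<eta> x" .
      qed
    qed
  qed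
qed

text \<open>Approximations are taken at the scales \<open>1 / (n + 1)\<close>. Uniform closeness
  gives convergence of the functions; for the gradients the bound of \<open>delta_le_osc\<close> is
  the same for all \<open>\<xi>\<close> and \<open>k\<close>, hence survives both suprema.\<close>

theorem grad_cl_ae_of_lip_grad:
  assumes f: "cae X f" "ae_eq X f u" and F: "cae X F"
  shows "grad_cl_ae X f F"
proof -
  let ?\<eta> = "\<lambda>n. inverse (real (Suc n))"
  have ne: "0 < ?\<eta> n" "?\<eta> n \<le> 1" for n by (auto simp: field_simps)
  have "\<forall>n. \<exists>p. c10_grad X (fst p) (snd p) \<and> (\<forall>x\<in>X. \<bar>fst p x - u x\<bar> \<le> ?\<eta> n) \<and>
     rv_ae X (snd p) F \<le> (7 + 4 * measure lebesgue X) * ?\<eta> n + (LINT x|lebesgue. indicator X x * osc (?\<eta> n) x)"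
  proof
    fix n
    let ?B = "(7 + 4 * measure lebesgue X) * ?\<eta> n + (LINT x|lebesgue. indicator X x * osc (?\<eta> n) x)"
    obtain w D where w: "c10_grad X w D" "\<And>x. x \<in> X \<Longrightarrow> \<bar>w x - u x\<bar> \<le> ?\<eta> n"
      and close: "\<And>\<xi> k. norm \<xi> = 1 \<Longrightarrow> 0 < k \<Longrightarrow>
        env_close (?\<eta> n) (infconv k X (\<lambda>x. D x \<bullet> \<xi>)) (infconv k S (\<lambda>x. F x \<bullet> \<xi>))"
      by (rule approximation[OF ne]) blast
    have D: "cae X D" "continuous_on X D" using c10_cae(2)[OF w(1)] w(1) by (auto simp: c10_grad_def)
    have "rv_ae X D F \<le> ?B"
    proof (rule rv_ae_le)
      fix \<xi> :: 'a assume \<xi>: "norm \<xi> = 1"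
      then have \<xi>': "norm (- \<xi>) = 1" by simp
      have cp: "X \<subseteq> cont_pts X (\<lambda>x. D x \<bullet> \<xi>)" "S \<subseteq> cont_pts X (\<lambda>x. F x \<bullet> \<xi>)"
        using D(2) S(1) cont_pts_inner[of X F \<xi>] cont_pts_inner[of X D \<xi>] cont_pts_continuous_on[OF D(2)] by auto
      note bd = cae_bounded[OF cae_inner[OF D(1)]] cae_bounded[OF cae_inner[OF F]]
      have XX: "X - X \<in> null_sets lebesgue" by simp
      show "r_ae X (\<lambda>x. D x \<bullet> \<xi>) (\<lambda>x. F x \<bullet> \<xi>) \<le> ?B"
      proof (rule r_ae_le)
        fix k :: nat assume "1 \<le> k"
        then have k: "0 < real k" by simp
        show "delta X (lenv_ae X k (\<lambda>x. D x \<bullet> \<xi>)) (lenv_ae X k (\<lambda>x. F x \<bullet> \<xi>)) \<le> ?B"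
          using lenv_ae_eq[OF X(2) _ bd(1) cp(1) XX] lenv_ae_eq[OF X(2) _ bd(2) cp(2) S(2)]
          by (intro delta_le_osc[OF ne(1)] env_close_cong[OF close[OF \<xi> k]])
        \<comment> \<open>The upper envelope in direction \<open>\<xi>\<close> is the negative of
          the lower envelope in direction \<open>- \<xi>\<close>.\<close>
        show "delta X (uenv_ae X k (\<lambda>x. D x \<bullet> \<xi>)) (uenv_ae X k (\<lambda>x. F x \<bullet> \<xi>)) \<le> ?B"
          using uenv_ae_eq[OF X(2) _ bd(1) cp(1) XX] uenv_ae_eq[OF X(2) _ bd(2) cp(2) S(2)]
          by (intro delta_le_osc[OF ne(1)] env_close_cong[OF env_close_minus[OF close[OF \<xi>' k]]]) simp_all
      qed
    qed
    then show "\<exists>p. c10_grad X (fst p) (snd p) \<and> (\<forall>x\<in>X. \<bar>fst p x - u x\<bar> \<le> ?\<eta> n) \<and> rv_ae X (snd p) F \<le> ?B"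
      using w by (intro exI[of _ "(w, D)"]) simp
  qed
  from choice[OF this] obtain P where P: "\<And>n. c10_grad X (fst (P n)) (snd (P n))"
    "\<And>n x. x \<in> X \<Longrightarrow> \<bar>fst (P n) x - u x\<bar> \<le> ?\<eta> n"
    "\<And>n. rv_ae X (snd (P n)) F \<le> (7 + 4 * measure lebesgue X) * ?\<eta> n + (LINT x|lebesgue. indicator X x * osc (?\<eta> n) x)"
    by blast
  have u: "cae X u" by (rule cae_continuous[OF ub u_continuous])
  have "(\<lambda>n. r_ae X (fst (P n)) u) \<longlonglongrightarrow> 0"
  proof (rule tendsto_sandwich[OF _ _ tendsto_const])
    show "\<forall>\<^sub>F n in sequentially. 0 \<le> r_ae X (fst (P n)) u"
      using r_ae_nonneg[OF c10_cae(1)[OF P(1)] u] by simp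
    show "\<forall>\<^sub>F n in sequentially. r_ae X (fst (P n)) u \<le> ?\<eta> n + ?\<eta> n * measure lebesgue X"
      using r_ae_le_uniform[OF c10_cae(1)[OF P(1)] c10_continuous[OF P(1)] u u_continuous P(2)] by (intro always_eventually) auto
    have "(\<lambda>n. ?\<eta> n + ?\<eta> n * measure lebesgue X) \<longlonglongrightarrow> 0 + 0 * measure lebesgue X"
      by (intro tendsto_intros LIMSEQ_inverse_real_of_nat)
    then show "(\<lambda>n. ?\<eta> n + ?\<eta> n * measure lebesgue X) \<longlonglongrightarrow> 0" by simp
  qed
  moreover have "(\<lambda>n. rv_ae X (snd (P n)) F) \<longlonglongrightarrow> 0"
  proof (rule tendsto_sandwich[OF _ _ tendsto_const])
    show "\<forall>\<^sub>F n in sequentially. 0 \<le> rv_ae X (snd (P n)) F"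
      using rv_ae_nonneg[OF c10_cae(2)[OF P(1)] F] by simp
    show "\<forall>\<^sub>F n in sequentially. rv_ae X (snd (P n)) F \<le> (7 + 4 * measure lebesgue X) * ?\<eta> n + (LINT x|lebesgue. indicator X x * osc (?\<eta> n) x)"
      using P(3) by (intro always_eventually) auto
    have "(\<lambda>n. (7 + 4 * measure lebesgue X) * ?\<eta> n + (LINT x|lebesgue. indicator X x * osc (?\<eta> n) x)) \<longlonglongrightarrow> (7 + 4 * measure lebesgue X) * 0 + 0"
      by (intro tendsto_intros LIMSEQ_inverse_real_of_nat osc_integral_tendsto)
    then show "(\<lambda>n. (7 + 4 * measure lebesgue X) * ?\<eta> n + (LINT x|lebesgue. indicator X x * osc (?\<eta> n) x)) \<longlonglongrightarrow> 0" by simp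
  qed
  ultimately show ?thesis
    unfolding grad_cl_ae_def
    by (intro conjI exI[of _ "\<lambda>n. fst (P n)"] exI[of _ "\<lambda>n. snd (P n)"] f F allI P(1)) (simp_all add: r_ae_cong[OF f(2)])
qed

end

section \<open>The main theorem\<close>

lemma (in grad_limit) limit_lip_grad:
  obtains u L where "lip_grad X (cont_pts X F) u F L" "\<And>x. x \<in> cont_pts X f \<Longrightarrow> u x = f x"
    "\<And>x. x \<in> X \<Longrightarrow> class_value X F x = clarke_grad X u x"
proof -
  obtain u L where u: "L > 0" "\<And>x. x \<in> X \<Longrightarrow> (\<lambda>i. fs i x) \<longlonglongrightarrow> u x"
    "\<And>x. x \<in> cont_pts X f \<Longrightarrow> u x = f x"
    "\<And>a b. closed_segment a b \<subseteq> X \<Longrightarrow> \<bar>u b - u a\<bar> \<le> L * dist a b"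
    by (rule limit_exists) blast
  obtain M where M: "M \<ge> 0" "\<And>x. x \<in> X \<Longrightarrow> norm (F x) \<le> M" using bounded_normD[OF cae_bounded[OF F]] by blast
  obtain B where B: "\<And>x. x \<in> X \<Longrightarrow> \<bar>f x\<bar> \<le> B" using bounded_realD[OF cae_bounded[OF f]] by blast
  \<comment> \<open>The bound of \<open>f\<close> applies to \<open>u\<close> only at continuity
    points of \<open>f\<close>; any other point has such a point within distance 1, at a cost of at
    most \<open>L\<close>.\<close>
  have ub: "\<bar>u x\<bar> \<le> B + L" if x: "x \<in> X" for x
  proof -
    obtain r where r: "r > 0" "ball x r \<subseteq> X" using X(2) x openE by blast
    have "x \<in> closure (cont_pts X f)" using conull_dense[OF X(2) cae_conull[OF f]] x by blast
    moreover have "min r 1 > 0" using r(1) by simp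
    ultimately obtain y where y: "y \<in> cont_pts X f" "dist y x < min r 1" unfolding closure_approachable by blast
    have "closed_segment y x \<subseteq> X"
      using y(2) r by (intro order_trans[OF closed_segment_subset r(2)]) (auto simp: dist_commute)
    then have "\<bar>u x - u y\<bar> \<le> L * dist y x" by (rule u(4))
    also have "\<dots> \<le> L * 1" using y(2) u(1) by (intro mult_left_mono) auto
    finally have "\<bar>u x - u y\<bar> \<le> L" by simp
    moreover have "\<bar>u y\<bar> \<le> B" using B[OF cont_ptsD(1)[OF y(1)]] u(3)[OF y(1)] by simp
    ultimately show ?thesis by linarith
  qed
  have "lip_grad X (cont_pts X F) u F (max L M)"
  proof
    show "cont_pts X F \<subseteq> cont_pts X F" "X - cont_pts X F \<in> null_sets lebesgue"
      using cae_conull[OF F] by auto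
    show "norm (F x) \<le> max L M" if "x \<in> X" for x using M(2)[OF that] by simp
    show "0 < max L M" using u(1) by simp
    show "\<bar>u b - u a\<bar> \<le> max L M * dist a b" if "closed_segment a b \<subseteq> X" for a b
      using u(4)[OF that] by (rule order_trans) (auto intro: mult_right_mono)
    show "GDERIV u y :> F y" if "y \<in> cont_pts X F" for y by (rule limit_gderiv[OF u(2) that])
    show "bounded (u ` X)" using ub by (intro boundedI[of _ "B + L"]) auto
  qed
  then show thesis by (rule that) (simp_all add: u(3) limit_clarke[OF u(2)])
qed

section \<open>The closed operator: uniqueness, Clarke gradient and algebra\<close>

context bounded_domain
begin

lemma grad_cl_ae_lip_grad:
  assumes "grad_cl_ae X f F"
  obtains u L where "lip_grad X (cont_pts X F) u F L" "\<And>x. x \<in> cont_pts X f \<Longrightarrow> u x = f x"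
    "\<And>x. x \<in> X \<Longrightarrow> class_value X F x = clarke_grad X u x"
proof -
  obtain fs Ds where "cae X f" "cae X F" "\<And>i. c10_grad X (fs i) (Ds i)"
    "(\<lambda>i. r_ae X (fs i) f) \<longlonglongrightarrow> 0" "(\<lambda>i. rv_ae X (Ds i) F) \<longlonglongrightarrow> 0"
    using assms unfolding grad_cl_ae_def by blast
  then interpret grad_limit X fs Ds f F by unfold_locales
  show thesis by (rule limit_lip_grad) (rule that)
qed

lemma conull_Int:
  "X - A \<in> null_sets lebesgue \<Longrightarrow> X - B \<in> null_sets lebesgue \<Longrightarrow> X - A \<inter> B \<in> null_sets lebesgue"
  by (simp add: Diff_Int null_sets.Un)

lemma ae_eq_of_conull:
  assumes "X - S \<in> null_sets lebesgue" "\<And>x. x \<in> S \<Longrightarrow> f x = g x" shows "ae_eq X f g"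
  unfolding ae_eq_def using AE_not_in[OF assms(1)] by eventually_elim (use assms(2) in auto)

text \<open>The two limit functions agree with \<open>h\<close> on a dense set and are continuous,
  so they coincide on \<open>X\<close>; uniqueness of the gradient then applies at common continuity
  points of \<open>F\<close> and \<open>G\<close>.\<close>

lemma preclosed:
  assumes "grad_limit X fs Dfs h F" "grad_limit X gs Dgs h G"
  shows "ae_eq X F G"
proof -
  obtain u L where u: "lip_grad X (cont_pts X F) u F L" "\<And>x. x \<in> cont_pts X h \<Longrightarrow> u x = h x"
    by (rule grad_limit.limit_lip_grad[OF assms(1)]) blast
  obtain w L' where w: "lip_grad X (cont_pts X G) w G L'" "\<And>x. x \<in> cont_pts X h \<Longrightarrow> w x = h x"
    by (rule grad_limit.limit_lip_grad[OF assms(2)]) blast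
  have h: "cae X h" using grad_limit.f[OF assms(1)] .
  have uw: "u x = w x" if "x \<in> X" for x
  proof -
    have d: "continuous_on X (\<lambda>x. u x - w x)"
      by (intro continuous_on_diff lip_grad.u_continuous[OF u(1)] lip_grad.u_continuous[OF w(1)])
    show ?thesis
    proof (rule ccontr)
      assume ne: "u x \<noteq> w x"
      let ?U = "X \<inter> (\<lambda>x. u x - w x) -` (- {0})"
      have "open ?U" by (rule continuous_open_preimage[OF d X(2)]) (simp add: open_Compl)
      moreover have "x \<in> ?U \<inter> X" using ne that by simp
      ultimately obtain y where "y \<in> cont_pts X h" "y \<in> ?U"
        using conull_meets_open[OF X(2) cae_conull[OF h], of ?U] by blast
      with u(2)[of y] w(2)[of y] show False by simp
    qed
  qed
  show ?thesis
  proof (rule ae_eq_of_conull)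
    show "X - cont_pts X F \<inter> cont_pts X G \<in> null_sets lebesgue"
      using grad_limit.F[OF assms(1)] grad_limit.F[OF assms(2)] by (intro conull_Int cae_conull)
    fix x assume x: "x \<in> cont_pts X F \<inter> cont_pts X G"
    then have xX: "x \<in> X" using cont_ptsD(1) by blast
    have "GDERIV u x :> F x" using x by (intro lip_grad.ug[OF u(1)]) simp
    then have "GDERIV w x :> F x" by (rule gderiv_transform_open[OF _ X(2) xX uw])
    moreover have "GDERIV w x :> G x" using x by (intro lip_grad.ug[OF w(1)]) simp
    ultimately show "F x = G x" by (rule gderiv_unique)
  qed
qed

lemma grad_cl_ae_clarke:
  assumes "grad_cl_ae X f F"
  shows "\<exists>g. locally_lipschitz_on X g \<and> ae_eq X f g \<and> (\<forall>x\<in>X. class_value X F x = clarke_grad X g x)"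
proof -
  obtain u L where u: "lip_grad X (cont_pts X F) u F L" "\<And>x. x \<in> cont_pts X f \<Longrightarrow> u x = f x"
    "\<And>x. x \<in> X \<Longrightarrow> class_value X F x = clarke_grad X u x"
    by (rule grad_cl_ae_lip_grad[OF assms]) blast
  have "\<exists>e>0. \<exists>L. L-lipschitz_on (ball x e \<inter> X) u" if x: "x \<in> X" for x
  proof -
    obtain r where r: "r > 0" "ball x r \<subseteq> X" using X(2) x openE by blast
    have "L-lipschitz_on (ball x r \<inter> X) u"
    proof (rule lipschitz_onI)
      fix a b assume "a \<in> ball x r \<inter> X" "b \<in> ball x r \<inter> X"
      then have "closed_segment b a \<subseteq> X" by (intro order_trans[OF closed_segment_subset r(2)]) auto
      then show "dist (u a) (u b) \<le> L * dist a b"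
        using lip_grad.ulip[OF u(1), of b a] by (simp add: dist_real_def dist_commute)
    qed (use lip_grad.L[OF u(1)] in simp)
    then show ?thesis using r(1) by blast
  qed
  then have "locally_lipschitz_on X u" by (simp add: locally_lipschitz_on_def)
  moreover have "ae_eq X f u"
    using assms u(2) by (intro ae_eq_of_conull[OF cae_conull]) (auto simp: grad_cl_ae_def)
  ultimately show ?thesis using u(3) by blast
qed

text \<open>Together with \<open>grad_cl_ae_lip_grad\<close> this describes the closed graph by
  Lipschitz functions, so that algebraic operations can be carried out on them and no approximating
  sequences have to be combined.\<close>

lemma grad_cl_aeI:
  assumes u: "lip_grad X S u F L" and f: "bounded (f ` X)" "S \<subseteq> cont_pts X f" "\<And>x. x \<in> S \<Longrightarrow> f x = u x"
  shows "grad_cl_ae X f F"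
proof (rule lip_grad.grad_cl_ae_of_lip_grad[OF u])
  note S = lip_grad.S[OF u]
  show "cae X f" by (rule cae_of_conull[OF f(1,2) S(2)])
  have "bounded (F ` X)" using lip_grad.FL[OF u] by (intro boundedI[of _ L]) auto
  then show "cae X F" by (rule cae_of_conull[OF _ S])
  show "ae_eq X f u" by (rule ae_eq_of_conull[OF S(2) f(3)])
qed

lemma grad_cl_ae_const: "grad_cl_ae X (\<lambda>x. c) (\<lambda>x. 0)"
proof (rule grad_cl_aeI)
  show b: "bounded ((\<lambda>x. c) ` X)" by (rule boundedI[of _ "norm c"]) auto
  show "X \<subseteq> cont_pts X (\<lambda>x. c)" by (simp add: cont_pts_def)
  \<comment> \<open>The constant is 1 and not 0 because \<open>lip_grad\<close> demands a positive
    one.\<close>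
  show "lip_grad X X (\<lambda>x. c) (\<lambda>x. 0) 1"
    by unfold_locales (auto simp: b cont_pts_def intro: GDERIV_const)
qed simp

lemma lip_grad_mono:
  assumes u: "lip_grad X S u F L" and S': "S' \<subseteq> S" "X - S' \<in> null_sets lebesgue" and "L \<le> L'"
  shows "lip_grad X S' u F L'"
proof
  interpret lip_grad X S u F L by (rule u)
  show "S' \<subseteq> cont_pts X F" "X - S' \<in> null_sets lebesgue" "bounded (u ` X)" "0 < L'"
    using S S' ub L assms(4) by auto
  show "norm (F x) \<le> L'" if "x \<in> X" for x using FL[OF that] assms(4) by linarith
  show "GDERIV u y :> F y" if "y \<in> S'" for y using ug that S'(1) by blast
  show "\<bar>u b - u a\<bar> \<le> L' * dist a b" if "closed_segment a b \<subseteq> X" for a b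
    using ulip[OF that] by (rule order_trans) (use assms(4) in \<open>auto intro: mult_right_mono\<close>)
qed

text \<open>Intersecting four conull sets puts both pairs on one \<open>S\<close> with one constant,
  and there the representatives agree with their Lipschitz versions.\<close>

lemma grad_cl_ae_pairE:
  assumes "grad_cl_ae X f F" "grad_cl_ae X g G"
  obtains u w S L where "lip_grad X S u F L" "lip_grad X S w G L"
    "S \<subseteq> cont_pts X f" "S \<subseteq> cont_pts X g" "\<And>x. x \<in> S \<Longrightarrow> f x = u x" "\<And>x. x \<in> S \<Longrightarrow> g x = w x"
proof -
  have cae: "cae X f" "cae X F" "cae X g" "cae X G" using assms by (auto simp: grad_cl_ae_def)
  obtain u L where u: "lip_grad X (cont_pts X F) u F L" "\<And>x. x \<in> cont_pts X f \<Longrightarrow> u x = f x"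
    by (rule grad_cl_ae_lip_grad[OF assms(1)]) blast
  obtain w K where w: "lip_grad X (cont_pts X G) w G K" "\<And>x. x \<in> cont_pts X g \<Longrightarrow> w x = g x"
    by (rule grad_cl_ae_lip_grad[OF assms(2)]) blast
  let ?S = "(cont_pts X F \<inter> cont_pts X G) \<inter> (cont_pts X f \<inter> cont_pts X g)"
  have S: "X - ?S \<in> null_sets lebesgue" by (intro conull_Int cae_conull cae)
  show thesis
  proof (rule that)
    show "lip_grad X ?S u F (max L K)" by (rule lip_grad_mono[OF u(1) _ S]) auto
    show "lip_grad X ?S w G (max L K)" by (rule lip_grad_mono[OF w(1) _ S]) auto
  qed (use u(2) w(2) in auto)
qed

lemma grad_cl_ae_linear:
  assumes "grad_cl_ae X f F" "grad_cl_ae X g G"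
  shows "grad_cl_ae X (\<lambda>x. c * f x + g x) (\<lambda>x. c *\<^sub>R F x + G x)"
proof -
  obtain u w S L where u: "lip_grad X S u F L" and w: "lip_grad X S w G L"
    and fg: "S \<subseteq> cont_pts X f" "S \<subseteq> cont_pts X g" "\<And>x. x \<in> S \<Longrightarrow> f x = u x" "\<And>x. x \<in> S \<Longrightarrow> g x = w x"
    by (rule grad_cl_ae_pairE[OF assms]) blast
  interpret u: lip_grad X S u F L by (rule u)
  interpret w: lip_grad X S w G L by (rule w)
  have bf: "bounded ((\<lambda>x. c * p x + q x) ` X)" if "bounded (p ` X)" "bounded (q ` X)" for p q :: "'a \<Rightarrow> real"
    using bounded_plus_comp[OF bounded_scaleR_comp[OF that(1), of c] that(2)] by simp
  show ?thesis
  proof (rule grad_cl_aeI)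
    show "bounded ((\<lambda>x. c * f x + g x) ` X)"
      using assms by (intro bf cae_bounded) (auto simp: grad_cl_ae_def)
    show "S \<subseteq> cont_pts X (\<lambda>x. c * f x + g x)"
      using fg(1,2) by (auto simp: cont_pts_def intro!: continuous_intros)
    show "c * f x + g x = c * u x + w x" if "x \<in> S" for x using fg(3,4) that by simp
    show "lip_grad X S (\<lambda>x. c * u x + w x) (\<lambda>x. c *\<^sub>R F x + G x) (\<bar>c\<bar> * L + L)"
    proof
      show "S \<subseteq> cont_pts X (\<lambda>x. c *\<^sub>R F x + G x)"
        using u.S(1) w.S(1) by (auto simp: cont_pts_def intro!: continuous_intros)
      show "X - S \<in> null_sets lebesgue" by (rule u.S(2))
      show "norm (c *\<^sub>R F x + G x) \<le> \<bar>c\<bar> * L + L" if "x \<in> X" for x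
        using u.FL[OF that] w.FL[OF that] by (intro norm_triangle_le add_mono) (auto intro: mult_left_mono)
      show "0 < \<bar>c\<bar> * L + L" using u.L by (simp add: add_nonneg_pos)
      show "bounded ((\<lambda>x. c * u x + w x) ` X)" by (rule bf[OF u.ub w.ub])
      fix a b assume ab: "closed_segment a b \<subseteq> X"
      have "\<bar>c * (u b - u a)\<bar> \<le> \<bar>c\<bar> * (L * dist a b)" using u.ulip[OF ab] by (simp add: abs_mult mult_left_mono)
      then show "\<bar>(c * u b + w b) - (c * u a + w a)\<bar> \<le> (\<bar>c\<bar> * L + L) * dist a b"
        using w.ulip[OF ab] unfolding distrib_right right_diff_distrib mult.assoc by linarith
    next
      fix y assume y: "y \<in> S"
      show "GDERIV (\<lambda>x. c * u x + w x) y :> c *\<^sub>R F y + G y"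
        using GDERIV_add[OF GDERIV_mult[OF GDERIV_const[of c y] u.ug[OF y]] w.ug[OF y]] by simp
    qed
  qed
qed

text \<open>The gradient is written with the representatives \<open>f\<close> and \<open>g\<close>,
  which may differ from \<open>u\<close> and \<open>w\<close> on a null set. On \<open>S\<close> it
  is the Leibniz expression in \<open>u\<close> and \<open>w\<close>, and continuous there.\<close>

lemma grad_cl_ae_mult:
  assumes "grad_cl_ae X f F" "grad_cl_ae X g G"
  shows "grad_cl_ae X (\<lambda>x. f x * g x) (\<lambda>x. f x *\<^sub>R G x + g x *\<^sub>R F x)"
proof -
  obtain u w S L where u: "lip_grad X S u F L" and w: "lip_grad X S w G L"
    and fg: "S \<subseteq> cont_pts X f" "S \<subseteq> cont_pts X g" "\<And>x. x \<in> S \<Longrightarrow> f x = u x" "\<And>x. x \<in> S \<Longrightarrow> g x = w x"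
    by (rule grad_cl_ae_pairE[OF assms]) blast
  interpret u: lip_grad X S u F L by (rule u)
  interpret w: lip_grad X S w G L by (rule w)
  have "bounded (f ` X \<union> g ` X \<union> (u ` X \<union> w ` X))"
    using assms u.ub w.ub by (auto simp: grad_cl_ae_def cae_def)
  then obtain B where "\<forall>v\<in>f ` X \<union> g ` X \<union> (u ` X \<union> w ` X). norm v \<le> B" unfolding bounded_iff by blast
  then have B: "\<bar>f x\<bar> \<le> B" "\<bar>g x\<bar> \<le> B" "\<bar>u x\<bar> \<le> B" "\<bar>w x\<bar> \<le> B" if "x \<in> X" for x using that by auto
  \<comment> \<open>\<open>B\<close> might be 0; a factor of at least 1 keeps the Lipschitz constant
    positive.\<close>
  define A where "A = max 1 B"
  have A: "1 \<le> A" "B \<le> A" by (auto simp: A_def)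
  have bf: "bounded ((\<lambda>x. p x * q x) ` X)" if pq: "\<And>x. x \<in> X \<Longrightarrow> \<bar>p x\<bar> \<le> B" "\<And>x. x \<in> X \<Longrightarrow> \<bar>q x\<bar> \<le> B"
    for p q :: "'a \<Rightarrow> real"
  proof (rule boundedI[of _ "B * B"], clarify)
    fix x assume x: "x \<in> X"
    have "0 \<le> B" using pq(1)[OF x] by linarith
    then show "norm (p x * q x) \<le> B * B" using pq[OF x] by (auto simp: abs_mult intro!: mult_mono)
  qed
  show ?thesis
  proof (rule grad_cl_aeI)
    show "bounded ((\<lambda>x. f x * g x) ` X)" by (rule bf[OF B(1,2)])
    show "S \<subseteq> cont_pts X (\<lambda>x. f x * g x)"
      using fg(1,2) by (auto simp: cont_pts_def intro!: continuous_intros)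
    show "f x * g x = u x * w x" if "x \<in> S" for x using fg(3,4) that by simp
    show "lip_grad X S (\<lambda>x. u x * w x) (\<lambda>x. f x *\<^sub>R G x + g x *\<^sub>R F x) (A * L + A * L)"
    proof
      show "S \<subseteq> cont_pts X (\<lambda>x. f x *\<^sub>R G x + g x *\<^sub>R F x)"
        using u.S(1) w.S(1) fg(1,2) by (auto simp: cont_pts_def subset_iff intro!: continuous_intros)
      show "X - S \<in> null_sets lebesgue" by (rule u.S(2))
      show "norm (f x *\<^sub>R G x + g x *\<^sub>R F x) \<le> A * L + A * L" if x: "x \<in> X" for x
      proof (rule norm_triangle_le[OF add_mono])
        show "norm (f x *\<^sub>R G x) \<le> A * L" "norm (g x *\<^sub>R F x) \<le> A * L"
          using u.FL[OF x] w.FL[OF x] A B(1,2)[OF x] by (auto intro!: mult_mono)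
      qed
      show "0 < A * L + A * L" using u.L A(1) by (simp add: add_pos_pos)
      show "bounded ((\<lambda>x. u x * w x) ` X)" by (rule bf[OF B(3,4)])
      fix a b assume ab: "closed_segment a b \<subseteq> X"
      then have X: "a \<in> X" "b \<in> X" by auto
      have "\<bar>u b * (w b - w a)\<bar> \<le> A * (L * dist a b)" "\<bar>w a * (u b - u a)\<bar> \<le> A * (L * dist a b)"
        using A B(3)[OF X(2)] B(4)[OF X(1)] u.ulip[OF ab] w.ulip[OF ab] by (auto simp: abs_mult intro!: mult_mono)
      moreover have "u b * w b - u a * w a = u b * (w b - w a) + w a * (u b - u a)" by (simp add: algebra_simps)
      ultimately have "\<bar>u b * w b - u a * w a\<bar> \<le> A * (L * dist a b) + A * (L * dist a b)" by linarith
      then show "\<bar>u b * w b - u a * w a\<bar> \<le> (A * L + A * L) * dist a b" by (simp add: algebra_simps)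
    next
      fix y assume y: "y \<in> S"
      show "GDERIV (\<lambda>x. u x * w x) y :> f y *\<^sub>R G y + g y *\<^sub>R F y"
        using GDERIV_mult[OF u.ug[OF y] w.ug[OF y]] fg(3,4)[OF y] by simp
    qed
  qed
qed

end

theorem theorem4p1:
  fixes X :: "'a::euclidean_space set"
  assumes "X \<noteq> {}" and "open X" and "bounded X"
  shows
    \<comment> \<open>(i) preclosedness\<close>
    "(\<forall>fs Dfs gs Dgs h F G.
        (\<forall>i. c10_grad X (fs i) (Dfs i)) \<and> (\<forall>i. c10_grad X (gs i) (Dgs i)) \<and>
        cae X h \<and> cae X F \<and> cae X G \<and>
        (\<lambda>i. r_ae X (fs i) h) \<longlonglongrightarrow> 0 \<and> (\<lambda>i. r_ae X (gs i) h) \<longlonglongrightarrow> 0 \<and>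
        (\<lambda>i. rv_ae X (Dfs i) F) \<longlonglongrightarrow> 0 \<and> (\<lambda>i. rv_ae X (Dgs i) G) \<longlonglongrightarrow> 0
        \<longrightarrow> ae_eq X F G)
     \<and> Delta_ae X \<subseteq> Delta_cm X
     \<and> (\<forall>f F. grad_cl_ae X f F \<longrightarrow>
          (\<exists>g. locally_lipschitz_on X g \<and> ae_eq X f g \<and>
               (\<forall>x\<in>X. class_value X F x = clarke_grad X g x)))
     \<comment> \<open>(ii) linearity\<close>
     \<and> grad_cl_ae X (\<lambda>x. 0) (\<lambda>x. 0)
     \<and> (\<forall>f F g G (c::real). grad_cl_ae X f F \<and> grad_cl_ae X g G \<longrightarrow>
          grad_cl_ae X (\<lambda>x. c * f x + g x) (\<lambda>x. c *\<^sub>R F x + G x))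
     \<comment> \<open>(iii) subring and product rule\<close>
     \<and> grad_cl_ae X (\<lambda>x. 1) (\<lambda>x. 0)
     \<and> (\<forall>f F g G. grad_cl_ae X f F \<and> grad_cl_ae X g G \<longrightarrow>
          grad_cl_ae X (\<lambda>x. f x * g x) (\<lambda>x. f x *\<^sub>R G x + g x *\<^sub>R F x))"
proof -
  interpret bounded_domain X using assms by unfold_locales
  have "ae_eq X F G"
    if "\<forall>i. c10_grad X (fs i) (Dfs i)" "\<forall>i. c10_grad X (gs i) (Dgs i)" "cae X h" "cae X F" "cae X G"
      "(\<lambda>i. r_ae X (fs i) h) \<longlonglongrightarrow> 0" "(\<lambda>i. r_ae X (gs i) h) \<longlonglongrightarrow> 0"
      "(\<lambda>i. rv_ae X (Dfs i) F) \<longlonglongrightarrow> 0" "(\<lambda>i. rv_ae X (Dgs i) G) \<longlonglongrightarrow> 0"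
    for fs Dfs gs Dgs h F G
    by (rule preclosed[of fs Dfs h F gs Dgs G]) (unfold_locales, use that in auto)
  moreover have "Delta_ae X \<subseteq> Delta_cm X"
    using grad_cl_ae_imp_cm by (auto simp: Delta_ae_def Delta_cm_def)
  ultimately show ?thesis
    using grad_cl_ae_clarke grad_cl_ae_const grad_cl_ae_linear grad_cl_ae_mult
    by (intro conjI allI impI) auto
qed

end
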